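(* Let $\mu$ be a partition of $n$, and let $\theta_\mu:\mathcal{T}(\mu)\to\mathcal{T}((1^n))$ be the canonical embedding of the set of column strict tableaux of content $\mu$ (and arbitrary partition shape) into the set of standard tableaux with $n$ cells. Then the image of $\theta_\mu$ is the set of standard tableaux $S$ with $n$ cells such that $\mathrm{cattype}(S)\trianglerighteq\mu$.
   Context: Tableaux are in English notation; column strict means weakly increasing along rows and strictly increasing down columns. The content of a tableau is $(c_1,c_2,\dots)$ with $c_i$ the number of letters $i$. The row-reading word of a tableau is $\cdots w^2w^1$, where $w^i$ is its $i$-th row read left to right. For a word $u$, $P(u)$ is the unique column strict tableau of partition shape whose row-reading word is Knuth equivalent to $u$ (Schensted's $P$-tableau); a tableau inside $P(\cdot)$ stands for its row-reading word. For a composition (finite sequence of nonnegative integers, trailing zeros allowed) $\alpha$, $\alpha^+$ is the partition obtained by sorting it, and $\mathcal{T}(\alpha)$ is the set of column strict tableaux of content $\alpha$ and arbitrary partition shape. For partitions of the same size, $\mu\trianglerighteq\nu$ means $\mu_1+\dots+\mu_i\ge\nu_1+\dots+\nu_i$ for all $i$; for compositions, $\alpha\trianglerighteq\beta$ means $\alpha^+\trianglerighteq\beta^+$. Crystal reflections: in a word $u$ regard each letter $r$ as a right parenthesis and each $r+1$ as a left parenthesis, ignoring other letters, and match parentheses; the unmatched ($r$-unpaired) letters form a subword $r^p(r+1)^q$. The operator $s_r$ replaces this subword by $r^q(r+1)^p$; the lowering operator $f_r$ (defined if $p>0$) replaces it by $r^{p-1}(r+1)^{q+1}$. These act on tableaux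 through the row-reading word, preserving shape. The $s_r$ satisfy the Coxeter relations, so permutations act on tableaux by $wT=s_{i_1}\cdots s_{i_p}T$ for a reduced word of $w$. Embeddings $\theta^\beta_\alpha:\mathcal{T}(\alpha)\to\mathcal{T}(\beta)$ for $\alpha\trianglerighteq\beta$: (i) if $\alpha^+=\beta^+$, $\theta^\beta_\alpha(T)=wT$ for any permutation $w$ with $w\alpha=\beta$; (ii) if $\beta=\alpha+(-1,1,0,\dots)$ with $\alpha_1>\alpha_2+1$, $\theta^\beta_\alpha=f_1$ (it changes the rightmost letter 1 to a 2); (iii) in general choose a sequence $\alpha=\gamma^0,\gamma^1,\dots,\gamma^p=\beta$ in which each consecutive pair is of type (i) or (ii) and let $\theta^\beta_\alpha$ be the composite of the corresponding maps. It is known (Lascoux) that this is independent of the choices, shape-preserving and injective. Put $\theta_\alpha=\theta_\alpha^{(1^n)}$ for $|\alpha|=n$. Catabolism type: for a standard tableau $S$, $\mathrm{Cat}(S)=P(S_nS_s)$ where $S_n$ is the first row of $S$ and $S_s$ is the rest of $S$. Let $d_1(S)$ be the maximal $i$ such that $1,2,\dots,i$ all lie in the first row of $S$. Then $\mathrm{cattype}(S)$ is the sequence whose first part is $d_1(S)$ and whose $(i+1)$-st part is $d_1(\mathrm{Cat}^{i}(S))-d_1(\mathrm{Cat}^{i-1}(S))$ for $i\ge1$; it is a partition of $n$. *)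

theory Defs
  imports "HOL-Combinatorics.Permutations"
begin

section \<open>Tableaux\<close>

text \<open>
  A tableau (English notation) is the list of its rows, top row first. Letters are positive,
  and there are no empty rows, so that a tableau of partition shape has a unique representation.
\<close>

type_synonym tableau = "nat list list"

definition column_strict :: "tableau \<Rightarrow> bool" where
  "column_strict T \<longleftrightarrow>
     (\<forall>row \<in> set T. row \<noteq> [] \<and> sorted row \<and> 0 \<notin> set row) \<and>
     (\<forall>i. Suc i < length T \<longrightarrow>
        length (T ! Suc i) \<le> length (T ! i) \<and>
        (\<forall>j < length (T ! Suc i). T ! i ! j < T ! Suc i ! j))"

definition row_word :: "tableau \<Rightarrow> nat list" where
  "row_word T = concat (rev T)"

definition first_row :: "tableau \<Rightarrow> nat list" where
  "first_row T = (case T of [] \<Rightarrow> [] | row # _ \<Rightarrow> row)"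


section \<open>Compositions\<close>

text \<open>
  A composition is a list of natural numbers. Its parts are numbered from 1, and parts beyond the
  end of the list are 0; compositions are only ever compared through their parts, so that
  trailing zeros are irrelevant.
\<close>

definition part :: "nat list \<Rightarrow> nat \<Rightarrow> nat" where
  "part \<alpha> i = (if 1 \<le> i \<and> i \<le> length \<alpha> then \<alpha> ! (i - 1) else 0)"

definition partition_of :: "nat list \<Rightarrow> nat \<Rightarrow> bool" where
  "partition_of \<mu> n \<longleftrightarrow> sorted_wrt (\<ge>) \<mu> \<and> 0 \<notin> set \<mu> \<and> sum_list \<mu> = n"

text \<open>The partition \<open>\<alpha>\<^sup>+\<close>, up to trailing zeros.\<close>

definition sort_parts :: "nat list \<Rightarrow> nat list" where
  "sort_parts \<alpha> = rev (sort \<alpha>)"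

definition dominates :: "nat list \<Rightarrow> nat list \<Rightarrow> bool"  (infix "\<unrhd>" 50) where
  "\<alpha> \<unrhd> \<beta> \<longleftrightarrow>
     sum_list \<alpha> = sum_list \<beta> \<and>
     (\<forall>i. sum_list (take i (sort_parts \<beta>)) \<le> sum_list (take i (sort_parts \<alpha>)))"

definition tableaux :: "nat list \<Rightarrow> tableau set" where
  "tableaux \<alpha> = {T. column_strict T \<and> (\<forall>i. count_list (row_word T) i = part \<alpha> i)}"

abbreviation standard_tableaux :: "nat \<Rightarrow> tableau set" where
  "standard_tableaux n \<equiv> tableaux (replicate n 1)"


section \<open>Knuth equivalence and Schensted's P-tableau\<close>

inductive knuth_step :: "nat list \<Rightarrow> nat list \<Rightarrow> bool" where
  "x \<le> y \<Longrightarrow> y < z \<Longrightarrow> knuth_step (u @ [x, z, y] @ v) (u @ [z, x, y] @ v)"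
| "x < y \<Longrightarrow> y \<le> z \<Longrightarrow> knuth_step (u @ [y, x, z] @ v) (u @ [y, z, x] @ v)"

definition knuth_equiv :: "nat list \<Rightarrow> nat list \<Rightarrow> bool" where
  "knuth_equiv = equivclp knuth_step"

definition P_tableau :: "nat list \<Rightarrow> tableau" where
  "P_tableau u = (THE T. column_strict T \<and> knuth_equiv (row_word T) u)"


section \<open>Crystal operators\<close>

text \<open>
  The positions of the \<open>r\<close>-unpaired letters of a word: \<open>i\<close> is the position of the head of the
  remaining word, and \<open>stack\<close> holds the positions of the letters \<open>r + 1\<close> (left parentheses)
  that are still open, innermost first.
\<close>

fun unpaired_from :: "nat \<Rightarrow> nat \<Rightarrow> nat list \<Rightarrow> nat list \<Rightarrow> nat set" where
  "unpaired_from r i [] stack = set stack"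
| "unpaired_from r i (x # u) stack =
     (if x = Suc r then unpaired_from r (Suc i) u (i # stack)
      else if x = r then
        (case stack of
           [] \<Rightarrow> insert i (unpaired_from r (Suc i) u [])
         | _ # stack' \<Rightarrow> unpaired_from r (Suc i) u stack')
      else unpaired_from r (Suc i) u stack)"

definition unpaired :: "nat \<Rightarrow> nat list \<Rightarrow> nat set" where
  "unpaired r u = unpaired_from r 0 u []"

definition num_unpaired :: "nat \<Rightarrow> nat list \<Rightarrow> nat \<Rightarrow> nat" where
  "num_unpaired r u x = card {k \<in> unpaired r u. u ! k = x}"

text \<open>
  Replace the subword of \<open>r\<close>-unpaired letters by the word of the same length that consists of
  \<open>p\<close> letters \<open>r\<close> followed by letters \<open>r + 1\<close>.
\<close>

definition set_unpaired :: "nat \<Rightarrow> nat \<Rightarrow> nat list \<Rightarrow> nat list" where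
  "set_unpaired r p u =
     map (\<lambda>j. if j \<in> unpaired r u
              then (if card {k \<in> unpaired r u. k < j} < p then r else Suc r)
              else u ! j)
         [0..<length u]"

definition reflect_word :: "nat \<Rightarrow> nat list \<Rightarrow> nat list" where
  "reflect_word r u = set_unpaired r (num_unpaired r u (Suc r)) u"

text \<open>
  The lowering operator is only meaningful when there is an unpaired letter \<open>r\<close>; otherwise the
  truncated subtraction makes it the identity. Below it is only relevant for \<open>r = 1\<close> and
  words with more letters 1 than letters 2.
\<close>

definition lower_word :: "nat \<Rightarrow> nat list \<Rightarrow> nat list" where
  "lower_word r u = set_unpaired r (num_unpaired r u r - 1) u"

text \<open>Operators on words act on tableaux by refilling the same shape.\<close>

fun cut :: "nat list \<Rightarrow> nat list \<Rightarrow> nat list list" where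
  "cut [] u = []"
| "cut (k # ks) u = take k u # cut ks (drop k u)"

definition on_tableau :: "(nat list \<Rightarrow> nat list) \<Rightarrow> tableau \<Rightarrow> tableau" where
  "on_tableau g T = rev (cut (map length (rev T)) (g (row_word T)))"

definition reflect :: "nat \<Rightarrow> tableau \<Rightarrow> tableau" where
  "reflect r = on_tableau (reflect_word r)"

definition lower :: "nat \<Rightarrow> tableau \<Rightarrow> tableau" where
  "lower r = on_tableau (lower_word r)"


section \<open>The action of permutations\<close>

text \<open>Words in the adjacent transpositions \<open>(r r+1)\<close>, \<open>r \<ge> 1\<close>.\<close>

definition word_for :: "(nat \<Rightarrow> nat) \<Rightarrow> nat list \<Rightarrow> bool" where
  "word_for w rs \<longleftrightarrow> 0 \<notin> set rs \<and> w = foldr (\<lambda>r g. transpose r (Suc r) \<circ> g) rs id"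

definition reduced_word :: "(nat \<Rightarrow> nat) \<Rightarrow> nat list \<Rightarrow> bool" where
  "reduced_word w rs \<longleftrightarrow> word_for w rs \<and> (\<forall>rs'. word_for w rs' \<longrightarrow> length rs \<le> length rs')"

text \<open>The action does not depend on the reduced word chosen.\<close>

definition perm_act :: "(nat \<Rightarrow> nat) \<Rightarrow> tableau \<Rightarrow> tableau" where
  "perm_act w = foldr reflect (SOME rs. reduced_word w rs)"


section \<open>The canonical embeddings\<close>

text \<open>
  The elementary maps. In the first rule the hypothesis on parts says \<open>w\<alpha> = \<beta>\<close>; such a \<open>w\<close>
  exists if and only if \<open>\<alpha>\<^sup>+ = \<beta>\<^sup>+\<close>.
\<close>

inductive elementary_embedding ::
    "nat list \<Rightarrow> nat list \<Rightarrow> (tableau \<Rightarrow> tableau) \<Rightarrow> bool" where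
  permute: "w permutes {1..N} \<Longrightarrow> (\<And>i. part \<beta> (w i) = part \<alpha> i) \<Longrightarrow>
     elementary_embedding \<alpha> \<beta> (perm_act w)"
| lowering: "part \<alpha> 1 > part \<alpha> 2 + 1 \<Longrightarrow>
     (\<And>i. part \<beta> i =
        (if i = 1 then part \<alpha> 1 - 1 else if i = 2 then part \<alpha> 2 + 1 else part \<alpha> i)) \<Longrightarrow>
     elementary_embedding \<alpha> \<beta> (lower 1)"

text \<open>
  \<open>composite_embedding \<alpha> \<beta> F\<close>: the map \<open>F\<close> is the composite of the elementary maps along some
  sequence of compositions from \<open>\<alpha>\<close> to \<open>\<beta>\<close>.
\<close>

inductive composite_embedding ::
    "nat list \<Rightarrow> nat list \<Rightarrow> (tableau \<Rightarrow> tableau) \<Rightarrow> bool" where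
  base: "composite_embedding \<alpha> \<alpha> id"
| step: "composite_embedding \<alpha> \<beta> F \<Longrightarrow> elementary_embedding \<beta> \<gamma> G \<Longrightarrow>
     composite_embedding \<alpha> \<gamma> (G \<circ> F)"

text \<open>
  For \<open>\<alpha> \<unrhd> \<beta>\<close>, the restriction of this map to \<open>tableaux \<alpha>\<close> does not depend on the choice
  of the sequence and of the permutations (Lascoux).
\<close>

definition canonical_embedding :: "nat list \<Rightarrow> nat list \<Rightarrow> tableau \<Rightarrow> tableau" where
  "canonical_embedding \<alpha> \<beta> = (SOME F. composite_embedding \<alpha> \<beta> F)"

definition standardization_embedding :: "nat list \<Rightarrow> tableau \<Rightarrow> tableau" where
  "standardization_embedding \<alpha> = canonical_embedding \<alpha> (replicate (sum_list \<alpha>) 1)"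


section \<open>Catabolism type\<close>

definition Cat :: "tableau \<Rightarrow> tableau" where
  "Cat S = P_tableau (first_row S @ row_word (tl S))"

definition d1 :: "tableau \<Rightarrow> nat" where
  "d1 S = Max {i. {1..i} \<subseteq> set (first_row S)}"

text \<open>
  For a standard tableau with \<open>n\<close> cells, \<open>d1 ((Cat ^^ i) S)\<close> strictly increases with \<open>i\<close> until it
  reaches \<open>n\<close>; so the subtraction does not truncate, and the parts after the first \<open>n\<close> vanish.
\<close>

definition cattype :: "tableau \<Rightarrow> nat list" where
  "cattype S =
     map (\<lambda>i. if i = 0 then d1 S else d1 ((Cat ^^ i) S) - d1 ((Cat ^^ (i - 1)) S))
         [0..<length (row_word S)]"

end

theory Submission
  imports Defs
begin

text \<open>
  Moving the first row of a tableau to the front of its reading word commutes with the crystal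
  reflections, which only depend on the cyclic bracketing of a word, and with the lowering
  operator \<open>f\<^sub>1\<close>, because all letters 1 of a tableau lie in its first row. Hence every
  composite of elementary maps preserves the sequence of shapes of \<open>T, Cat T, Cat\<^sup>2 T, \<dots>\<close>.
  A standard tableau is determined by this sequence: \<open>Cat S\<close> and the shape of \<open>S\<close> determine
  \<open>S\<close> since products with a row are multiplicity free (Pieri). So \<open>S\<close> lies in the image
  of the embedding iff some \<open>T\<close> of content \<open>\<mu>\<close> has the same shape sequence as \<open>S\<close>.

  If \<open>T\<close> has content \<open>\<mu>\<close>, then \<open>Cat T\<close> is \<open>1\<close> repeated \<open>\<mu>\<^sub>1\<close> times, prepended to the first
  row of a tableau in larger letters whose content is \<open>\<mu>\<close> without its first part. Applying the
  embedding to that smaller tableau shows, by induction on \<open>\<mu>\<close>, that the first row of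
  \<open>Cat\<^sup>i S\<close> contains \<open>1, \<dots>, \<mu>\<^sub>1 + \<dots> + \<mu>\<^sub>i\<^sub>+\<^sub>1\<close> for all \<open>i\<close>, which is the dominance of the
  catabolism type. Conversely such an \<open>S\<close> is lifted to a \<open>T\<close> by induction: the factorization of
  the reading word of \<open>Cat S\<close> is pulled back through the embedding of the smaller tableau, and the
  result is a tableau because no part of \<open>\<mu>\<close> exceeds \<open>\<mu>\<^sub>1\<close>.
\<close>

text \<open>Dominance compares sorted compositions, whereas the runs in the first rows control the
  partial sums of the catabolism type in its given order. The two agree because the type is weakly
  decreasing, which needs an argument of its own: a long run after a catabolism forces the order in
  which \<open>x\<close> and \<open>x + 1\<close> occur in a word, and for distinct letters this
  order is invariant under Knuth equivalence.

  Uniqueness in the Pieri step arises in an awkward form: the row stands to the left of the word,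
  while row insertion adds letters on the right. Reversing a word without repetitions exchanges the
  two Knuth relations; it transposes the tableau and moves the row to the right end, where bumping
  can be reversed.

  The embedding is fixed by a choice operator only. This is harmless, since every composite sends
  \<open>T\<close> to the one standard tableau with the shape sequence of \<open>T\<close>.

  Lifting is the delicate direction. Without its \<open>k\<close> smallest letters the first row
  need not fit above the second; what survives is the weaker inequality \<open>below k\<close>, and
  it has to be carried through all intermediate contents.\<close>

notation knuth_equiv (infix "\<approx>" 50)

section \<open>Knuth equivalence as a congruence\<close>

lemma knuth_refl [simp]: "u \<approx> u"
  unfolding knuth_equiv_def by simp

lemma knuth_sym: "u \<approx> v \<Longrightarrow> v \<approx> u"
  unfolding knuth_equiv_def by (rule equivclp_sym)

lemma knuth_trans [trans]: "u \<approx> v \<Longrightarrow> v \<approx> w \<Longrightarrow> u \<approx> w"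
  unfolding knuth_equiv_def by (rule equivclp_trans)

lemma knuth_of_step: "knuth_step u v \<Longrightarrow> u \<approx> v"
  unfolding knuth_equiv_def by (rule r_into_equivclp)

lemma knuth_induct [consumes 1, case_names base step]:
  assumes "u \<approx> v" "P u" "\<And>v w. P v \<Longrightarrow> knuth_step v w \<or> knuth_step w v \<Longrightarrow> P w"
  shows "P v"
  using assms unfolding knuth_equiv_def
  by (induction rule: equivclp_induct) auto

lemma knuth_step_cong: "knuth_step u v \<Longrightarrow> knuth_step (a @ u @ b) (a @ v @ b)"
proof (induction rule: knuth_step.induct)
  case (1 x y z u v)
  then show ?case using knuth_step.intros(1)[of x y z "a @ u" "v @ b"] by simp
next
  case (2 x y z u v)
  then show ?case using knuth_step.intros(2)[of x y z "a @ u" "v @ b"] by simp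
qed

lemma knuth_cong: "u \<approx> v \<Longrightarrow> a @ u @ b \<approx> a @ v @ b"
proof (induction rule: knuth_induct)
  case (step v w)
  then show ?case by (metis knuth_of_step knuth_sym knuth_trans knuth_step_cong)
qed simp

lemma knuth_append: "u \<approx> v \<Longrightarrow> a \<approx> b \<Longrightarrow> u @ a \<approx> v @ b"
  by (metis append_Nil append_Nil2 knuth_cong knuth_trans)

lemma knuth_Cons: "u \<approx> v \<Longrightarrow> x # u \<approx> x # v"
  using knuth_cong[of u v "[x]" "[]"] by simp

lemma knuth_xzy: "x \<le> y \<Longrightarrow> y < z \<Longrightarrow> [x, z, y] @ v \<approx> [z, x, y] @ v"
  using knuth_of_step[OF knuth_step.intros(1)[of x y z "[]" v]] by simp

lemma knuth_yxz: "x < y \<Longrightarrow> y \<le> z \<Longrightarrow> [y, x, z] @ v \<approx> [y, z, x] @ v"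
  using knuth_of_step[OF knuth_step.intros(2)[of x y z "[]" v]] by simp

lemma knuth_triple:
  "x \<le> y \<Longrightarrow> y < z \<Longrightarrow> [x,z,y] \<approx> [z,x,y]"
  "x \<le> y \<Longrightarrow> y < z \<Longrightarrow> [z,x,y] \<approx> [x,z,y]"
  "x < y \<Longrightarrow> y \<le> z \<Longrightarrow> [y,x,z] \<approx> [y,z,x]"
  "x < y \<Longrightarrow> y \<le> z \<Longrightarrow> [y,z,x] \<approx> [y,x,z]"
  using knuth_xzy[of x y z "[]"] knuth_yxz[of x y z "[]"] by (auto intro: knuth_sym)

lemma knuth_mset: "u \<approx> v \<Longrightarrow> mset u = mset v"
  by (induction rule: knuth_induct) (auto elim!: knuth_step.cases)

lemma knuth_count: "u \<approx> v \<Longrightarrow> count_list u x = count_list v x"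
  by (metis knuth_mset count_mset)

lemma knuth_set: "u \<approx> v \<Longrightarrow> set u = set v"
  by (metis knuth_mset set_mset_mset)

lemma knuth_length: "u \<approx> v \<Longrightarrow> length u = length v"
  by (metis knuth_mset size_mset)

lemma knuth_distinct: "u \<approx> v \<Longrightarrow> distinct u \<longleftrightarrow> distinct v"
  by (metis knuth_mset mset_eq_imp_distinct_iff)

text \<open>For distinct letters all inequalities are strict, and then reading backwards turns each
  of the two Knuth relations into the other. With repeated letters the weak and the strict
  inequality would change sides.\<close>

lemma knuth_rev:
  assumes "u \<approx> v" "distinct u"
  shows "rev u \<approx> rev v"
proof -
  have *: "rev v \<approx> rev w" if "knuth_step v w" "distinct v" for v w
    using that
  proof (induction rule: knuth_step.induct)
    case (1 x y z u v)
    then have "x < y" by auto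
    then show ?case using 1 knuth_cong[OF knuth_triple(4)[of x y z], of "rev v" "rev u"] by simp
  next
    case (2 x y z u v)
    then have "y < z" by auto
    then show ?case using 2 knuth_cong[OF knuth_triple(2)[of x y z], of "rev v" "rev u"] by simp
  qed
  have "distinct v \<and> rev u \<approx> rev v"
    using assms(1)
  proof (induction rule: knuth_induct)
    case base
    then show ?case using assms by simp
  next
    case (step v w)
    have "distinct w" using step knuth_distinct[OF knuth_of_step, of v w] knuth_distinct[OF knuth_of_step, of w v]
      by blast
    then show ?case using step * by (metis knuth_sym knuth_trans)
  qed
  then show ?thesis by simp
qed

section \<open>Row insertion\<close>

fun row_ins :: "nat \<Rightarrow> nat list \<Rightarrow> nat list" where
  "row_ins x [] = [x]"
| "row_ins x (y # R) = (if x < y then x # R else y # row_ins x R)"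

text \<open>The result is a list of length at most one, so that the letters bumped by a word can
  simply be concatenated into the word for the next row.\<close>

fun bump :: "nat \<Rightarrow> nat list \<Rightarrow> nat list" where
  "bump x [] = []"
| "bump x (y # R) = (if x < y then [y] else bump x R)"

fun insert_word :: "nat list \<Rightarrow> nat list \<Rightarrow> nat list" where
  "insert_word R [] = R"
| "insert_word R (x # w) = insert_word (row_ins x R) w"

fun bumps :: "nat list \<Rightarrow> nat list \<Rightarrow> nat list" where
  "bumps R [] = []"
| "bumps R (x # w) = bump x R @ bumps (row_ins x R) w"

lemma insert_word_append [simp]: "insert_word R (u @ v) = insert_word (insert_word R u) v"
  by (induction u arbitrary: R) auto

lemma bumps_append [simp]: "bumps R (u @ v) = bumps R u @ bumps (insert_word R u) v"
  by (induction u arbitrary: R) auto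

lemma row_ins_bump_cases:
  assumes "sorted R"
  obtains "bump x R = []" "\<forall>y\<in>set R. y \<le> x" "row_ins x R = R @ [x]"
  | A b C where "bump x R = [b]" "R = A @ b # C" "\<forall>y\<in>set A. y \<le> x" "x < b" "row_ins x R = A @ x # C"
proof -
  have "(bump x R = [] \<and> (\<forall>y\<in>set R. y \<le> x) \<and> row_ins x R = R @ [x]) \<or>
     (\<exists>A b C. bump x R = [b] \<and> R = A @ b # C \<and> (\<forall>y\<in>set A. y \<le> x) \<and> x < b \<and> row_ins x R = A @ x # C)"
    using assms
  proof (induction R)
    case (Cons y R)
    show ?case
    proof (cases "x < y")
      case True then show ?thesis
        by (intro disjI2 exI[of _ "[]"] exI[of _ y] exI[of _ R]) auto
    next
      case False
      from Cons consider "bump x R = []" "\<forall>y\<in>set R. y \<le> x" "row_ins x R = R @ [x]"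
        | A b C where "bump x R = [b]" "R = A @ b # C" "\<forall>y\<in>set A. y \<le> x" "x < b" "row_ins x R = A @ x # C"
        by auto
      then show ?thesis
      proof cases
        case 1 then show ?thesis using False by auto
      next
        case (2 A b C)
        then show ?thesis using False
          by (intro disjI2 exI[of _ "y # A"] exI[of _ b] exI[of _ C]) auto
      qed
    qed
  qed auto
  then show ?thesis using that by blast
qed

lemma sorted_row_ins: "sorted R \<Longrightarrow> sorted (row_ins x R)"
  by (rule row_ins_bump_cases[of R x]) (auto simp: sorted_append)

lemma sorted_insert_word: "sorted R \<Longrightarrow> sorted (insert_word R w)"
  by (induction w arbitrary: R) (auto intro: sorted_row_ins)

lemma mset_row_ins: "mset (row_ins x R) + mset (bump x R) = mset R + {#x#}"
  by (induction R) auto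

lemma mset_insert_word: "mset (insert_word R w) + mset (bumps R w) = mset R + mset w"
proof (induction w arbitrary: R)
  case (Cons x w)
  have "mset (insert_word R (x # w)) + mset (bumps R (x # w)) = mset (bump x R) + (mset (row_ins x R) + mset w)"
    using Cons[of "row_ins x R"] by (simp add: ac_simps)
  also have "\<dots> = mset R + mset (x # w)"
    using mset_row_ins[of x R] by (simp add: ac_simps flip: add.assoc)
  finally show ?case .
qed simp

lemma length_insert_word: "length (insert_word R w) + length (bumps R w) = length R + length w"
  using mset_insert_word[of R w] by (metis size_mset size_union)

lemma set_bump: "set (bump x R) \<subseteq> set R"
  by (induction R) auto

lemma bump_gt: "b \<in> set (bump x R) \<Longrightarrow> x < b"
  by (induction R) (auto split: if_splits)

lemma bump_row_ins_less: "y < z \<Longrightarrow> \<exists>b. bump y (row_ins z R) = [b] \<and> b \<le> z \<and> b \<in> insert z (set R)"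
  by (induction R) auto

lemma length_bump: "bump x R = [] \<or> (\<exists>b. bump x R = [b])"
  by (induction R) auto

lemma bump_row_ins_ge:
  assumes "y \<le> z" "bump z (row_ins y R) = [c]" "sorted R"
  shows "\<exists>a. bump y R = [a] \<and> y < a \<and> a \<le> c \<and> a \<in> set R"
  using assms
proof (induction R)
  case (Cons h R)
  then show ?case using set_bump[of z R] by (auto split: if_splits)
qed simp

text \<open>All three letters pass a head that is at most \<open>x\<close>, so the induction has
  work only where \<open>x\<close> displaces the head. There the bumped letters are again related by
  a Knuth move; this is the core of the invariance of Schensted's algorithm.\<close>

lemma knuth1_row:
  assumes "sorted R" "x \<le> y" "y < z"
  shows "insert_word R [x,z,y] = insert_word R [z,x,y] \<and> bumps R [x,z,y] \<approx> bumps R [z,x,y]"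
  using assms(1)
proof (induction R)
  case Nil
  then show ?case using assms by auto
next
  case (Cons h R)
  then have IH: "insert_word R [x,z,y] = insert_word R [z,x,y]" "bumps R [x,z,y] \<approx> bumps R [z,x,y]" by auto
  have hR: "\<And>g. g \<in> set R \<Longrightarrow> h \<le> g" using Cons by auto
  show ?case
  proof (cases "h \<le> x")
    case True
    then show ?thesis using IH assms by auto
  next
    case False
    show ?thesis
    proof (cases "z < h")
      case True
      show ?thesis
      proof (cases R)
        case Nil
        then show ?thesis using True False assms by auto
      next
        case (Cons g R')
        then have "h \<le> g" using hR by auto
        then have "[h, z, g] \<approx> [h, g, z]" using knuth_yxz[of z h g "[]"] True by auto
        then show ?thesis using True False assms Cons \<open>h \<le> g\<close> by (auto intro: knuth_sym)
      qed
    next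
      case z: False
      obtain b where b: "bump y (row_ins z R) = [b]" "b \<le> z" "b \<in> insert z (set R)"
        using bump_row_ins_less[OF assms(3)] by blast
      consider "bump z R = []" | b1 where "bump z R = [b1]" "z < b1"
        using length_bump[of z R] bump_gt[of _ z R] by (metis list.set_intros(1))
      then show ?thesis
      proof cases
        case 1
        then show ?thesis using z False assms b by auto
      next
        case (2 b1)
        have "h \<le> b" using b hR z by auto
        then have "[h, b1, b] \<approx> [b1, h, b]" using knuth_xzy[of h b b1 "[]"] 2 b by auto
        then show ?thesis using z False assms b 2 by auto
      qed
    qed
  qed
qed

lemma knuth2_row:
  assumes "sorted R" "x < y" "y \<le> z"
  shows "insert_word R [y,x,z] = insert_word R [y,z,x] \<and> bumps R [y,x,z] \<approx> bumps R [y,z,x]"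
  using assms(1)
proof (induction R)
  case Nil
  then show ?case using assms by auto
next
  case (Cons h R)
  then have IH: "insert_word R [y,x,z] = insert_word R [y,z,x]" "bumps R [y,x,z] \<approx> bumps R [y,z,x]" by auto
  have hR: "\<And>g. g \<in> set R \<Longrightarrow> h \<le> g" using Cons by auto
  show ?case
  proof (cases "h \<le> x")
    case True
    then show ?thesis using IH assms by auto
  next
    case False
    show ?thesis
    proof (cases "y < h")
      case True
      consider "bump z R = []" | b where "bump z R = [b]" "h \<le> b"
        using length_bump[of z R] set_bump[of z R] hR by (metis list.set_intros(1) subsetD)
      then show ?thesis
      proof cases
        case 1
        then show ?thesis using True False assms by auto
      next
        case (2 b)
        then have "[h, y, b] \<approx> [h, b, y]" using knuth_yxz[of y h b "[]"] True by auto
        then show ?thesis using True False assms 2 by auto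
      qed
    next
      case y: False
      consider "bump z (row_ins y R) = []" | c where "bump z (row_ins y R) = [c]"
        using length_bump[of z "row_ins y R"] by blast
      then show ?thesis
      proof cases
        case 1
        then show ?thesis using y False assms by auto
      next
        case (2 c)
        then obtain a where a: "bump y R = [a]" "y < a" "a \<le> c" "a \<in> set R"
          using bump_row_ins_ge[OF assms(3)] Cons by fastforce
        then have "[a, h, c] \<approx> [a, c, h]" using knuth_yxz[of h a c "[]"] y by auto
        then show ?thesis using y False assms 2 a by auto
      qed
    qed
  qed
qed

lemma knuth_step_row:
  assumes "knuth_step u v" "sorted R"
  shows "insert_word R u = insert_word R v \<and> bumps R u \<approx> bumps R v"
  using assms
proof (induction rule: knuth_step.induct)
  case (1 x y z u v)
  let ?R = "insert_word R u"
  have k: "insert_word ?R [x,z,y] = insert_word ?R [z,x,y]" "bumps ?R [x,z,y] \<approx> bumps ?R [z,x,y]"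
    using knuth1_row[OF sorted_insert_word[OF 1(3)] 1(1,2)] by auto
  show ?case
    using k(1) knuth_cong[OF k(2), of "bumps R u" "bumps (insert_word ?R [z,x,y]) v"]
    by (simp only: insert_word_append bumps_append k(1))
next
  case (2 x y z u v)
  let ?R = "insert_word R u"
  have k: "insert_word ?R [y,x,z] = insert_word ?R [y,z,x]" "bumps ?R [y,x,z] \<approx> bumps ?R [y,z,x]"
    using knuth2_row[OF sorted_insert_word[OF 2(3)] 2(1,2)] by auto
  show ?case
    using k(1) knuth_cong[OF k(2), of "bumps R u" "bumps (insert_word ?R [y,z,x]) v"]
    by (simp only: insert_word_append bumps_append k(1))
qed

lemma knuth_row:
  assumes "u \<approx> v" "sorted R"
  shows "insert_word R u = insert_word R v \<and> bumps R u \<approx> bumps R v"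
  using assms by (induction rule: knuth_induct) (auto dest: knuth_step_row knuth_sym knuth_trans)

lemma row_ins_nonempty: "row_ins x R \<noteq> []"
  by (cases R) auto

lemma insert_word_nonempty: "R \<noteq> [] \<or> w \<noteq> [] \<Longrightarrow> insert_word R w \<noteq> []"
  by (induction w arbitrary: R) (auto simp: row_ins_nonempty)

text \<open>The tableau is built row by row instead of letter by letter: the whole word passes
  through the first row and the bumped letters form the word for the rest. Invariance under Knuth
  equivalence is then an induction whose step is \<open>knuth_row\<close>.\<close>

function schensted :: "nat list \<Rightarrow> tableau" where
  "schensted [] = []"
| "w \<noteq> [] \<Longrightarrow> schensted w = insert_word [] w # schensted (bumps [] w)"
  by auto
termination
proof (relation "measure length")
  fix w :: "nat list" assume "w \<noteq> []"
  then show "(bumps [] w, w) \<in> measure length"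
    using length_insert_word[of "[]" w] insert_word_nonempty[of "[]" w] by (cases "insert_word [] w") auto
qed simp

lemma length_bumps_less: "w \<noteq> [] \<Longrightarrow> length (bumps [] w) < length w"
  using length_insert_word[of "[]" w] insert_word_nonempty[of "[]" w] by (cases "insert_word [] w") auto

lemma knuth_imp_schensted_eq: "u \<approx> v \<Longrightarrow> schensted u = schensted v"
proof (induction "length u" arbitrary: u v rule: less_induct)
  case less
  show ?case
  proof (cases "u = []")
    case True then show ?thesis using knuth_length[OF less(2)] by simp
  next
    case False
    then have "v \<noteq> []" using knuth_length[OF less(2)] by auto
    then show ?thesis using False less knuth_row[OF less(2), of "[]"] length_bumps_less[OF False]
      by simp
  qed
qed

lemma knuth_move_left:
  assumes "sorted (y # R)" "x < y"
  shows "y # R @ [x] \<approx> y # x # R"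
  using assms
proof (induction R arbitrary: y)
  case (Cons z R)
  have "y # z # R @ [x] \<approx> y # z # x # R" using knuth_Cons[OF Cons.IH[of z]] Cons.prems by auto
  also have "\<dots> \<approx> y # x # z # R" using knuth_sym[OF knuth_yxz[of x y z R]] Cons by auto
  finally show ?case by simp
qed simp

lemma knuth_row_ins: "sorted R \<Longrightarrow> R @ [x] \<approx> bump x R @ row_ins x R"
proof (induction R)
  case (Cons y R)
  show ?case
  proof (cases "x < y")
    case True then show ?thesis using knuth_move_left[of y R x] Cons by auto
  next
    case False
    have IH: "y # R @ [x] \<approx> y # bump x R @ row_ins x R" using Cons by (intro knuth_Cons) auto
    consider "bump x R = []" | b where "bump x R = [b]" "x < b"
      using length_bump[of x R] bump_gt[of _ x R] by (metis list.set_intros(1))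
    then show ?thesis
    proof cases
      case 1 then show ?thesis using IH False by auto
    next
      case (2 b)
      obtain c D where c: "row_ins x R = c # D" using row_ins_nonempty by (cases "row_ins x R") auto
      have "c \<le> x" using c by (cases R) (auto split: if_splits)
      moreover have "y \<le> c" using c Cons False by (cases R) (auto split: if_splits)
      ultimately have "y # b # c # D \<approx> b # y # c # D" using knuth_xzy[of y c b D] 2 by auto
      then show ?thesis using IH False 2 c knuth_trans by auto
    qed
  qed
qed simp

lemma knuth_insert_word: "sorted R \<Longrightarrow> R @ w \<approx> bumps R w @ insert_word R w"
proof (induction w arbitrary: R)
  case (Cons x w)
  have "R @ x # w \<approx> (bump x R @ row_ins x R) @ w"
    using knuth_append[OF knuth_row_ins[OF Cons(2), of x], of w w] by simp
  also have "\<dots> \<approx> bump x R @ bumps (row_ins x R) w @ insert_word (row_ins x R) w"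
    using knuth_append[OF knuth_refl Cons(1)[OF sorted_row_ins[OF Cons(2)]]] by simp
  finally show ?case by simp
qed simp

lemma knuth_schensted: "row_word (schensted w) \<approx> w"
proof (induction w rule: schensted.induct)
  case (2 w)
  have "w \<approx> bumps [] w @ insert_word [] w" using knuth_insert_word[of "[]" w] by simp
  moreover have "bumps [] w @ insert_word [] w \<approx> row_word (schensted (bumps [] w)) @ insert_word [] w"
    using 2 by (intro knuth_append) (auto intro: knuth_sym)
  ultimately show ?case using 2 by (auto simp: row_word_def intro: knuth_sym knuth_trans)
qed (simp add: row_word_def)

section \<open>Column strictness by counting\<close>

abbreviation "num_le x R \<equiv> length (filter (\<lambda>y. y \<le> x) R)"
abbreviation "num_less x R \<equiv> length (filter (\<lambda>y. y < x) R)"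

text \<open>
  \<open>R'\<close> fits below the row that consists of \<open>k\<close> small letters followed by \<open>R\<close>; for \<open>k = 0\<close> this is
  column strictness of sorted rows.
\<close>

definition below :: "nat \<Rightarrow> nat list \<Rightarrow> nat list \<Rightarrow> bool" where
  "below k R' R \<longleftrightarrow> (\<forall>x. num_le x R' \<le> k + num_less x R)"

lemma sorted_filter_le_less:
  assumes "sorted (R::nat list)" "j < length R"
  shows "R ! j < x \<longleftrightarrow> j < num_less x R"
  using assms
proof (induction R arbitrary: j)
  case (Cons a R)
  show ?case
  proof (cases "a < x")
    case True then show ?thesis using Cons by (cases j) auto
  next
    case False
    then have "filter (\<lambda>y. y < x) R = []" using Cons by (auto simp: filter_empty_conv)
    moreover have "a \<le> (a # R) ! j" using Cons by (metis Cons.prems sorted_nth_mono nth_Cons_0 le0)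
    ultimately show ?thesis using False by auto
  qed
qed simp

lemma below_iff:
  assumes "sorted R" "sorted R'"
  shows "below 0 R' R \<longleftrightarrow> length R' \<le> length R \<and> (\<forall>j<length R'. R ! j < R' ! j)"
proof
  assume b: "below 0 R' R"
  \<comment> \<open>A threshold above every letter of \<open>R'\<close> turns the comparison of
    counts into one of lengths.\<close>
  have "length R' \<le> length (filter (\<lambda>y. y < Suc (Max (insert 0 (set R')))) R)"
  proof -
    have "filter (\<lambda>y. y \<le> Suc (Max (insert 0 (set R')))) R' = R'"
      by (rule filter_True) (auto intro: le_SucI)
    then show ?thesis using b[unfolded below_def, rule_format, of "Max (insert 0 (set R'))"]
      by (metis (no_types, lifting) b[unfolded below_def] List.finite_set Max_ge add_0 dual_order.trans filter_True finite.insertI insert_iff le_refl less_Suc_eq_le length_filter_le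
        filter_cong le_SucI below_def)
  qed
  then have l: "length R' \<le> length R" by (meson le_trans length_filter_le)
  have "R ! j < R' ! j" if "j < length R'" for j
  proof -
    have "R' ! j < Suc (R' ! j)" by simp
    then have "j < length (filter (\<lambda>y. y < Suc (R' ! j)) R')"
      using sorted_filter_le_less[OF assms(2) that] by blast
    also have "\<dots> \<le> length (filter (\<lambda>y. y < R' ! j) R)"
      using b[unfolded below_def, rule_format, of "R' ! j"] by (simp add: less_Suc_eq_le)
    finally show ?thesis using sorted_filter_le_less[OF assms(1), of j] l that by auto
  qed
  then show "length R' \<le> length R \<and> (\<forall>j<length R'. R ! j < R' ! j)" using l by auto
next
  assume a: "length R' \<le> length R \<and> (\<forall>j<length R'. R ! j < R' ! j)"
  show "below 0 R' R" unfolding below_def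
  proof
    fix x
    show "num_le x R' \<le> 0 + num_less x R"
    proof (rule ccontr)
      assume n: "\<not> ?thesis"
      let ?j = "num_less x R"
      have j: "?j < num_less (Suc x) R'" using n by (simp add: less_Suc_eq_le)
      then have j2: "?j < length R'" by (meson length_filter_le less_le_trans)
      then have "R' ! ?j < Suc x" using sorted_filter_le_less[OF assms(2) j2] j by blast
      then have "R ! ?j < x" using a j2 by fastforce
      then show False using sorted_filter_le_less[OF assms(1), of ?j x] a j2 by auto
    qed
  qed
qed

lemma column_strict_iff:
  "column_strict T \<longleftrightarrow> (\<forall>row \<in> set T. row \<noteq> [] \<and> sorted row \<and> 0 \<notin> set row) \<and>
    (\<forall>i. Suc i < length T \<longrightarrow> below 0 (T ! Suc i) (T ! i))"
  unfolding column_strict_def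
  by (metis (no_types, lifting) Suc_lessD below_iff nth_mem)

lemma column_strict_Nil [simp]: "column_strict []"
  by (simp add: column_strict_def)

lemma column_strict_Cons:
  "column_strict (R # T) \<longleftrightarrow> R \<noteq> [] \<and> sorted R \<and> 0 \<notin> set R \<and> column_strict T \<and>
    (T \<noteq> [] \<longrightarrow> below 0 (hd T) R)"
proof -
  have "(\<forall>i. Suc i < length (R # T) \<longrightarrow> below 0 ((R # T) ! Suc i) ((R # T) ! i)) \<longleftrightarrow>
     (T \<noteq> [] \<longrightarrow> below 0 (hd T) R) \<and> (\<forall>i. Suc i < length T \<longrightarrow> below 0 (T ! Suc i) (T ! i))"
    (is "?L \<longleftrightarrow> ?R")
  proof
    assume L: ?L
    show ?R
    proof (intro conjI impI allI)
      assume "T \<noteq> []" then show "below 0 (hd T) R" using L[rule_format, of 0] by (simp add: hd_conv_nth)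
    next
      fix i assume "Suc i < length T" then show "below 0 (T ! Suc i) (T ! i)" using L[rule_format, of "Suc i"] by simp
    qed
  next
    assume ?R
    then show ?L by (auto simp: nth_Cons hd_conv_nth split: nat.splits)
  qed
  then show ?thesis unfolding column_strict_iff by auto
qed

lemma below_insert:
  assumes "sorted R" "sorted R'" "below 0 R' R"
  shows "below 0 (insert_word R' (bump x R)) (row_ins x R)"
  using assms(1)
proof (rule row_ins_bump_cases[of R x])
  assume "bump x R = []" "row_ins x R = R @ [x]"
  then show ?thesis using assms(3) by (auto simp: below_def intro: le_SucI)
next
  fix A b C assume 1: "bump x R = [b]" "R = A @ b # C" "\<forall>y\<in>set A. y \<le> x" "x < b" "row_ins x R = A @ x # C"
  have b: "num_le t R' \<le> num_less t R" for t
    using assms(3) by (auto simp: below_def)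
  from 1 have e: "insert_word R' (bump x R) = row_ins b R'" by simp
  \<comment> \<open>Between \<open>b\<close> and the next larger letter of \<open>R'\<close> the
    inserted \<open>b\<close> raises the count below. The slack comes from the threshold
    \<open>b\<close>, at which the letter \<open>b\<close> of the old upper row was not yet
    counted.\<close>
  have bb: "num_le b R' \<le> num_less t A + num_less t C"
    if "b < t" for t
  proof -
    have "num_less b C = 0" using assms(1) 1(2)
      by (auto simp: sorted_append filter_empty_conv)
    moreover have "num_less b A \<le> num_less t A"
      using that by (induction A) auto
    ultimately show ?thesis using b[of b] 1(2) by auto
  qed
  have "num_le t (row_ins b R') \<le> num_less t (row_ins x R)" for t
    using assms(2)
  proof (rule row_ins_bump_cases[of R' b])
    assume 2: "\<forall>y\<in>set R'. y \<le> b" "row_ins b R' = R' @ [b]"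
    show ?thesis
    proof (cases "b < t")
      case True
      have "filter (\<lambda>y. y \<le> t) R' = filter (\<lambda>y. y \<le> b) R'" using 2 True by (intro filter_cong) auto
      then show ?thesis using bb[OF True] 1 2 True by (auto)
    next
      case False
      then show ?thesis using b[of t] 1 2 by auto
    qed
  next
    fix A' b' C' assume 2: "R' = A' @ b' # C'" "\<forall>y\<in>set A'. y \<le> b" "b < b'" "row_ins b R' = A' @ b # C'"
    show ?thesis
    proof (cases "b < t \<and> t < b'")
      case True
      have C0: "filter (\<lambda>y. y \<le> t) C' = []" using assms(2) 2 True
        by (auto simp: sorted_append filter_empty_conv)
      have "filter (\<lambda>y. y \<le> t) A' = filter (\<lambda>y. y \<le> b) A'" using 2 True by (intro filter_cong) auto
      then show ?thesis using bb[of t] 1 2 True C0 by auto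
    next
      case False
      then show ?thesis using b[of t] 1 2 by auto
    qed
  qed
  then show ?thesis using e by (simp add: below_def)
qed

lemma below_insert_word: "below 0 (insert_word [] (bumps [] w)) (insert_word [] w)"
proof (induction w rule: rev_induct)
  case (snoc x w)
  then show ?case using below_insert[of "insert_word [] w" "insert_word [] (bumps [] w)" x] sorted_insert_word[of "[]"]
    by simp
qed (simp add: below_def)

lemma column_strict_schensted: "0 \<notin> set w \<Longrightarrow> column_strict (schensted w)"
proof (induction w rule: schensted.induct)
  case (2 w)
  have s: "set (insert_word [] w) \<union> set (bumps [] w) = set w"
    using mset_insert_word[of "[]" w] by (metis mset.simps(1) add_0 set_mset_mset set_mset_union)
  have "below 0 (hd (schensted (bumps [] w))) (insert_word [] w)" if "schensted (bumps [] w) \<noteq> []"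
  proof -
    have "bumps [] w \<noteq> []" using that by auto
    then show ?thesis using below_insert_word[of w] by simp
  qed
  then show ?case using 2 s sorted_insert_word[of "[]" w] insert_word_nonempty[of "[]" w] by (auto simp: column_strict_Cons)
qed simp

text \<open>\<open>A\<close> is the part of the new row that is already inserted and
  \<open>H\<close> what is left of the old row. Since \<open>R\<close> fits above \<open>H\<close>,
  each letter of \<open>R\<close> bumps exactly the head of \<open>H\<close>.\<close>

lemma insert_word_over:
  assumes "sorted (A @ R)" "length H \<le> length R" "\<And>j. j < length H \<Longrightarrow> R ! j < H ! j"
    and "sorted H"
  shows "insert_word (A @ H) R = A @ R \<and> bumps (A @ H) R = H"
  using assms
proof (induction R arbitrary: A H)
  case (Cons x R)
  have A: "row_ins x (A @ H') = A @ row_ins x H'" "bump x (A @ H') = bump x H'" for H'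
  proof -
    have "\<forall>a\<in>set A. a \<le> x" using Cons by (auto simp: sorted_append)
    then show "row_ins x (A @ H') = A @ row_ins x H'" "bump x (A @ H') = bump x H'" by (induction A) auto
  qed
  show ?case
  proof (cases H)
    case Nil
    then show ?thesis using Cons.IH[of "A @ [x]" "[]"] Cons.prems A[of "[]"] by simp
  next
    case c: (Cons h H')
    have "x < h" using Cons.prems(3)[of 0] c by auto
    moreover have "\<And>j. j < length H' \<Longrightarrow> R ! j < H' ! j" using Cons.prems(3)[of "Suc _"] c by auto
    ultimately show ?thesis using Cons.IH[of "A @ [x]" H'] Cons.prems c A by auto
  qed
qed simp

lemma row_word_Cons: "row_word (R # T) = row_word T @ R"
  by (simp add: row_word_def)

lemma row_word_Nil [simp]: "row_word [] = []"
  by (simp add: row_word_def)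

lemma insert_word_row_word:
  "column_strict T \<Longrightarrow> insert_word [] (row_word T) = (case T of [] \<Rightarrow> [] | R # _ \<Rightarrow> R) \<and> bumps [] (row_word T) = row_word (tl T)"
proof (induction T)
  case (Cons R T)
  show ?case
  proof (cases T)
    case Nil
    then show ?thesis using insert_word_over[of "[]" R "[]"] Cons.prems by (auto simp: column_strict_Cons row_word_Cons)
  next
    case (Cons H T')
    have "sorted R" "sorted H" "below 0 H R" using Cons.prems Cons by (auto simp: column_strict_Cons)
    then show ?thesis using Cons.IH Cons.prems Cons insert_word_over[of "[]" R H] below_iff[of R H]
      by (auto simp: column_strict_Cons row_word_Cons)
  qed
qed simp

lemma row_word_eq_Nil: "column_strict T \<Longrightarrow> row_word T = [] \<longleftrightarrow> T = []"
  by (cases T) (auto simp: column_strict_Cons row_word_Cons)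

lemma schensted_row_word: "column_strict T \<Longrightarrow> schensted (row_word T) = T"
proof (induction T)
  case (Cons R T)
  then have "row_word (R # T) \<noteq> []" using row_word_eq_Nil by blast
  then show ?case using Cons insert_word_row_word[OF Cons.prems] by (auto simp: column_strict_Cons)
qed simp

lemma schensted_unique: "column_strict T \<Longrightarrow> row_word T \<approx> u \<Longrightarrow> T = schensted u"
  using knuth_imp_schensted_eq schensted_row_word by metis

lemma P_tableau_eq_schensted: "0 \<notin> set u \<Longrightarrow> P_tableau u = schensted u"
  unfolding P_tableau_def
  by (rule the_equality) (auto simp: column_strict_schensted knuth_schensted intro: schensted_unique)

section \<open>Bracket statistics\<close>

text \<open>The numbers of unpaired letters \<open>r\<close> and \<open>r + 1\<close> of a word.\<close>

fun low :: "nat \<Rightarrow> nat list \<Rightarrow> nat" where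
  "low r [] = 0"
| "low r (x # v) = (if x = r then Suc (low r v) else if x = Suc r then low r v - 1 else low r v)"

fun high :: "nat \<Rightarrow> nat list \<Rightarrow> nat" where
  "high r [] = 0"
| "high r (x # v) = (if x = Suc r \<and> low r v = 0 then Suc (high r v) else high r v)"

text \<open>Concatenation cancels the open left parentheses of \<open>u\<close> against the
  unmatched right parentheses of \<open>v\<close>; the truncated subtractions are what remains on
  either side.\<close>

lemma low_append [simp]: "low r (u @ v) = low r u + (low r v - high r u)"
  and high_append [simp]: "high r (u @ v) = high r v + (high r u - low r v)"
  by (induction u) auto

text \<open>\<open>unpaired_from\<close> returns both kinds of unpaired positions at once and
  recurses from the left. Separating the final stack from the positions found on the way makes it
  compatible with appending letters on the right.\<close>

fun scan_stack :: "nat \<Rightarrow> nat \<Rightarrow> nat list \<Rightarrow> nat list \<Rightarrow> nat list" where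
  "scan_stack r i [] st = st"
| "scan_stack r i (x # u) st = scan_stack r (Suc i) u
     (if x = Suc r then i # st else if x = r then tl st else st)"

fun scan_set :: "nat \<Rightarrow> nat \<Rightarrow> nat list \<Rightarrow> nat list \<Rightarrow> nat set" where
  "scan_set r i [] st = {}"
| "scan_set r i (x # u) st = (if x = r \<and> st = [] then {i} else {}) \<union> scan_set r (Suc i) u
     (if x = Suc r then i # st else if x = r then tl st else st)"

lemma unpaired_from_eq: "unpaired_from r i u st = scan_set r i u st \<union> set (scan_stack r i u st)"
  by (induction u arbitrary: i st) (auto split: list.splits)

lemma scan_stack_append: "scan_stack r i (u @ v) st = scan_stack r (i + length u) v (scan_stack r i u st)"
  by (induction u arbitrary: i st) auto

lemma scan_set_append:
  "scan_set r i (u @ v) st = scan_set r i u st \<union> scan_set r (i + length u) v (scan_stack r i u st)"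
  by (induction u arbitrary: i st) (auto simp: Un_assoc)

abbreviation "open_stack r u \<equiv> scan_stack r 0 u []"
abbreviation "unpaired_lows r u \<equiv> scan_set r 0 u []"

lemma unpaired_eq: "unpaired r u = unpaired_lows r u \<union> set (open_stack r u)"
  by (simp add: unpaired_def unpaired_from_eq)

text \<open>An \<open>r\<close> stays unpaired only when no letter \<open>r + 1\<close> is open, so
  all unpaired \<open>r\<close> precede the open letters. Hence the unpaired subword is sorted and
  the two numbers \<open>low\<close> and \<open>high\<close> describe it completely.\<close>

lemma scan_invariant:
  "sorted_wrt (>) (open_stack r u) \<and> (\<forall>k\<in>set (open_stack r u). k < length u \<and> u ! k = Suc r) \<and>
   (\<forall>k\<in>unpaired_lows r u. k < length u \<and> u ! k = r) \<and> (\<forall>a\<in>unpaired_lows r u. \<forall>s\<in>set (open_stack r u). a < s) \<and>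
   finite (unpaired_lows r u) \<and> card (unpaired_lows r u) = low r u \<and> length (open_stack r u) = high r u"
proof (induction u rule: rev_induct)
  case (snoc x u)
  let ?s = "open_stack r u" and ?A = "unpaired_lows r u"
  have nin: "length u \<notin> ?A" "length u \<notin> set ?s" using snoc by auto
  have lt: "\<And>k. k \<in> ?A \<Longrightarrow> (u @ [x]) ! k = u ! k" "\<And>k. k \<in> set ?s \<Longrightarrow> (u @ [x]) ! k = u ! k"
    using snoc by (auto simp: nth_append)
  consider "x = Suc r" | "x = r" "?s = []" | m s where "x = r" "?s = m # s" | "x \<noteq> r" "x \<noteq> Suc r"
    by (cases ?s) auto
  then show ?case
  proof cases
    case 1
    then show ?thesis using snoc nin by (auto simp: scan_stack_append scan_set_append nth_append)
  next
    case 2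
    then have "high r u = 0" using snoc by auto
    then show ?thesis using snoc nin 2 by (auto simp: scan_stack_append scan_set_append nth_append less_SucI)
  next
    case (3 m s)
    then have "high r u = Suc (length s)" using snoc by auto
    then show ?thesis using snoc nin 3 by (auto simp: scan_stack_append scan_set_append nth_append less_SucI)
  next
    case 4
    then show ?thesis using snoc nin by (auto simp: scan_stack_append scan_set_append nth_append less_SucI)
  qed
qed simp

lemma finite_unpaired: "finite (unpaired r u)"
  using scan_invariant[of r u] by (auto simp: unpaired_eq)

lemma unpaired_less: "k \<in> unpaired r u \<Longrightarrow> k < length u"
  using scan_invariant[of r u] by (auto simp: unpaired_eq)

lemma card_open_stack: "card (set (open_stack r u)) = high r u"
proof -
  have "distinct (open_stack r u)" using scan_invariant[of r u]
    by (metis (no_types, lifting) distinct_conv_nth less_irrefl linorder_neqE_nat sorted_wrt_iff_nth_less)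
  then show ?thesis using scan_invariant[of r u] distinct_card by metis
qed

lemma card_unpaired: "card (unpaired r u) = low r u + high r u"
  unfolding unpaired_eq using scan_invariant[of r u] card_open_stack[of r u]
  by (subst card_Un_disjoint) auto

lemma num_unpaired_r: "num_unpaired r u r = low r u"
proof -
  have "k \<in> set (open_stack r u) \<Longrightarrow> u ! k = Suc r" "k \<in> unpaired_lows r u \<Longrightarrow> u ! k = r" for k
    using scan_invariant[of r u] by blast+
  then have "k \<in> unpaired r u \<and> u ! k = r \<longleftrightarrow> k \<in> unpaired_lows r u" for k
    unfolding unpaired_eq by (metis UnE UnI1 n_not_Suc_n)
  then have "{k \<in> unpaired r u. u ! k = r} = unpaired_lows r u" by (simp only: Collect_mem_eq)
  then show ?thesis using scan_invariant[of r u] by (simp add: num_unpaired_def)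
qed

lemma num_unpaired_Suc: "num_unpaired r u (Suc r) = high r u"
proof -
  have "k \<in> set (open_stack r u) \<Longrightarrow> u ! k = Suc r" "k \<in> unpaired_lows r u \<Longrightarrow> u ! k = r" for k
    using scan_invariant[of r u] by blast+
  then have "k \<in> unpaired r u \<and> u ! k = Suc r \<longleftrightarrow> k \<in> set (open_stack r u)" for k
    unfolding unpaired_eq by (metis UnE UnI2 n_not_Suc_n)
  then have "{k \<in> unpaired r u. u ! k = Suc r} = set (open_stack r u)" by (simp only: Collect_mem_eq)
  then show ?thesis using card_open_stack by (simp add: num_unpaired_def)
qed

abbreviation "fill \<equiv> set_unpaired"

lemma length_fill [simp]: "length (fill r t u) = length u"
  by (simp add: set_unpaired_def)

lemma fill_Nil [simp]: "fill r t [] = []"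
  by (simp add: set_unpaired_def)

lemma fill_nth: "j < length u \<Longrightarrow> fill r t u ! j = (if j \<in> unpaired r u
              then (if card {k \<in> unpaired r u. k < j} < t then r else Suc r) else u ! j)"
  by (simp add: set_unpaired_def)

lemma fill_snoc_add:
  assumes "unpaired r (u @ [x]) = insert (length u) (unpaired r u)"
  shows "fill r t (u @ [x]) = fill r t u @ [if low r u + high r u < t then r else Suc r]"
proof (rule nth_equalityI)
  fix j assume "j < length (fill r t (u @ [x]))"
  then have j: "j < Suc (length u)" by simp
  have e: "{k \<in> unpaired r (u @ [x]). k < j} = {k \<in> unpaired r u. k < j}"
    using j assms by auto
  have f: "{k \<in> unpaired r u. k < length u} = unpaired r u" using unpaired_less by auto
  show "fill r t (u @ [x]) ! j = (fill r t u @ [if low r u + high r u < t then r else Suc r]) ! j"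
    using j assms e f card_unpaired[of r u] by (auto simp: fill_nth nth_append less_Suc_eq)
qed simp

lemma fill_snoc_same:
  assumes "unpaired r (u @ [x]) = unpaired r u"
  shows "fill r t (u @ [x]) = fill r t u @ [x]"
proof (rule nth_equalityI)
  fix j assume "j < length (fill r t (u @ [x]))"
  then have j: "j < Suc (length u)" by simp
  show "fill r t (u @ [x]) ! j = (fill r t u @ [x]) ! j"
    using j assms unpaired_less[of "length u" r u] by (auto simp: fill_nth nth_append less_Suc_eq)
qed simp

lemma fill_snoc_other [simp]: "x \<noteq> r \<Longrightarrow> x \<noteq> Suc r \<Longrightarrow> fill r t (u @ [x]) = fill r t u @ [x]"
  by (rule fill_snoc_same) (simp add: unpaired_eq scan_stack_append scan_set_append)

lemma fill_snoc_Suc [simp]: "fill r t (u @ [Suc r]) = fill r t u @ [if low r u + high r u < t then r else Suc r]"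
  by (rule fill_snoc_add) (simp add: unpaired_eq scan_stack_append scan_set_append)

lemma fill_snoc_r0 [simp]: "high r u = 0 \<Longrightarrow> fill r t (u @ [r]) = fill r t u @ [if low r u < t then r else Suc r]"
  using fill_snoc_add[of r u r t] scan_invariant[of r u]
  by (simp add: unpaired_eq scan_stack_append scan_set_append)

text \<open>The new letter closes the rightmost open position, which is the last unpaired one. For
  \<open>t\<close> below the number of unpaired letters that position is filled with
  \<open>r + 1\<close>, its own letter, so its leaving the unpaired set changes nothing.\<close>

lemma fill_snoc_r1 [simp]:
  assumes "high r u > 0" "t < low r u + high r u"
  shows "fill r t (u @ [r]) = fill r t u @ [r]"
proof -
  obtain m s where ms: "open_stack r u = m # s" using assms scan_invariant[of r u] by (cases "open_stack r u") auto
  have inv: "\<forall>k\<in>set s. k < m" "m < length u" "u ! m = Suc r" "\<forall>k\<in>unpaired_lows r u. k < m"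
    using scan_invariant[of r u] ms by auto
  have U: "unpaired r u = insert m (unpaired_lows r u \<union> set s)"
    using ms by (auto simp: unpaired_eq)
  have U': "unpaired r (u @ [r]) = unpaired_lows r u \<union> set s"
    using ms by (auto simp: unpaired_eq scan_stack_append scan_set_append)
  have c: "card {k \<in> unpaired r u. k < m} = low r u + high r u - 1"
  proof -
    have "{k \<in> unpaired r u. k < m} = unpaired r u - {m}" using inv U by auto
    then show ?thesis using card_unpaired[of r u] U by (metis card_Diff_singleton insertI1)
  qed
  show ?thesis
  proof (rule nth_equalityI)
    fix j assume "j < length (fill r t (u @ [r]))"
    then have j: "j < Suc (length u)" by simp
    show "fill r t (u @ [r]) ! j = (fill r t u @ [r]) ! j"
    proof (cases "j = m \<or> j = length u")
      case True
      then show ?thesis using j inv c U U' assms by (auto simp: fill_nth nth_append)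
    next
      case False
      have "{k \<in> unpaired r (u @ [r]). k < j} = {k \<in> unpaired r u. k < j}" if "j \<in> unpaired r (u @ [r])"
        using that inv U U' by auto
      then show ?thesis using False j inv U U' by (auto simp: fill_nth nth_append)
    qed
  qed simp
qed

lemma fill_top: "low r u + high r u \<le> t \<Longrightarrow> fill r t u = fill r (low r u + high r u) u"
proof (rule nth_equalityI)
  fix j assume a: "low r u + high r u \<le> t" "j < length (fill r t u)"
  have "card {k \<in> unpaired r u. k < j} < low r u + high r u" if "j \<in> unpaired r u"
  proof -
    have "card {k \<in> unpaired r u. k < j} < card (unpaired r u)"
      using that by (intro psubset_card_mono finite_unpaired) auto
    then show ?thesis using card_unpaired by simp
  qed
  then show "fill r t u ! j = fill r (low r u + high r u) u ! j"
    using a by (auto simp: fill_nth)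
qed simp

lemma snoc_cases:
  obtains "x \<noteq> r" "x \<noteq> Suc r" | "x = Suc r" | "x = r" "high r u = 0" | "x = r" "high r u > 0"
  by auto

lemma fill_stats: "t \<le> low r u + high r u \<Longrightarrow> low r (fill r t u) = t \<and> high r (fill r t u) = low r u + high r u - t"
proof (induction u arbitrary: t rule: rev_induct)
  case (snoc x u)
  show ?case
  proof (cases rule: snoc_cases[where x=x and r=r and u=u])
    case 2
    then show ?thesis using snoc fill_top[of r u "Suc (low r u + high r u)"]
      by (cases "t = Suc (low r u + high r u)") auto
  next
    case 3
    then show ?thesis using snoc fill_top[of r u "Suc (low r u)"]
      by (cases "t = Suc (low r u)") auto
  qed (use snoc in auto)
qed simp

lemma fill_id: "fill r (low r u) u = u"
proof (induction u rule: rev_induct)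
  case (snoc x u)
  show ?case
    by (cases rule: snoc_cases[where x=x and r=r and u=u]) (use snoc fill_top[of r u "Suc (low r u)"] in auto)
qed simp

lemma reflect_word_eq: "reflect_word r u = fill r (high r u) u"
  by (simp add: reflect_word_def num_unpaired_Suc)

lemma lower_word_eq: "lower_word r u = fill r (low r u - 1) u"
  by (simp add: lower_word_def num_unpaired_r)

section \<open>Flipping one letter\<close>

text \<open>
  \<open>flips r r (Suc r)\<close> is the graph of the lowering operator \<open>f\<^sub>r\<close>, and \<open>flips r (Suc r) r\<close> that of
  its inverse.
\<close>

definition flips :: "nat \<Rightarrow> nat \<Rightarrow> nat \<Rightarrow> nat list \<Rightarrow> nat list \<Rightarrow> bool" where
  "flips r x y u u' \<longleftrightarrow> (\<exists>A B. u = A @ x # B \<and> u' = A @ y # B \<and> high r A = 0 \<and> low r B = 0)"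

abbreviation "flip r \<equiv> flips r r (Suc r)"

lemma flips_sym: "flips r x y u v \<longleftrightarrow> flips r y x v u"
  unfolding flips_def by blast

lemma flip_snoc:
  assumes "flip r u u'" "x = r \<longrightarrow> high r u > 0"
  shows "flip r (u @ [x]) (u' @ [x])"
proof -
  obtain A B where "u = A @ r # B" "u' = A @ Suc r # B" "high r A = 0" "low r B = 0"
    using assms unfolding flips_def by auto
  then show ?thesis using assms(2) unfolding flips_def
    by (intro exI[of _ A] exI[of _ "B @ [x]"]) auto
qed

lemma flip_last: "high r u = 0 \<Longrightarrow> flip r (u @ [r]) (u @ [Suc r])"
  unfolding flips_def by (intro exI[of _ u] exI[of _ "[]"]) auto

text \<open>Only the unpaired letter number \<open>t + 1\<close> changes. The unpaired letters
  before it are all \<open>r\<close> and those behind it all \<open>r + 1\<close>, which leaves no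
  open letter in front of it and no unpaired \<open>r\<close> behind it.\<close>

lemma flip_fill: "t < low r u + high r u \<Longrightarrow> flip r (fill r (Suc t) u) (fill r t u)"
proof (induction u arbitrary: t rule: rev_induct)
  case (snoc x u)
  let ?N = "low r u + high r u"
  show ?case
  proof (cases rule: snoc_cases[where x=x and r=r and u=u])
    case 2
    then show ?thesis using snoc fill_top[of r u "Suc ?N"] fill_stats[of ?N r u]
      by (cases "t = ?N") (auto intro!: flip_snoc flip_last)
  next
    case 3
    then show ?thesis using snoc fill_top[of r u "Suc ?N"] fill_stats[of ?N r u]
      by (cases "t = ?N") (auto intro!: flip_snoc flip_last)
  next
    case 4
    then show ?thesis using snoc fill_stats[of "Suc t" r u] by (auto intro!: flip_snoc)
  next
    case 1
    then show ?thesis using snoc by (auto intro!: flip_snoc)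
  qed
qed simp

lemma flip_lower: "low r u > 0 \<Longrightarrow> flip r u (lower_word r u)"
  using flip_fill[of "low r u - 1" r u] fill_id[of r u] by (simp add: lower_word_eq)

lemma flip_low: "flip r u u' \<Longrightarrow> low r u = Suc (low r u') \<and> high r u' = Suc (high r u)"
  unfolding flips_def by auto

text \<open>Two candidate positions exclude each other: one of the two letters would have to be
  paired within the stretch between them, and the partner supplied there would violate the condition
  at the other position.\<close>

lemma flips_det:
  assumes "flips r x y u v" "flips r x y u w" "x = r \<or> x = Suc r"
  shows "v = w"
proof -
  have *: False if "u = A @ x # B" "u = A' @ x # B'" "low r B = 0" "high r A' = 0" "length A < length A'" for A B A' B'
  proof -
    have "A' = A @ drop (length A) A'" using that by (metis append_eq_append_conv_if append_take_drop_id less_imp_le_nat)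
    moreover have "drop (length A) A' \<noteq> []" using that(5) by simp
    then obtain c C where "drop (length A) A' = c # C" by (meson neq_Nil_conv)
    ultimately have "A' = A @ x # C" "B = C @ x # B'" using that by auto
    then show False using that(3,4) assms(3) by (auto split: if_splits)
  qed
  obtain A B where 1: "u = A @ x # B" "v = A @ y # B" "high r A = 0" "low r B = 0"
    using assms unfolding flips_def by auto
  obtain A' B' where 2: "u = A' @ x # B'" "w = A' @ y # B'" "high r A' = 0" "low r B' = 0"
    using assms unfolding flips_def by auto
  have "length A = length A'" using *[of A B A' B'] *[of A' B' A B] 1 2 by (meson linorder_neqE_nat)
  then show ?thesis using 1 2 by auto
qed

abbreviation "linked r \<equiv> equivclp (flip r)"

lemma linked_interval:
  assumes "\<And>s. a \<le> s \<Longrightarrow> s < N \<Longrightarrow> flip r (f (Suc s)) (f s)" "a \<le> i" "i \<le> N" "a \<le> j" "j \<le> N"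
  shows "linked r (f i) (f j)"
proof -
  have *: "linked r (f i) (f j)" if "a \<le> i" "i \<le> j" "j \<le> N" for i j
    using that(2,3)
  proof (induction j rule: dec_induct)
    case (step j)
    then have "linked r (f j) (f (Suc j))" using assms(1)[of j] that(1) by (meson converse_r_into_equivclp le_trans Suc_le_lessD)
    then show ?case using step by (meson Suc_leD equivclp_trans)
  qed (rule equivclp_refl)
  show ?thesis using *[of i j] *[of j i] assms(2-) equivclp_sym by (meson linear)
qed

lemma linked_fill: "t \<le> low r u + high r u \<Longrightarrow> linked r u (fill r t u)"
  using linked_interval[of 0 "low r u + high r u" r "\<lambda>t. fill r t u" "low r u" t] flip_fill fill_id[of r u] by simp

lemma linked_total: "linked r u w \<Longrightarrow> low r w + high r w = low r u + high r u"
  by (induction rule: equivclp_induct) (auto dest!: flip_low)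

text \<open>The words of one \<open>r\<close>-string are told apart by their number of unpaired
  \<open>r\<close>. A fill can therefore be identified by exhibiting any linked word with the right
  number, without computing positions; the rules for letters added on the left are all obtained this
  way.\<close>

lemma linked_imp_fill: "linked r u w \<Longrightarrow> fill r (low r w) u = w"
proof (induction rule: equivclp_induct)
  case base
  show ?case by (rule fill_id)
next
  case (step y z)
  note N = linked_total[OF step(1)]
  from step(2) show ?case
  proof
    assume f: "flip r y z"
    have "flip r (fill r (Suc (low r z)) u) (fill r (low r z) u)"
      using flip_low[OF f] N by (intro flip_fill) linarith
    moreover have "low r y = Suc (low r z)" using flip_low[OF f] by (rule conjunct1)
    ultimately have "flip r y (fill r (low r z) u)" using step(3) by (simp only:)
    then show ?case by (rule flips_det[OF _ f disjI1[OF refl]])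
  next
    assume f: "flip r z y"
    have z: "low r z = Suc (low r y)" using flip_low[OF f] by (rule conjunct1)
    have "flip r (fill r (Suc (low r y)) u) (fill r (low r y) u)"
      using flip_low[OF f] N by (intro flip_fill) linarith
    then have "flips r (Suc r) r y (fill r (low r z) u)"
      unfolding z step(3) by (rule flips_sym[THEN iffD1])
    then show ?case by (rule flips_det[OF _ f[THEN flips_sym[THEN iffD1]] disjI2[OF refl]])
  qed
qed

lemma fill_eqI: "linked r u w \<Longrightarrow> low r w = t \<Longrightarrow> fill r t u = w"
  using linked_imp_fill by blast

lemma fill_fill: "s \<le> low r u + high r u \<Longrightarrow> t \<le> low r u + high r u \<Longrightarrow> fill r t (fill r s u) = fill r t u"
  using linked_fill[of s r u] linked_fill[of t r "fill r s u"] fill_stats[of s r u] fill_stats[of t r "fill r s u"]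
  by (intro fill_eqI[symmetric]) (auto intro: equivclp_trans)

lemma flip_Cons:
  assumes "flip r u w" "x = Suc r \<longrightarrow> low r w > 0"
  shows "flip r (x # u) (x # w)"
proof -
  obtain A B where "u = A @ r # B" "w = A @ Suc r # B" "high r A = 0" "low r B = 0"
    using assms unfolding flips_def by auto
  then show ?thesis using assms(2) unfolding flips_def
    by (intro exI[of _ "x # A"] exI[of _ B]) auto
qed

lemma fill_Cons:
  assumes "t \<le> low r v + high r v"
  shows "x \<noteq> r \<Longrightarrow> x \<noteq> Suc r \<Longrightarrow> fill r t (x # v) = x # fill r t v" "fill r (Suc t) (r # v) = r # fill r t v"
proof -
  have *: "linked r (x # v) (x # fill r t v)" if "x \<noteq> Suc r" for x
    using linked_interval[of 0 "low r v + high r v" r "\<lambda>t. x # fill r t v" "low r v" t] flip_fill fill_id[of r v] that assms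
    by (simp add: flip_Cons)
  show "x \<noteq> r \<Longrightarrow> x \<noteq> Suc r \<Longrightarrow> fill r t (x # v) = x # fill r t v" "fill r (Suc t) (r # v) = r # fill r t v"
    using fill_stats[OF assms] by (auto intro!: fill_eqI *)
qed

lemma flip_head: "low r v = 0 \<Longrightarrow> flip r (r # v) (Suc r # v)"
  unfolding flips_def by (intro exI[of _ "[]"] exI[of _ v]) auto

lemma fill_0_Cons: "fill r 0 (r # v) = Suc r # fill r 0 v"
proof (rule fill_eqI)
  have s: "low r (fill r 0 v) = 0" using fill_stats[of 0 r v] by simp
  have "linked r (r # v) (r # fill r 0 v)" using linked_fill[of "Suc 0" r "r # v"] fill_Cons(2)[of 0 r v] by simp
  then show "linked r (r # v) (Suc r # fill r 0 v)" using flip_head[OF s] equivclp_trans by (metis r_into_equivclp)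
  show "low r (Suc r # fill r 0 v) = 0" using s by simp
qed

lemma fill_Cons_unpaired: "low r v = 0 \<Longrightarrow> t \<le> Suc (high r v) \<Longrightarrow> fill r t (Suc r # v) = fill r t (r # v)"
  using linked_fill[of t r "r # v"] fill_stats[of t r "r # v"] converse_r_into_equivclp[of "flip r", OF flip_head[of r v]]
  by (intro fill_eqI) (auto intro: equivclp_trans)

text \<open>The new \<open>r + 1\<close> consumes the first unpaired \<open>r\<close> of
  \<open>v\<close>. The fills of the longer word thus correspond to those fills of \<open>v\<close>
  that keep at least one unpaired \<open>r\<close>, whence the shift to
  \<open>Suc t\<close>.\<close>

lemma fill_Cons_pair:
  assumes "low r v > 0" "t < low r v + high r v"
  shows "fill r t (Suc r # v) = Suc r # fill r (Suc t) v"
proof (rule fill_eqI)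
  have "flip r (Suc r # fill r (Suc s) v) (Suc r # fill r s v)" if "1 \<le> s" "s < low r v + high r v" for s
    using flip_fill[OF that(2)] fill_stats[of s r v] that by (intro flip_Cons) auto
  then show "linked r (Suc r # v) (Suc r # fill r (Suc t) v)"
    using linked_interval[of 1 "low r v + high r v" r "\<lambda>t. Suc r # fill r t v" "low r v" "Suc t"] fill_id[of r v] assms by simp
  show "low r (Suc r # fill r (Suc t) v) = t" using fill_stats[of "Suc t" r v] assms by simp
qed

lemma reflect_word_invol [simp]: "reflect_word r (reflect_word r u) = u"
  using fill_stats[of "high r u" r u] fill_fill[of "high r u" r u "low r u"] fill_id[of r u] by (simp add: reflect_word_eq)

lemma length_reflect_word [simp]: "length (reflect_word r u) = length u"
  by (simp add: reflect_word_eq)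

text \<open>Reflections only see the cyclic bracketing.\<close>

lemma reflect_word_rotate1: "reflect_word r (rotate1 u) = rotate1 (reflect_word r u)"
proof (cases u)
  case (Cons x v)
  consider "x \<noteq> r" "x \<noteq> Suc r" | "x = r" "high r v = 0" | "x = r" "high r v > 0"
    | "x = Suc r" "low r v = 0" | "x = Suc r" "low r v > 0" by auto
  then show ?thesis
  proof cases
    case 1
    then show ?thesis using Cons fill_Cons(1)[of "high r v" r v x] by (simp add: reflect_word_eq)
  next
    case 2
    then show ?thesis using Cons fill_0_Cons[of r v] by (simp add: reflect_word_eq)
  next
    case 3
    \<comment> \<open>In front, this \<open>r\<close> is unpaired; at the end it closes an open
      letter of \<open>v\<close>. The reflection leaves it an \<open>r\<close> in both places, and
      \<open>v\<close> is filled with the same number \<open>i\<close>.\<close>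
    then obtain i where "high r v = Suc i" by (cases "high r v") auto
    then show ?thesis using Cons 3(1) fill_Cons(2)[of i r v] by (simp add: reflect_word_eq)
  next
    case 4
    have "fill r (Suc (high r v)) v = fill r (high r v) v" using fill_top[of r v "Suc (high r v)"] 4 by simp
    then show ?thesis using Cons fill_Cons_unpaired[of r v "Suc (high r v)"] fill_Cons(2)[of "high r v" r v] 4
      by (simp add: reflect_word_eq)
  next
    case 5
    then show ?thesis using Cons fill_Cons_pair[of r v "high r v"] by (simp add: reflect_word_eq)
  qed
qed (simp add: reflect_word_eq)

lemma reflect_word_rotate: "reflect_word r (rotate m u) = rotate m (reflect_word r u)"
  by (induction m) (auto simp: reflect_word_rotate1)

lemma reflect_word_swap:
  assumes "reflect_word r (u @ v) = u' @ v'" "length u' = length u"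
  shows "reflect_word r (v @ u) = v' @ u'"
  using reflect_word_rotate[of r "length u" "u @ v"] assms
  by (metis rotate_append)

section \<open>Compatibility of the crystal operators with Knuth equivalence\<close>

lemma split3: "[a,b,c] = A @ x # B \<longleftrightarrow>
   A = [] \<and> x = a \<and> B = [b,c] \<or> A = [a] \<and> x = b \<and> B = [c] \<or> A = [a,b] \<and> x = c \<and> B = []"
  by (auto simp: Cons_eq_append_conv)

lemma flips3: "flips r x y [a,b,c] t \<longleftrightarrow>
   a = x \<and> low r [b,c] = 0 \<and> t = [y,b,c] \<or> b = x \<and> high r [a] = 0 \<and> low r [c] = 0 \<and> t = [a,y,c] \<or>
   c = x \<and> high r [a,b] = 0 \<and> t = [a,b,y]"
  unfolding flips_def split3 conj_disj_distribR ex_disj_distrib by auto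

definition window :: "nat list \<Rightarrow> nat list \<Rightarrow> bool" where
  "window w w' \<longleftrightarrow> (\<exists>x y z. x \<le> y \<and> y < z \<and> (w = [x,z,y] \<and> w' = [z,x,y] \<or> w = [z,x,y] \<and> w' = [x,z,y])) \<or>
     (\<exists>x y z. x < y \<and> y \<le> z \<and> (w = [y,x,z] \<and> w' = [y,z,x] \<or> w = [y,z,x] \<and> w' = [y,x,z]))"

lemma window_knuth: "window w w' \<Longrightarrow> w \<approx> w'"
  unfolding window_def by (auto simp: knuth_triple)

lemma window_stats: "window w w' \<Longrightarrow> low r w = low r w' \<and> high r w = high r w'"
  unfolding window_def by auto

lemma knuth_window: "knuth_step u v \<or> knuth_step v u \<Longrightarrow> \<exists>a b w w'. window w w' \<and> u = a @ w @ b \<and> v = a @ w' @ b"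
proof -
  have *: "\<exists>a b w w'. window w w' \<and> window w' w \<and> u = a @ w @ b \<and> v = a @ w' @ b" if "knuth_step u v" for u v
    using that
  proof cases
    case (1 x y z a b)
    then have "window [x,z,y] [z,x,y]" "window [z,x,y] [x,z,y]" unfolding window_def by blast+
    then show ?thesis using 1 by blast
  next
    case (2 x y z a b)
    then have "window [y,x,z] [y,z,x]" "window [y,z,x] [y,x,z]" unfolding window_def by blast+
    then show ?thesis using 2 by blast
  qed
  assume "knuth_step u v \<or> knuth_step v u"
  then show ?thesis using * by meson
qed

text \<open>A finite check. The case that simplification leaves has two coinciding letters: there
  the flip hits different positions in the two windows, and the results are linked by the other
  Knuth relation.\<close>

lemma flips_window:
  assumes "window w w'" "flips r x y w t" "x = r \<and> y = Suc r \<or> x = Suc r \<and> y = r"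
  shows "\<exists>t'. flips r x y w' t' \<and> t \<approx> t'"
proof -
  have "\<exists>t'. flips r r (Suc r) w' t' \<and> t \<approx> t'" if "flips r r (Suc r) w t"
    using assms(1) that unfolding window_def
    apply (elim disjE exE conjE)
       apply (auto simp: flips3 knuth_triple ex_disj_distrib conj_disj_distribR split: if_splits)
    subgoal for y using knuth_triple(4)[of r "Suc r" "Suc r"] by (cases "y = r") auto
    done
  moreover have "\<exists>t'. flips r (Suc r) r w' t' \<and> t \<approx> t'" if "flips r (Suc r) r w t"
    using assms(1) that unfolding window_def
    apply (elim disjE exE conjE)
       apply (auto simp: flips3 knuth_triple ex_disj_distrib conj_disj_distribR split: if_splits)
    subgoal for y using knuth_triple(2)[of r r "Suc r"] by (cases "y = Suc r") auto
    done
  ultimately show ?thesis using assms(2,3) by blast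
qed

lemma append3_cases:
  assumes "a @ w @ b = A @ x # B"
  obtains B0 where "a = A @ x # B0" "B = B0 @ w @ b"
  | w1 w2 where "w = w1 @ x # w2" "A = a @ w1" "B = w2 @ b"
  | b1 where "b = b1 @ x # B" "A = a @ w @ b1"
  using assms
  apply (auto simp: append_eq_append_conv2 append_eq_Cons_conv Cons_eq_append_conv)
  done

text \<open>From outside, only the two bracket statistics of the window are visible, and these agree
  for both windows. A flip outside is therefore unaffected, and a flip inside reduces to the window
  alone.\<close>

lemma flips_context:
  assumes "window w w'" "flips r x y (a @ w @ b) t" "x = r \<and> y = Suc r \<or> x = Suc r \<and> y = r"
  shows "\<exists>t'. flips r x y (a @ w' @ b) t' \<and> t \<approx> t'"
proof -
  obtain A B where AB: "a @ w @ b = A @ x # B" "t = A @ y # B" "high r A = 0" "low r B = 0"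
    using assms unfolding flips_def by auto
  note st = window_stats[OF assms(1), of r]
  from AB(1) show ?thesis
  proof (cases rule: append3_cases)
    case (1 B0)
    have "flips r x y (a @ w' @ b) (A @ y # B0 @ w' @ b)"
      unfolding flips_def using 1 AB st by (intro exI[of _ A] exI[of _ "B0 @ w' @ b"]) auto
    moreover have "t \<approx> A @ y # B0 @ w' @ b"
      using knuth_cong[OF window_knuth[OF assms(1)], of "A @ y # B0" b] AB 1 by simp
    ultimately show ?thesis by blast
  next
    case (2 w1 w2)
    have w0: "high r w1 = 0" "low r w2 = 0" "high r a \<le> low r w1" "low r b \<le> high r w2" using AB 2 by auto
    have "flips r x y w (w1 @ y # w2)"
      unfolding flips_def using w0 2 by auto
    then obtain s where s: "flips r x y w' s" "w1 @ y # w2 \<approx> s" using flips_window[OF assms(1) _ assms(3)] by blast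
    then obtain v1 v2 where v: "w' = v1 @ x # v2" "s = v1 @ y # v2" "high r v1 = 0" "low r v2 = 0"
      unfolding flips_def by auto
    \<comment> \<open>Nothing is open in front of the flipped letter and no \<open>r\<close> is
      unpaired behind it, so in both windows the total statistics split into those of the two sides;
      equal totals give equal sides.\<close>
    have "low r v1 = low r w1" "high r v2 = high r w2" using st v(1,3,4) 2(1) w0(1,2) assms(3) by auto
    then have "flips r x y (a @ w' @ b) (a @ s @ b)"
      unfolding flips_def using v w0 by (intro exI[of _ "a @ v1"] exI[of _ "v2 @ b"]) auto
    moreover have "t \<approx> a @ s @ b" using knuth_cong[OF s(2), of a b] AB 2 by simp
    ultimately show ?thesis by blast
  next
    case (3 b1)
    have "flips r x y (a @ w' @ b) (a @ w' @ b1 @ y # B)"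
      unfolding flips_def using 3 AB st by (intro exI[of _ "a @ w' @ b1"] exI[of _ B]) auto
    moreover have "t \<approx> a @ w' @ b1 @ y # B"
      using knuth_cong[OF window_knuth[OF assms(1)], of a "b1 @ y # B"] AB 3 by simp
    ultimately show ?thesis by blast
  qed
qed

lemma flips_knuth:
  assumes "u \<approx> v" "flips r x y u t" "x = r \<and> y = Suc r \<or> x = Suc r \<and> y = r"
  shows "\<exists>t'. flips r x y v t' \<and> t \<approx> t'"
  using assms(1)
proof (induction rule: knuth_induct)
  case (step v w)
  then show ?case using knuth_window[OF step(2)] flips_context[OF _ _ assms(3)] knuth_trans by metis
qed (use assms in auto)

lemma flip_knuth: "u \<approx> v \<Longrightarrow> flip r u t \<Longrightarrow> \<exists>t'. flip r v t' \<and> t \<approx> t'"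
  by (rule flips_knuth) auto

lemma flip_knuth': "u \<approx> v \<Longrightarrow> flip r t u \<Longrightarrow> \<exists>t'. flip r t' v \<and> t \<approx> t'"
  using flips_knuth[of u v r "Suc r" r t] unfolding flips_sym[of r "Suc r" r] by blast

lemma knuth_stats: "u \<approx> v \<Longrightarrow> low r u = low r v \<and> high r u = high r v"
proof (induction rule: knuth_induct)
  case (step v w)
  obtain a b x y where "window x y" "v = a @ x @ b" "w = a @ y @ b" using knuth_window[OF step(2)] by blast
  then show ?case using step window_stats[of x y r] by auto
qed simp

lemma linked_induct [consumes 1, case_names base flip unflip]:
  assumes "linked r u w" "P u" "\<And>v w. P v \<Longrightarrow> flip r v w \<Longrightarrow> P w" "\<And>v w. P v \<Longrightarrow> flip r w v \<Longrightarrow> P w"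
  shows "P w"
  using assms(1)
proof (induction rule: equivclp_induct)
  case base
  show ?case by (rule assms(2))
next
  case (step v w)
  then show ?case using assms(3,4) by blast
qed

text \<open>A fill is reached by a chain of single flips, and each flip transfers to an equivalent
  word. The number of unpaired \<open>r\<close>, itself invariant, then identifies the end of the
  transferred chain.\<close>

lemma fill_knuth:
  assumes "u \<approx> v" "t \<le> low r u + high r u"
  shows "fill r t u \<approx> fill r t v"
proof -
  have "\<exists>w. linked r v w \<and> fill r t u \<approx> w"
    using linked_fill[OF assms(2)]
  proof (induction rule: linked_induct)
    case base
    then show ?case using assms(1) by (meson equivclp_refl)
  next
    case (flip a b)
    then show ?case using flip_knuth by (metis equivclp_trans r_into_equivclp)
  next
    case (unflip a b)
    then show ?case using flip_knuth' by (metis equivclp_trans converse_r_into_equivclp)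
  qed
  then obtain w where w: "linked r v w" "fill r t u \<approx> w" by blast
  then have "low r w = t" using knuth_stats[OF w(2), of r] fill_stats[OF assms(2)] by simp
  then show ?thesis using w fill_eqI by metis
qed

lemma reflect_word_knuth: "u \<approx> v \<Longrightarrow> reflect_word r u \<approx> reflect_word r v"
  using fill_knuth[of u v "high r u" r] knuth_stats[of u v r] by (simp add: reflect_word_eq)

lemma lower_word_knuth: "u \<approx> v \<Longrightarrow> lower_word r u \<approx> lower_word r v"
  using fill_knuth[of u v "low r u - 1" r] knuth_stats[of u v r] by (simp add: lower_word_eq)

section \<open>Arrays of rows\<close>

lemma low_sorted: "sorted R \<Longrightarrow> low r R = count_list R r"
  and high_sorted: "sorted R \<Longrightarrow> high r R = count_list R (Suc r)"
proof -
  show 1: "sorted R \<Longrightarrow> low r R = count_list R r" for R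
  proof (induction R)
    case (Cons a R)
    then have "a = Suc r \<Longrightarrow> count_list R r = 0" by (auto simp: count_list_0_iff)
    then show ?case using Cons by auto
  qed simp
  show "sorted R \<Longrightarrow> high r R = count_list R (Suc r)"
  proof (induction R)
    case (Cons a R)
    then show ?case using 1[of R] by (auto simp: count_list_0_iff)
  qed simp
qed

lemma filter_le_Suc: "num_le (Suc r) R = num_le r R + count_list R (Suc r)"
  by (induction R) auto

lemma filter_less_Suc: "num_less (Suc r) R = num_less r R + count_list R r"
  by (induction R) auto

lemma filter_le_0: "sorted (a # R) \<Longrightarrow> b < a \<Longrightarrow> num_le b R = 0"
  by (auto simp: filter_empty_conv)

lemma sorted_flip:
  assumes "high r R1 = 0" "low r R2 = 0"
  shows "sorted (R1 @ r # R2) \<longleftrightarrow> sorted (R1 @ Suc r # R2)"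
proof
  assume s: "sorted (R1 @ r # R2)"
  then have "r \<notin> set R2" using low_sorted[of R2 r] assms by (auto simp: sorted_append count_list_0_iff)
  then show "sorted (R1 @ Suc r # R2)" using s
    by (auto simp: sorted_append Suc_le_eq order.order_iff_strict)
next
  assume s: "sorted (R1 @ Suc r # R2)"
  then have "Suc r \<notin> set R1" using high_sorted[of R1 r] assms by (auto simp: sorted_append count_list_0_iff)
  then show "sorted (R1 @ r # R2)" using s
    by (fastforce simp: sorted_append le_Suc_eq)
qed

text \<open>The only critical threshold is \<open>r + 1\<close>. There the inequality follows from
  the one at \<open>r\<close>, because the bracket condition matches every \<open>r + 1\<close> of
  \<open>X\<close> with an \<open>r\<close> of \<open>R1\<close>.\<close>

lemma below_flip_right:
  assumes "sorted X" "sorted (R1 @ r # R2)" "sorted (R1 @ Suc r # R2)" "high r (X @ R1) = 0"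
  shows "below k X (R1 @ r # R2) \<longleftrightarrow> below k X (R1 @ Suc r # R2)"
proof
  assume b: "below k X (R1 @ r # R2)"
  have c: "count_list X (Suc r) \<le> count_list R1 r"
    using assms low_sorted[of R1 r] high_sorted[of X r] by (auto simp: sorted_append)
  have "num_le r X \<le> k + num_less r R1"
  proof -
    have "filter (\<lambda>y. y < r) R2 = []" using assms(2) by (fastforce simp: sorted_append filter_empty_conv)
    then show ?thesis using b[unfolded below_def, rule_format, of r] by simp
  qed
  then have "num_le (Suc r) X \<le> k + num_less (Suc r) R1"
    unfolding filter_le_Suc filter_less_Suc using c by simp
  then have *: "num_le (Suc r) X \<le> k + num_less (Suc r) (R1 @ Suc r # R2)"
    by simp
  show "below k X (R1 @ Suc r # R2)" unfolding below_def
  proof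
    fix x
    show "num_le x X \<le> k + num_less x (R1 @ Suc r # R2)"
    proof (cases "x = Suc r")
      case False
      then show ?thesis using b[unfolded below_def, rule_format, of x] by (auto split: if_splits)
    qed (use * in simp)
  qed
next
  assume b: "below k X (R1 @ Suc r # R2)"
  show "below k X (R1 @ r # R2)" unfolding below_def
  proof
    fix x
    show "num_le x X \<le> k + num_less x (R1 @ r # R2)"
      using b[unfolded below_def, rule_format, of x] by (auto split: if_splits)
  qed
qed

text \<open>Dual to the previous lemma: the critical threshold is \<open>r\<close>, its inequality
  follows from the one at \<open>r + 1\<close>, and every \<open>r\<close> of \<open>Y\<close> is
  matched with an \<open>r + 1\<close> of \<open>R2\<close>.\<close>

lemma below_flip_left:
  assumes "sorted Y" "sorted (R1 @ r # R2)" "sorted (R1 @ Suc r # R2)" "low r (R2 @ Y) = 0"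
  shows "below k (R1 @ r # R2) Y \<longleftrightarrow> below k (R1 @ Suc r # R2) Y"
proof
  assume b: "below k (R1 @ r # R2) Y"
  show "below k (R1 @ Suc r # R2) Y" unfolding below_def
  proof
    fix x
    show "num_le x (R1 @ Suc r # R2) \<le> k + num_less x Y"
      using b[unfolded below_def, rule_format, of x] by (auto split: if_splits)
  qed
next
  assume b: "below k (R1 @ Suc r # R2) Y"
  have c: "count_list Y r \<le> count_list R2 (Suc r)"
    using assms low_sorted[of Y r] high_sorted[of R2 r] by (auto simp: sorted_append)
  have z: "num_le r R2 = 0"
    using filter_le_0[of "Suc r" R2 r] assms(3) by (auto simp: sorted_append)
  have "num_le (Suc r) R1 + Suc (num_le (Suc r) R2) \<le> k + num_less (Suc r) Y"
    using b[unfolded below_def, rule_format, of "Suc r"] by simp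
  then have "num_le r R1 + Suc (num_le r R2) \<le> k + num_less r Y"
    unfolding filter_le_Suc filter_less_Suc using c z by simp
  then have *: "num_le r (R1 @ r # R2) \<le> k + num_less r Y" by simp
  show "below k (R1 @ r # R2) Y" unfolding below_def
  proof
    fix x
    show "num_le x (R1 @ r # R2) \<le> k + num_less x Y"
    proof (cases "x = r")
      case False
      then show ?thesis using b[unfolded below_def, rule_format, of x] by (auto split: if_splits)
    qed (use * in simp)
  qed
qed

text \<open>Rows are listed in reading order, that is, bottom row first.\<close>

definition similar :: "nat list list \<Rightarrow> nat list list \<Rightarrow> bool" where
  "similar L L' \<longleftrightarrow> map length L' = map length L \<and> (\<forall>R\<in>set L. sorted R) \<and> (\<forall>R\<in>set L'. sorted R) \<and>
     (\<forall>i k. Suc i < length L \<longrightarrow> (below k (L ! i) (L ! Suc i) \<longleftrightarrow> below k (L' ! i) (L' ! Suc i)))"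

lemma similar_length: "similar L L' \<Longrightarrow> length L' = length L"
  unfolding similar_def by (metis length_map)

lemma similar_refl: "\<forall>R\<in>set L. sorted R \<Longrightarrow> similar L L"
  by (simp add: similar_def)

lemma similar_sym: "similar L L' \<Longrightarrow> similar L' L"
  using similar_length[of L L'] by (auto simp: similar_def)

lemma similar_trans: "similar L L' \<Longrightarrow> similar L' L'' \<Longrightarrow> similar L L''"
  using similar_length[of L L'] by (auto simp: similar_def)

lemma concat_split:
  "concat L = A @ x # B \<Longrightarrow> \<exists>M R1 R2 N. L = M @ (R1 @ x # R2) # N \<and> A = concat M @ R1 \<and> B = R2 @ concat N"
proof (induction L arbitrary: A)
  case (Cons R L)
  from Cons.prems have "R @ concat L = A @ x # B" by simp
  then consider R2 where "R = A @ x # R2" "B = R2 @ concat L" | A' where "A = R @ A'" "concat L = A' @ x # B"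
    by (auto simp: append_eq_append_conv2 append_eq_Cons_conv Cons_eq_append_conv)
  then show ?case
  proof cases
    case 1
    then show ?thesis by (intro exI[of _ "[]"] exI[of _ A] exI[of _ R2] exI[of _ L]) auto
  next
    case 2
    then obtain M R1 R2 N where "L = M @ (R1 @ x # R2) # N" "A' = concat M @ R1" "B = R2 @ concat N"
      using Cons.IH by blast
    then show ?thesis using 2
      by (intro exI[of _ "R # M"] exI[of _ R1] exI[of _ R2] exI[of _ N]) auto
  qed
qed simp

text \<open>The changed row meets one neighbour on each side, and the bracket conditions on the
  whole word restrict to these two pairs. The array need not be a tableau: later a row is put in
  front of or behind one, which is why all offsets \<open>k\<close> are tracked.\<close>

lemma similar_flip:
  assumes L: "L = M @ (R1 @ r # R2) # N" and L': "L' = M @ (R1 @ Suc r # R2) # N"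
    and s: "(\<forall>R\<in>set L. sorted R) \<or> (\<forall>R\<in>set L'. sorted R)"
    and q: "high r (concat M @ R1) = 0" "low r (R2 @ concat N) = 0"
  shows "similar L L'"
proof -
  have "high r R1 = 0" "low r R2 = 0" using q by auto
  then have e: "sorted (R1 @ r # R2) \<longleftrightarrow> sorted (R1 @ Suc r # R2)" by (rule sorted_flip)
  then have s1: "\<forall>R\<in>set L. sorted R" "\<forall>R\<in>set L'. sorted R" using s L L' by auto
  then have s2: "sorted (R1 @ r # R2)" "sorted (R1 @ Suc r # R2)" using L L' by auto
  have "below k (L ! i) (L ! Suc i) \<longleftrightarrow> below k (L' ! i) (L' ! Suc i)" if i: "Suc i < length L" for i k
  proof -
    consider "i = length M" | "Suc i = length M" | "i \<noteq> length M" "Suc i \<noteq> length M" by blast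
    then show ?thesis
    proof cases
      case 1
      then obtain Y N' where N: "N = Y # N'" using i L by (cases N) auto
      have "low r (R2 @ Y) = 0" using q N by auto
      moreover have "sorted Y" using s1 L N by auto
      ultimately show ?thesis using below_flip_left[of Y R1 r R2 k] s2 1 L L' N by (simp add: nth_append)
    next
      case 2
      then have M: "M = butlast M @ [last M]" by (metis append_butlast_last_id list.size(3) nat.distinct(1))
      then have X: "L ! i = last M" "L' ! i = last M" using 2 L L'
        by (metis Suc_inject diff_Suc_1 last_conv_nth lessI list.size(3) nat.distinct(1) nth_append)+
      \<comment> \<open>Letters further to the left can only add open letters, so the condition on
        the whole prefix passes to the last row of \<open>M\<close> followed by
        \<open>R1\<close>.\<close>
      have "high r (concat M @ R1) = high r (concat (butlast M) @ (last M @ R1))" using M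
        by (metis append.assoc concat.simps concat_append append_Nil2)
      then have "high r (last M @ R1) = 0" using q(1) by (metis add_is_0 high_append)
      moreover have "sorted (last M)" using s1 L M by (metis Un_iff in_set_conv_decomp set_append)
      ultimately show ?thesis using below_flip_right[of "last M" R1 r R2 k] s2 2 L L' X by (simp add: nth_append)
    next
      case 3
      then have "L ! i = L' ! i" "L ! Suc i = L' ! Suc i" using L L' by (auto simp: nth_append nth_Cons split: nat.splits)
      then show ?thesis by simp
    qed
  qed
  then show ?thesis using s1 L L' by (auto simp: similar_def)
qed

lemma similar_flip_ex:
  assumes "\<forall>R\<in>set L. sorted R" "flip r (concat L) u"
  shows "\<exists>L'. u = concat L' \<and> similar L L'"
proof -
  obtain A B where AB: "concat L = A @ r # B" "u = A @ Suc r # B" "high r A = 0" "low r B = 0"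
    using assms unfolding flips_def by auto
  obtain M R1 R2 N where 1: "L = M @ (R1 @ r # R2) # N" "A = concat M @ R1" "B = R2 @ concat N"
    using concat_split[OF AB(1)] by blast
  then show ?thesis using similar_flip[OF 1(1) refl] assms(1) AB
    by (intro exI[of _ "M @ (R1 @ Suc r # R2) # N"]) auto
qed

text \<open>Similarity says nothing about the first row of the array relative to the last, but
  \<open>pull_step\<close> compares exactly these two; there the letter-by-letter change of the rows
  is needed.\<close>

lemma similar_flip_ex':
  assumes "\<forall>R\<in>set L. sorted R" "flip r u (concat L)"
  shows "\<exists>L'. u = concat L' \<and> similar L L' \<and>
    list_all2 (\<lambda>R R'. R = R' \<or> (\<exists>R1 R2. R = R1 @ r # R2 \<and> R' = R1 @ Suc r # R2)) L' L"
proof -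
  obtain A B where AB: "concat L = A @ Suc r # B" "u = A @ r # B" "high r A = 0" "low r B = 0"
    using assms unfolding flips_def by auto
  obtain M R1 R2 N where 1: "L = M @ (R1 @ Suc r # R2) # N" "A = concat M @ R1" "B = R2 @ concat N"
    using concat_split[OF AB(1)] by blast
  then show ?thesis using similar_flip[OF refl 1(1)] assms(1) AB
    by (intro exI[of _ "M @ (R1 @ r # R2) # N"]) (auto intro!: similar_sym list_all2_appendI list.rel_refl)
qed

lemma similar_fill:
  assumes "\<forall>R\<in>set L. sorted R" "t \<le> low r (concat L) + high r (concat L)"
  shows "\<exists>L'. fill r t (concat L) = concat L' \<and> similar L L'"
  using linked_fill[OF assms(2)]
proof (induction rule: linked_induct)
  show "\<exists>L'. concat L = concat L' \<and> similar L L'" using similar_refl[OF assms(1)] by blast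
next
  fix v w assume "\<exists>L'. v = concat L' \<and> similar L L'" "flip r v w"
  then obtain L1 where L1: "v = concat L1" "similar L L1" by blast
  then have "\<forall>R\<in>set L1. sorted R" by (simp add: similar_def)
  then show "\<exists>L'. w = concat L' \<and> similar L L'"
    using similar_flip_ex[of L1 r w] \<open>flip r v w\<close> L1 similar_trans by blast
next
  fix v w assume "\<exists>L'. v = concat L' \<and> similar L L'" "flip r w v"
  then obtain L1 where L1: "v = concat L1" "similar L L1" by blast
  then have "\<forall>R\<in>set L1. sorted R" by (simp add: similar_def)
  then show "\<exists>L'. w = concat L' \<and> similar L L'"
    using similar_flip_ex'[of L1 r w] \<open>flip r w v\<close> L1 similar_trans by blast
qed

lemma cut_concat: "map length L' = map length L \<Longrightarrow> cut (map length L) (concat L') = L'"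
proof (induction L arbitrary: L')
  case (Cons R L)
  then show ?case by (cases L') auto
qed auto

section \<open>Operators on tableaux\<close>

lemma column_strict_sorted: "column_strict T \<Longrightarrow> \<forall>R\<in>set T. sorted R"
  by (auto simp: column_strict_def)

lemma set_row_word: "set (row_word T) = (\<Union>R\<in>set T. set R)"
  by (auto simp: row_word_def)

lemma column_strict_pos: "column_strict T \<Longrightarrow> 0 \<notin> set (row_word T)"
  by (auto simp: column_strict_def set_row_word)

lemma row_word_rev: "row_word (rev L) = concat L"
  by (simp add: row_word_def)

lemma column_strict_similar:
  assumes "column_strict T" "similar (rev T) L" "0 \<notin> set (concat L)"
  shows "column_strict (rev L)" "map length (rev L) = map length T"
proof -
  have len: "length L = length T" using similar_length[OF assms(2)] by simp
  have ml: "map length L = map length (rev T)" using assms(2) by (simp add: similar_def)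
  show m: "map length (rev L) = map length T" using ml by (simp add: rev_map[symmetric])
  have "0 \<notin> length ` set L"
  proof -
    have "length ` set L = length ` set T" using arg_cong[OF ml, of set] by simp
    then show ?thesis using assms(1) by (auto simp: column_strict_def)
  qed
  then have "\<forall>R\<in>set L. R \<noteq> []" by force
  moreover have "below 0 (rev L ! Suc i) (rev L ! i)" if i: "Suc i < length L" for i
  proof -
    define j where "j = length L - Suc (Suc i)"
    have j: "Suc j < length L" "rev L ! Suc i = L ! j" "rev L ! i = L ! Suc j"
      "T ! Suc i = rev T ! j" "T ! i = rev T ! Suc j"
      using i len by (auto simp: j_def rev_nth Suc_diff_Suc)
    have "below 0 (T ! Suc i) (T ! i)" using assms(1) i len by (auto simp: column_strict_iff)
    then show ?thesis using assms(2) j len by (auto simp: similar_def)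
  qed
  ultimately show "column_strict (rev L)"
    using assms(2,3) by (auto simp: column_strict_iff similar_def)
qed

lemma set_fill: "set (fill r t u) \<subseteq> set u \<union> {r, Suc r}"
  by (auto simp: set_unpaired_def)

lemma on_tableau_fill:
  assumes "column_strict T" "r > 0" "t \<le> low r (row_word T) + high r (row_word T)"
    and "g (row_word T) = fill r t (row_word T)"
  shows "column_strict (on_tableau g T)" "map length (on_tableau g T) = map length T"
    "row_word (on_tableau g T) = g (row_word T)"
proof -
  have rw: "row_word T = concat (rev T)" by (simp add: row_word_def)
  obtain L where L: "g (row_word T) = concat L" "similar (rev T) L"
    using similar_fill[of "rev T" t r] column_strict_sorted[OF assms(1)] assms(3,4) rw by auto
  have "on_tableau g T = rev L"
    using L cut_concat[of L "rev T"] by (simp add: on_tableau_def similar_def)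
  moreover have "0 \<notin> set (concat L)"
    using set_fill[of r t "row_word T"] column_strict_pos[OF assms(1)] assms(2,4) L(1) by auto
  ultimately show "column_strict (on_tableau g T)" "map length (on_tableau g T) = map length T"
    "row_word (on_tableau g T) = g (row_word T)"
    using column_strict_similar[OF assms(1) L(2)] L(1) by (simp_all add: row_word_rev)
qed

lemma reflect_tableau:
  assumes "column_strict T" "r > 0"
  shows "column_strict (reflect r T)" "map length (reflect r T) = map length T"
    "row_word (reflect r T) = reflect_word r (row_word T)"
  unfolding reflect_def
  by (rule on_tableau_fill[OF assms, of "high r (row_word T)"]; simp add: reflect_word_eq)+

lemma lower_tableau:
  assumes "column_strict T" "r > 0"
  shows "column_strict (lower r T)" "map length (lower r T) = map length T"
    "row_word (lower r T) = lower_word r (row_word T)"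
  unfolding lower_def
  by (rule on_tableau_fill[OF assms, of "low r (row_word T) - 1"]; simp add: lower_word_eq)+

lemma count_diff: "int (count_list u r) - int (count_list u (Suc r)) = int (low r u) - int (high r u)"
  by (induction u) auto

lemma flip_count: "flip r u v \<Longrightarrow> (\<forall>i. i \<noteq> r \<and> i \<noteq> Suc r \<longrightarrow> count_list v i = count_list u i) \<and>
  count_list u r = Suc (count_list v r) \<and> count_list v (Suc r) = Suc (count_list u (Suc r))"
  unfolding flips_def by auto

lemma fill_count:
  assumes "t \<le> low r u + high r u"
  shows "(\<forall>i. i \<noteq> r \<and> i \<noteq> Suc r \<longrightarrow> count_list (fill r t u) i = count_list u i) \<and>
    count_list (fill r t u) r + count_list (fill r t u) (Suc r) = count_list u r + count_list u (Suc r)"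
  using linked_fill[OF assms]
  by (induction rule: linked_induct) (auto dest!: flip_count)

lemma count_reflect_word: "count_list (reflect_word r u) (transpose r (Suc r) i) = count_list u i"
proof -
  let ?v = "reflect_word r u"
  have *: "count_list ?v r = count_list u (Suc r)" "count_list ?v (Suc r) = count_list u r"
    using fill_count[of "high r u" r u] count_diff[of u r] count_diff[of ?v r] fill_stats[of "high r u" r u]
    by (auto simp: reflect_word_eq)
  show ?thesis using * fill_count[of "high r u" r u]
    by (auto simp: transpose_def reflect_word_eq)
qed

section \<open>Catabolism and its compatibility with the elementary maps\<close>

lemma row_word_first_row: "row_word T = row_word (tl T) @ first_row T"
  by (cases T) (auto simp: row_word_Cons first_row_def)

lemma Cat_eq: "column_strict T \<Longrightarrow> Cat T = schensted (first_row T @ row_word (tl T))"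
  unfolding Cat_def using column_strict_pos[of T] row_word_first_row[of T]
  by (intro P_tableau_eq_schensted) auto

lemma column_strict_Cat: "column_strict T \<Longrightarrow> column_strict (Cat T)"
  using column_strict_pos[of T] row_word_first_row[of T]
  by (auto simp: Cat_eq intro!: column_strict_schensted)

lemma row_word_Cat: "column_strict T \<Longrightarrow> row_word (Cat T) \<approx> first_row T @ row_word (tl T)"
  by (simp add: Cat_eq knuth_schensted)

lemma count_Cat: "column_strict T \<Longrightarrow> count_list (row_word (Cat T)) i = count_list (row_word T) i"
  using knuth_count[OF row_word_Cat, of T i] row_word_first_row[of T] by simp

lemma column_strict_tl: "column_strict T \<Longrightarrow> column_strict (tl T)"
  by (cases T) (auto simp: column_strict_Cons)

lemma sorted_first_row: "column_strict T \<Longrightarrow> sorted (first_row T)"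
  by (cases T) (auto simp: column_strict_Cons first_row_def)

lemma tl_gt_hd: "column_strict (R # T) \<Longrightarrow> x \<in> set (row_word T) \<Longrightarrow> hd R < x"
proof (induction T arbitrary: R)
  case (Cons H T)
  have "column_strict (H # T)" "sorted H" "H \<noteq> []" "R \<noteq> []" "sorted R" "below 0 H R"
    using Cons.prems by (auto simp: column_strict_Cons)
  moreover then have "hd R < hd H" using below_iff[of R H] by (auto simp: hd_conv_nth)
  moreover have "x \<in> set H \<Longrightarrow> hd H \<le> x" using \<open>sorted H\<close> \<open>H \<noteq> []\<close> by (cases H) auto
  ultimately show ?case using Cons.IH[of H] Cons.prems(2) by (fastforce simp: row_word_Cons)
qed simp

lemma tl_ge_2: "column_strict T \<Longrightarrow> x \<in> set (row_word (tl T)) \<Longrightarrow> 2 \<le> x"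
  using tl_gt_hd[of "hd T" "tl T" x] by (cases T) (fastforce simp: column_strict_Cons neq_Nil_conv)+

lemma length_row_word: "length (row_word T) = sum_list (map length T)"
  by (simp add: row_word_def length_concat rev_map[symmetric])

lemma length_first_row: "length (first_row T) = (case map length T of [] \<Rightarrow> 0 | h # _ \<Rightarrow> h)"
  by (cases T) (auto simp: first_row_def)

text \<open>The elementary maps broken up into single operators. The guard of the second rule
  ensures an unpaired letter 1, so that \<open>lower_word\<close> really lowers; it also keeps the
  maximal multiplicity from growing.\<close>

inductive step :: "tableau \<Rightarrow> tableau \<Rightarrow> bool" where
  reflect: "r > 0 \<Longrightarrow> step T (reflect r T)"
| lower: "count_list (row_word T) 1 > count_list (row_word T) 2 + 1 \<Longrightarrow> step T (lower 1 T)"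

lemma low_pos: "count_list u 1 > count_list u 2 + 1 \<Longrightarrow> low 1 u > 0"
  using count_diff[of u 1] by (auto simp: numeral_2_eq_2)

lemma step_column_strict: "step T T' \<Longrightarrow> column_strict T \<Longrightarrow> column_strict T' \<and> map length T' = map length T"
  by (induction rule: step.induct) (auto simp: reflect_tableau lower_tableau)

lemma step_Cat:
  assumes "step T T'" "column_strict T"
  shows "step (Cat T) (Cat T')"
proof -
  have T': "column_strict T'" "map length T' = map length T" using step_column_strict assms by auto
  let ?R = "first_row T" and ?U = "row_word (tl T)" and ?R' = "first_row T'" and ?U' = "row_word (tl T')"
  have len: "length ?R' = length ?R" "length ?U' = length ?U"
    using T' by (auto simp: length_first_row length_row_word map_tl)
  have w: "row_word T = ?U @ ?R" "row_word T' = ?U' @ ?R'" by (rule row_word_first_row)+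
  note C = column_strict_Cat[OF assms(2)]
  from assms(1) show ?thesis
  proof cases
    case (reflect r)
    have "reflect_word r (?U @ ?R) = ?U' @ ?R'" using reflect w reflect_tableau[OF assms(2)] by metis
    \<comment> \<open>Moving the first row to the front is a rotation of the reading word, and
      reflections preserve the two lengths.\<close>
    then have "reflect_word r (?R @ ?U) = ?R' @ ?U'" using reflect_word_swap len by blast
    then have "row_word (reflect r (Cat T)) \<approx> ?R' @ ?U'"
      using reflect_word_knuth[OF row_word_Cat[OF assms(2)], of r] reflect_tableau[OF C] reflect by metis
    then have "reflect r (Cat T) = Cat T'"
      using schensted_unique reflect_tableau(1)[OF C] reflect Cat_eq[OF T'(1)] by metis
    then show ?thesis using step.reflect reflect by metis
  next
    case lower
    have low: "low 1 (?U @ ?R) > 0" using low_pos[OF lower(2)] w by simp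
    have "flip 1 (?U @ ?R) (?U' @ ?R')"
      using flip_lower[OF low] w lower_tableau(3)[OF assms(2), of 1] lower(1) by simp
    then obtain A B where AB: "?U @ ?R = A @ 1 # B" "?U' @ ?R' = A @ Suc 1 # B" "high 1 A = 0" "low 1 B = 0"
      unfolding flips_def by blast
    have no1: "1 \<notin> set ?U" using tl_ge_2[OF assms(2)] by fastforce
    have "length ?U \<le> length A"
    proof (rule ccontr)
      assume "\<not> ?thesis"
      then have "(A @ 1 # B) ! length A \<in> set ?U" using AB(1) by (metis nth_append nth_mem not_le)
      then show False using no1 by simp
    qed
    then obtain A1 where A1: "A = ?U @ A1" "?R = A1 @ 1 # B"
      using AB(1) by (auto simp: append_eq_append_conv2)
    then have R': "?U' = ?U" "?R' = A1 @ Suc 1 # B" using AB(2) len by auto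
    \<comment> \<open>Since \<open>?U\<close> contains no letter 1, moving it behind the first row
      creates no unpaired 1 there, and the same letter of the row is lowered as before.\<close>
    have "low 1 ?U = 0" using no1
    proof -
      have "1 \<notin> set u \<Longrightarrow> low 1 u = 0" for u by (induction u) auto
      then show ?thesis using no1 by blast
    qed
    then have fl: "flip 1 (?R @ ?U) (?R' @ ?U')"
      unfolding flips_def using A1 R' AB(3,4) by (intro exI[of _ A1] exI[of _ "B @ ?U"]) auto
    moreover have "low 1 (?R @ ?U) > 0" using flip_low[OF fl] by linarith
    ultimately have "lower_word 1 (?R @ ?U) = ?R' @ ?U'"
      using flips_det[OF _ fl] flip_lower by blast
    then have "row_word (lower 1 (Cat T)) \<approx> ?R' @ ?U'"
      using lower_word_knuth[OF row_word_Cat[OF assms(2)], of 1] lower_tableau(3)[OF C, of 1] by simp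
    then have "lower 1 (Cat T) = Cat T'"
      using schensted_unique lower_tableau(1)[OF C, of 1] Cat_eq[OF T'(1)] by simp
    then show ?thesis using step.lower[of "Cat T"] lower count_Cat[OF assms(2)] by simp
  qed
qed



section \<open>Shape sequences under repeated catabolism\<close>

definition cat_sim :: "tableau \<Rightarrow> tableau \<Rightarrow> bool" where
  "cat_sim T S \<longleftrightarrow> (\<forall>i. map length ((Cat ^^ i) T) = map length ((Cat ^^ i) S))"

lemma cat_sim_sym: "cat_sim T S \<Longrightarrow> cat_sim S T"
  by (simp add: cat_sim_def)

lemma cat_sim_trans: "cat_sim T S \<Longrightarrow> cat_sim S U \<Longrightarrow> cat_sim T U"
  by (simp add: cat_sim_def)

lemma cat_sim_Cat_iff: "cat_sim T S \<longleftrightarrow> map length T = map length S \<and> cat_sim (Cat T) (Cat S)"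
proof
  assume s: "cat_sim T S"
  have "map length ((Cat ^^ i) (Cat T)) = map length ((Cat ^^ i) (Cat S))" for i
    using s[unfolded cat_sim_def, rule_format, of "Suc i"] by (simp add: funpow_Suc_right del: funpow.simps)
  then show "map length T = map length S \<and> cat_sim (Cat T) (Cat S)"
    using s[unfolded cat_sim_def, rule_format, of 0] by (simp add: cat_sim_def)
next
  assume a: "map length T = map length S \<and> cat_sim (Cat T) (Cat S)"
  have "map length ((Cat ^^ i) T) = map length ((Cat ^^ i) S)" for i
    using a by (cases i) (auto simp: cat_sim_def funpow_Suc_right simp del: funpow.simps(2))
  then show "cat_sim T S" by (simp add: cat_sim_def)
qed

lemma step_cat_sim:
  assumes "step T T'" "column_strict T"
  shows "cat_sim T T'"
proof -
  have "map length ((Cat ^^ i) T) = map length ((Cat ^^ i) T')" for i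
    using assms
  proof (induction i arbitrary: T T')
    case 0
    then show ?case using step_column_strict by auto
  next
    case (Suc i)
    then show ?case using step_Cat column_strict_Cat by (simp add: funpow_Suc_right del: funpow.simps)
  qed
  then show ?thesis by (simp add: cat_sim_def)
qed

lemma steps_cat_sim:
  assumes "step\<^sup>*\<^sup>* T T'" "column_strict T"
  shows "cat_sim T T' \<and> column_strict T'"
  using assms(1)
proof induction
  case base
  then show ?case using assms by (simp add: cat_sim_def)
next
  case (step S S')
  then show ?case using step_cat_sim cat_sim_trans step_column_strict by blast
qed

section \<open>Prepending letters to the first row\<close>

definition prepend :: "nat list \<Rightarrow> tableau \<Rightarrow> tableau" where
  "prepend a X = (a @ first_row X) # tl X"

lemma row_ins_above: "\<forall>y\<in>set a. y \<le> x \<Longrightarrow> row_ins x (a @ R) = a @ row_ins x R \<and> bump x (a @ R) = bump x R"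
  by (induction a) auto

lemma insert_word_above:
  "\<forall>x\<in>set w. \<forall>y\<in>set a. y \<le> x \<Longrightarrow> insert_word (a @ R) w = a @ insert_word R w \<and> bumps (a @ R) w = bumps R w"
  by (induction w arbitrary: R) (auto simp: row_ins_above)

text \<open>The letters of \<open>a\<close> are at most as large as all later ones and hence are
  never bumped; they stay in front of the first row while the rest is inserted behind them.\<close>

lemma schensted_prepend:
  assumes "a \<noteq> []" "sorted a" "\<forall>x\<in>set w. \<forall>y\<in>set a. y \<le> x"
  shows "schensted (a @ w) = prepend a (schensted w)"
proof -
  have "insert_word [] a = a" "bumps [] a = []" using insert_word_over[of "[]" a "[]"] assms by auto
  then have "schensted (a @ w) = (a @ insert_word [] w) # schensted (bumps [] w)"
    using assms insert_word_above[of w a "[]"] by simp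
  then show ?thesis by (cases "w = []") (auto simp: prepend_def first_row_def)
qed

definition prependable :: "nat list \<Rightarrow> nat list \<Rightarrow> bool" where
  "prependable a w \<longleftrightarrow> a \<noteq> [] \<and> sorted a \<and> 0 \<notin> set a \<and> (\<forall>x\<in>set w. \<forall>y\<in>set a. y \<le> x)"

lemma column_strict_prepend:
  assumes "prependable a (row_word X)" "column_strict X"
  shows "column_strict (prepend a X)"
proof -
  have "prepend a X = schensted (a @ row_word X)"
    using schensted_prepend[of a "row_word X"] schensted_row_word[OF assms(2)] assms(1) by (simp add: prependable_def)
  then show ?thesis
    using column_strict_schensted[of "a @ row_word X"] column_strict_pos[OF assms(2)] assms(1)
    by (auto simp: prependable_def)
qed

lemma set_Cat: "column_strict T \<Longrightarrow> set (row_word (Cat T)) = set (row_word T)"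
  using knuth_set[OF row_word_Cat, of T] row_word_first_row[of T] by auto

lemma Cat_Cons:
  assumes "column_strict ((a @ R) # U)" "prependable a (R @ row_word U)"
  shows "Cat ((a @ R) # U) = prepend a (schensted (R @ row_word U))"
  using Cat_eq[OF assms(1)] schensted_prepend[of a "R @ row_word U"] assms(2)
  by (simp add: first_row_def prependable_def)

lemma Cat_prepend:
  assumes "prependable a (row_word X)" "column_strict X"
  shows "Cat (prepend a X) = prepend a (Cat X)"
  using Cat_Cons[of a "first_row X" "tl X"] column_strict_prepend[OF assms] assms row_word_first_row[of X] Cat_eq[OF assms(2)]
  by (auto simp: prepend_def prependable_def)

lemma Cat_funpow_column_strict: "column_strict X \<Longrightarrow> column_strict ((Cat ^^ i) X) \<and> set (row_word ((Cat ^^ i) X)) = set (row_word X)"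
  by (induction i) (auto simp: column_strict_Cat set_Cat)

lemma Cat_funpow_prepend:
  assumes "prependable a (row_word X)" "column_strict X"
  shows "(Cat ^^ i) (prepend a X) = prepend a ((Cat ^^ i) X)"
proof (induction i)
  case (Suc i)
  have "prependable a (row_word ((Cat ^^ i) X))" using assms Cat_funpow_column_strict by (simp add: prependable_def)
  then show ?case using Suc Cat_prepend Cat_funpow_column_strict[OF assms(2)] by simp
qed simp

lemma map_length_prepend: "map length (prepend a X) =
    (length a + (case map length X of [] \<Rightarrow> 0 | h # _ \<Rightarrow> h)) # tl (map length X)"
  by (simp add: prepend_def length_first_row map_tl)

text \<open>The prepended letters may differ, only their number enters the shapes. It is used with
  \<open>k\<close> equal letters on one side and \<open>k\<close> consecutive ones on the
  other.\<close>

lemma cat_sim_prepend: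
  assumes "cat_sim X Y" "prependable a (row_word X)" "prependable b (row_word Y)" "length a = length b"
    "column_strict X" "column_strict Y"
  shows "cat_sim (prepend a X) (prepend b Y)"
  using assms unfolding cat_sim_def by (simp add: Cat_funpow_prepend map_length_prepend)

section \<open>Transposition\<close>

lemma knuth_move_column:
  assumes "sorted (z # Z)" "sorted_wrt (>) C" "\<forall>c\<in>set C. c < z"
  shows "z # Z @ C \<approx> z # C @ Z"
  using assms
proof (induction C arbitrary: z)
  case (Cons c C)
  have "(z # Z @ [c]) @ C \<approx> (z # c # Z) @ C"
    using knuth_append[OF knuth_move_left[of z Z c] knuth_refl[of C]] Cons.prems by auto
  also have "(z # c # Z) @ C = z # (c # Z @ C)" by simp
  also have "c # Z @ C \<approx> c # C @ Z"
    using Cons.prems by (intro Cons.IH) auto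
  then have "z # (c # Z @ C) \<approx> z # (c # C @ Z)" by (rule knuth_Cons)
  finally show ?case by simp
qed simp

text \<open>The bottom row comes first in the word. Its tail moves to the right past the heads of
  the rows above, all of which are smaller than its own head.\<close>

lemma knuth_first_column:
  assumes "\<forall>R\<in>set U. R \<noteq> [] \<and> sorted R" "sorted_wrt (<) (map hd U)"
  shows "row_word U \<approx> rev (map hd U) @ row_word (map tl U)"
  using assms
proof (induction U rule: rev_induct)
  case (snoc Z U)
  let ?C = "rev (map hd U)"
  have Z: "Z = hd Z # tl Z" "sorted (hd Z # tl Z)" using snoc.prems by auto
  have "row_word (U @ [Z]) = Z @ row_word U" by (simp add: row_word_def)
  also have "\<dots> \<approx> Z @ ?C @ row_word (map tl U)"
    using snoc by (intro knuth_append snoc.IH) (auto simp: sorted_wrt_append)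
  also have "\<dots> = (hd Z # tl Z @ ?C) @ row_word (map tl U)" using Z(1) by (metis append.assoc append_Cons)
  also have "\<dots> \<approx> (hd Z # ?C @ tl Z) @ row_word (map tl U)"
  proof (intro knuth_append knuth_move_column)
    show "sorted_wrt (>) ?C" using snoc.prems by (simp add: sorted_wrt_rev sorted_wrt_append)
  qed (use Z snoc.prems in \<open>auto simp: sorted_wrt_append\<close>)
  finally show ?case by (simp add: row_word_def)
qed simp

definition strip :: "tableau \<Rightarrow> tableau" where
  "strip U = filter (\<lambda>R. R \<noteq> []) (map tl U)"

text \<open>The rows of length one are at the bottom, so dropping empty tails does not shift the
  indices of the remaining rows.\<close>

lemma strip_prefix: "column_strict U \<Longrightarrow> strip U = map tl (take (length (strip U)) U)"
proof (induction U)
  case (Cons R U)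
  show ?case
  proof (cases "tl R = []")
    case True
    have "strip U = []"
    proof (cases U)
      case (Cons H U')
      then have "length (hd (map tl U)) = 0" using Cons.prems True below_iff[of R H]
        by (cases R; cases H) (auto simp: column_strict_Cons)
      then have H: "tl H = []" using Cons by (cases H) auto
      have IH: "strip U = map tl (take (length (strip U)) U)"
        using Cons.IH Cons.prems by (simp add: column_strict_Cons)
      show ?thesis
      proof (cases "strip U")
        case c: (Cons S Ss)
        then have "take (length (strip U)) U = H # take (length Ss) U'" using Cons by simp
        then have "S = tl H" using IH c by (metis list.sel(1) list.simps(9))
        moreover have "S \<in> set (strip U)" using c by simp
        then have "S \<noteq> []" by (simp add: strip_def)
        ultimately show ?thesis using H by simp
      qed simp
    qed (simp add: strip_def)
    then show ?thesis using True by (simp add: strip_def)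
  next
    case False
    then show ?thesis using Cons by (simp add: strip_def column_strict_Cons)
  qed
qed (simp add: strip_def)

lemma row_word_strip: "row_word (strip U) = row_word (map tl U)"
  by (induction U) (auto simp: strip_def row_word_Cons)

lemma column_strict_strip:
  assumes "column_strict U"
  shows "column_strict (strip U)"
proof -
  let ?m = "length (strip U)"
  have m: "?m \<le> length U" by (simp add: strip_def le_trans[OF length_filter_le])
  have nth: "strip U ! i = tl (U ! i)" if "i < ?m" for i
    using strip_prefix[OF assms] that m by (metis length_take min.absorb2 nth_map nth_take)
  have "below 0 (strip U ! Suc i) (strip U ! i)" if i: "Suc i < ?m" for i
  proof -
    let ?R = "U ! i" and ?H = "U ! Suc i"
    have s: "sorted ?R" "sorted ?H" "below 0 ?H ?R" "?R \<noteq> []" "?H \<noteq> []"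
      using assms i m by (auto simp: column_strict_iff)
    then have "below 0 (tl ?H) (tl ?R)"
      using below_iff[of ?R ?H] below_iff[of "tl ?R" "tl ?H"] by (auto simp: sorted_tl nth_tl)
    then show ?thesis using nth i by simp
  qed
  moreover have "row \<noteq> [] \<and> sorted row \<and> 0 \<notin> set row" if "row \<in> set (strip U)" for row
    using that assms by (auto simp: strip_def column_strict_def sorted_tl dest: list.set_sel(2))
  ultimately show ?thesis by (auto simp: column_strict_iff)
qed

lemma heads_increasing: "column_strict U \<Longrightarrow> sorted_wrt (<) (map hd U)"
proof (induction U)
  case (Cons R U)
  show ?case
  proof (cases U)
    case c: (Cons H U')
    have "hd R < hd H" using Cons.prems c below_iff[of R H] by (auto simp: column_strict_Cons hd_conv_nth)
    then show ?thesis using Cons c by (auto simp: column_strict_Cons intro: less_trans)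
  qed simp
qed simp

text \<open>The conjugate partition, read off column by column in the recursion of
  \<open>transpose_ex\<close>. What matters is that the shape of the transposed tableau depends on
  the shape of the given one only.\<close>

function conj_shape :: "nat list \<Rightarrow> nat list" where
  "conj_shape l = (if l = [] then [] else length l # conj_shape (filter (\<lambda>x. 0 < x) (map (\<lambda>x. x - 1) l)))"
  by auto
termination
proof (relation "measure (\<lambda>l. sum_list l + length l)")
  fix l :: "nat list" assume "l \<noteq> []"
  have "sum_list (filter (\<lambda>x. 0 < x) (map (\<lambda>x. x - 1) l)) + length (filter (\<lambda>x. 0 < x) (map (\<lambda>x. x - 1) l)) \<le> sum_list l" for l :: "nat list"
    by (induction l) auto
  from this[of l] have "sum_list (filter (\<lambda>x. 0 < x) (map (\<lambda>x. x - 1) l)) + length (filter (\<lambda>x. 0 < x) (map (\<lambda>x. x - 1) l)) < sum_list l + length l"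
    using \<open>l \<noteq> []\<close> unfolding length_greater_0_conv[symmetric] by linarith
  then show "(filter (\<lambda>x. 0 < x) (map (\<lambda>x. x - 1) l), l) \<in> measure (\<lambda>l. sum_list l + length l)"
    by (simp only: in_measure)
qed simp

declare conj_shape.simps [simp del]

lemma map_length_strip: "map length (strip U) = filter (\<lambda>x. 0 < x) (map (\<lambda>x. x - 1) (map length U))"
proof (induction U)
  case (Cons R U)
  have "tl R \<noteq> [] \<longleftrightarrow> 0 < length R - 1" by (metis length_greater_0_conv length_tl)
  then show ?case using Cons by (auto simp: strip_def)
qed (simp add: strip_def)

text \<open>The first column becomes the first row and the stripped tableau supplies the rest. The
  conjunct on \<open>hd V\<close> strengthens the induction: fitting the new row above
  \<open>V\<close> means comparing the first two columns of \<open>U\<close>.\<close>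

lemma transpose_ex:
  assumes "column_strict U" "distinct (row_word U)"
  shows "\<exists>V. column_strict V \<and> rev (row_word U) \<approx> row_word V \<and> map length V = conj_shape (map length U) \<and>
    (V \<noteq> [] \<longrightarrow> hd V = map hd U)"
  using assms
proof (induction "length (row_word U)" arbitrary: U rule: less_induct)
  case less
  show ?case
  proof (cases "U = []")
    case True
    then show ?thesis by (intro exI[of _ "[]"]) (simp add: conj_shape.simps)
  next
    case False
    have rows: "\<forall>R\<in>set U. R \<noteq> [] \<and> sorted R \<and> 0 \<notin> set R" using less.prems by (auto simp: column_strict_def)
    have k: "row_word U \<approx> rev (map hd U) @ row_word (strip U)"
      using knuth_first_column[of U] heads_increasing rows less.prems by (simp add: row_word_strip)
    then have d: "distinct (row_word (strip U))" using less.prems knuth_distinct by force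
    have "length (row_word (strip U)) < length (row_word U)" using knuth_length[OF k] False by simp
    then obtain V where V: "column_strict V" "rev (row_word (strip U)) \<approx> row_word V"
      "map length V = conj_shape (map length (strip U))" "V \<noteq> [] \<longrightarrow> hd V = map hd (strip U)"
      using less.hyps column_strict_strip[OF less.prems(1)] d by blast
    let ?C = "map hd U"
    have sC: "sorted ?C" using heads_increasing[OF less.prems(1)] strict_sorted_imp_sorted by blast
    have "column_strict (?C # V)"
      unfolding column_strict_Cons
    proof (intro conjI impI)
      show "?C \<noteq> []" using False by simp
      show "sorted ?C" by fact
      show "0 \<notin> set ?C" using rows by (fastforce dest: hd_in_set)
      assume "V \<noteq> []"
      let ?m = "length (strip U)"
      have m: "?m \<le> length U" by (simp add: strip_def le_trans[OF length_filter_le])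
      have "U ! j ! 0 < hd (strip U ! j)" if j: "j < ?m" for j
      proof -
        have "strip U ! j = tl (U ! j)"
          using strip_prefix[OF less.prems(1)] j m by (metis length_take min.absorb2 nth_map nth_take)
        moreover have "strip U ! j \<in> set (strip U)" using j by simp
        ultimately have ne: "tl (U ! j) \<noteq> []" by (auto simp: strip_def)
        have R: "sorted (U ! j)" "U ! j \<in> set U" using rows j m by auto
        \<comment> \<open>Distinctness makes the rows strictly increasing, as columns of the
          transposed tableau have to be.\<close>
        have "distinct (U ! j)" using less.prems(2) R(2)
          by (simp add: row_word_def distinct_concat_iff)
        then show ?thesis using ne R \<open>strip U ! j = tl (U ! j)\<close>
          by (cases "U ! j"; cases "tl (U ! j)") (auto simp: order.order_iff_strict)
      qed
      then have "length (map hd (strip U)) \<le> length ?C \<and> (\<forall>j<length (map hd (strip U)). ?C ! j < map hd (strip U) ! j)"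
        using m rows by (auto simp: hd_conv_nth)
      moreover have "sorted (map hd (strip U))"
        using heads_increasing[OF column_strict_strip[OF less.prems(1)]] strict_sorted_imp_sorted by blast
      ultimately have "below 0 (map hd (strip U)) ?C" using below_iff[OF sC] by blast
      then show "below 0 (hd V) ?C" using V(4) \<open>V \<noteq> []\<close> by simp
    qed (fact V(1))
    moreover have "rev (row_word U) \<approx> row_word (?C # V)"
    proof -
      have "rev (row_word U) \<approx> rev (row_word (strip U)) @ ?C"
        using knuth_rev[OF k less.prems(2)] by simp
      also have "\<dots> \<approx> row_word V @ ?C" using V(2) by (intro knuth_append) auto
      finally show ?thesis by (simp add: row_word_Cons)
    qed
    moreover have "map length (?C # V) = conj_shape (map length U)"
      using V(3) False by (simp add: conj_shape.simps[of "map length U"] map_length_strip)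
    ultimately show ?thesis by (intro exI[of _ "?C # V"]) simp
  qed
qed

section \<open>Reversing insertions\<close>

fun tab_insert :: "nat \<Rightarrow> tableau \<Rightarrow> tableau" where
  "tab_insert x [] = [[x]]"
| "tab_insert x (R # T) = row_ins x R # (case bump x R of [] \<Rightarrow> T | b # _ \<Rightarrow> tab_insert b T)"

lemma schensted_snoc: "schensted (w @ [x]) = tab_insert x (schensted w)"
proof (induction w arbitrary: x rule: schensted.induct)
  case (2 w)
  have "bump x (insert_word [] w) = [] \<or> (\<exists>b. bump x (insert_word [] w) = [b])" by (rule length_bump)
  then show ?case using 2 by auto
qed simp

lemma schensted_append: "schensted (w @ D) = foldl (\<lambda>T x. tab_insert x T) (schensted w) D"
proof (induction D rule: rev_induct)
  case (snoc x D)
  then show ?case using schensted_snoc[of "w @ D" x] by simp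
qed simp

definition wf_rows :: "tableau \<Rightarrow> bool" where
  "wf_rows T \<longleftrightarrow> (\<forall>R\<in>set T. sorted R \<and> R \<noteq> [])"

lemma wf_rows_tab_insert: "wf_rows T \<Longrightarrow> wf_rows (tab_insert x T)"
proof (induction T arbitrary: x)
  case (Cons R T)
  have *: "wf_rows (Q # T') \<longleftrightarrow> sorted Q \<and> Q \<noteq> [] \<and> wf_rows T'" for Q T'
    by (auto simp: wf_rows_def)
  have "wf_rows (tab_insert b T)" for b using Cons by (simp only: *)
  then show ?case using Cons.prems length_bump[of x R]
    by (elim disjE exE) (simp_all add: * sorted_row_ins row_ins_nonempty)
qed (simp add: wf_rows_def)

lemma wf_rows_foldl: "wf_rows T \<Longrightarrow> wf_rows (foldl (\<lambda>T x. tab_insert x T) T D)"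
  by (induction D arbitrary: T) (auto simp: wf_rows_tab_insert)

text \<open>Reverse bumping: behind the inserted letter all letters are at least the bumped
  \<open>b\<close>, while the inserted letter is smaller than \<open>b\<close>; this determines its
  position. If one of the bumps is empty, so is the other, by the lengths.\<close>

lemma row_ins_inj:
  assumes "sorted R" "sorted R'" "length R = length R'" "row_ins x R = row_ins x' R'" "bump x R = bump x' R' \<or> bump x R = [] \<or> bump x' R' = []"
  shows "R = R' \<and> x = x'"
  using assms(1)
proof (rule row_ins_bump_cases[of R x])
  assume 1: "bump x R = []" "row_ins x R = R @ [x]"
  show ?thesis using assms(2)
    by (rule row_ins_bump_cases[of R' x']) (use 1 assms(3,4) in \<open>auto dest: arg_cong[of _ _ length]\<close>)
next
  fix A b C assume 1: "bump x R = [b]" "R = A @ b # C" "\<forall>y\<in>set A. y \<le> x" "x < b" "row_ins x R = A @ x # C"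
  show ?thesis using assms(2)
  proof (rule row_ins_bump_cases[of R' x'])
    assume "row_ins x' R' = R' @ [x']" then show ?thesis using 1 assms(3,4) by (auto dest: arg_cong[of _ _ length])
  next
    fix A' b' C' assume 2: "bump x' R' = [b']" "R' = A' @ b' # C'" "\<forall>y\<in>set A'. y \<le> x'" "x' < b'" "row_ins x' R' = A' @ x' # C'"
    have b: "b = b'" using 1 2 assms(5) by auto
    have e: "A @ x # C = A' @ x' # C'" using 1 2 assms(4) by auto
    have *: False if "A @ x # C = A' @ x' # C'" "length A < length A'" "x' < b" "\<forall>c\<in>set C. b \<le> c" for A A' C C' :: "nat list" and x x'
    proof -
      have "x' \<in> set C" using that(1,2) by (auto simp: append_eq_append_conv2 Cons_eq_append_conv)
      then show False using that(3,4) by auto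
    qed
    have "\<forall>c\<in>set C. b \<le> c" "\<forall>c\<in>set C'. b \<le> c" using 1 2 b assms(1,2) by (auto simp: sorted_append)
    then have "length A = length A'" using *[OF e] *[OF e[symmetric]] 1(4) 2(4) b by (meson linorder_neqE_nat)
    then show ?thesis using e 1 2 b by auto
  qed
qed

text \<open>Row lengths tell whether a letter was bumped out of the first row. If so, the recursion
  recovers this letter from the lower rows, and then the first row can be undone.\<close>

lemma tab_insert_inj:
  assumes "wf_rows T" "wf_rows T'" "map length T = map length T'" "tab_insert x T = tab_insert x' T'"
  shows "T = T' \<and> x = x'"
  using assms
proof (induction T arbitrary: T' x x')
  case Nil
  then show ?case by (cases T') auto
next
  case (Cons R T)
  then obtain R' T'' where T': "T' = R' # T''" by (cases T') auto
  have s: "sorted R" "sorted R'" "length R = length R'" "row_ins x R = row_ins x' R'" "wf_rows T" "wf_rows T''"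
    using Cons.prems T' by (auto simp: wf_rows_def)
  have l: "length (bump x R) = length (bump x' R')"
  proof -
    have "length (row_ins x R) + length (bump x R) = Suc (length R)" for x R
      using mset_row_ins[of x R] by (metis size_mset size_union size_add_mset add_mset_add_single)
    then show ?thesis using s by (metis add_left_cancel)
  qed
  show ?case
  proof (cases "bump x R")
    case Nil
    then have "bump x' R' = []" using l by simp
    then show ?thesis using Nil row_ins_inj[OF s(1-4)] Cons.prems(4) T' by auto
  next
    case c: (Cons b B)
    then obtain b' where b': "bump x' R' = [b']" "bump x R = [b]" using l length_bump[of x' R'] length_bump[of x R] by auto
    then have "tab_insert b T = tab_insert b' T''" using Cons.prems(4) T' by simp
    then have "T = T'' \<and> b = b'" using Cons.IH s Cons.prems(3) T' by simp
    then show ?thesis using b' row_ins_inj[OF s(1-4)] T' by simp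
  qed
qed

fun insertion_row :: "nat \<Rightarrow> tableau \<Rightarrow> nat" where
  "insertion_row x [] = 0"
| "insertion_row x (R # T) = (case bump x R of [] \<Rightarrow> 0 | b # _ \<Rightarrow> Suc (insertion_row b T))"

text \<open>In each row the later, smaller letter bumps a letter that is at most the one just
  inserted, hence smaller than the letter bumped before. Its path therefore goes on for at least one
  row more.\<close>

lemma insertion_row_less: "y < x \<Longrightarrow> insertion_row x T < insertion_row y (tab_insert x T)"
proof (induction T arbitrary: x y)
  case (Cons R T)
  obtain b' where b': "bump y (row_ins x R) = [b']" "b' \<le> x" using bump_row_ins_less[OF Cons.prems] by blast
  consider "bump x R = []" | b where "bump x R = [b]" "x < b"
    using length_bump[of x R] bump_gt[of _ x R] by (metis list.set_intros(1))
  then show ?case by cases (use b' Cons.IH in auto)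
qed simp

definition row_len :: "tableau \<Rightarrow> nat \<Rightarrow> nat" where
  "row_len T i = (if i < length T then length (T ! i) else 0)"

lemma row_len_Cons: "row_len (R # T) i = (case i of 0 \<Rightarrow> length R | Suc j \<Rightarrow> row_len T j)"
  by (auto simp: row_len_def split: nat.splits)

lemma row_len_tab_insert: "row_len (tab_insert x T) i = row_len T i + (if i = insertion_row x T then 1 else 0)"
proof (induction T arbitrary: x i)
  case Nil
  then show ?case by (auto simp: row_len_def)
next
  case (Cons R T)
  have l: "length (row_ins x R) + length (bump x R) = Suc (length R)"
    using mset_row_ins[of x R] by (metis size_mset size_union size_add_mset add_mset_add_single)
  consider "bump x R = []" | b where "bump x R = [b]" using length_bump[of x R] by blast
  then show ?case by cases (use l Cons in \<open>auto simp: row_len_Cons split: nat.splits\<close>)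
qed

lemma map_length_eqI:
  assumes "wf_rows T" "wf_rows T'" "\<And>i. row_len T i = row_len T' i"
  shows "map length T = map length T'"
proof -
  have p: "0 < row_len T i \<longleftrightarrow> i < length T" "0 < row_len T' i \<longleftrightarrow> i < length T'" for i
    using assms(1,2) by (auto simp: row_len_def wf_rows_def)
  then have "i < length T \<longleftrightarrow> i < length T'" for i using assms(3) by metis
  then have l: "length T = length T'" by (metis linorder_neqE_nat nat_less_le)
  show ?thesis
  proof (rule nth_equalityI)
    fix i assume "i < length (map length T)"
    then show "map length T ! i = map length T' ! i" using assms(3)[of i] l by (simp add: row_len_def)
  qed (simp add: l)
qed

abbreviation "tab_inserts T D \<equiv> foldl (\<lambda>T x. tab_insert x T) T D"

lemma row_len_tab_inserts_ge: "row_len T i \<le> row_len (tab_inserts T D) i"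
  by (induction D rule: rev_induct) (auto simp: row_len_tab_insert)

lemma row_len_tab_inserts_above:
  "sorted_wrt (>) (D @ [d]) \<Longrightarrow> insertion_row d (tab_inserts T D) < i \<Longrightarrow> row_len (tab_inserts T (D @ [d])) i = row_len T i"
proof (induction D arbitrary: d rule: rev_induct)
  case Nil
  then show ?case by (simp add: row_len_tab_insert)
next
  case (snoc e D)
  have "insertion_row e (tab_inserts T D) < insertion_row d (tab_inserts T (D @ [e]))" using insertion_row_less[of d e] snoc.prems(1) by (simp add: sorted_wrt_append)
  then have "row_len (tab_inserts T (D @ [e])) i = row_len T i" using snoc by (auto simp: sorted_wrt_append)
  then show ?case using snoc.prems(2) by (simp add: row_len_tab_insert)
qed

lemma tab_inserts_inj:
  assumes "wf_rows T" "wf_rows T'" "map length T = map length T'" "length D = length D'"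
    "sorted_wrt (>) D" "sorted_wrt (>) D'" "tab_inserts T D = tab_inserts T' D'"
  shows "T = T' \<and> D = D'"
  using assms(4-)
proof (induction D arbitrary: D' rule: rev_induct)
  case (snoc d D E')
  then obtain D' d' where E': "E' = D' @ [d']" "length D = length D'" by (cases E' rule: rev_cases) auto
  let ?X = "tab_inserts T D" and ?X' = "tab_inserts T' D'"
  let ?n = "insertion_row d ?X" and ?n' = "insertion_row d' ?X'"
  have r: "row_len T i = row_len T' i" for i using assms(3) by (metis row_len_def length_map nth_map)
  have f: "row_len (tab_inserts T (D @ [d])) i = row_len (tab_inserts T' (D' @ [d'])) i" for i using snoc.prems E' by simp
  \<comment> \<open>If the last cell of the first sequence were higher up, row \<open>?n'\<close>
    would keep its length in the first sequence but grow in the second, although the resulting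
    tableaux coincide.\<close>
  have "\<not> ?n < ?n'"
    using row_len_tab_inserts_above[OF snoc.prems(2), of T ?n'] r[of ?n'] f[of ?n'] row_len_tab_inserts_ge[of T' ?n' D'] row_len_tab_insert[of d' ?X' ?n'] by auto
  moreover have "\<not> ?n' < ?n"
    using row_len_tab_inserts_above[of D' d' T' ?n] snoc.prems(3) E' r[of ?n] f[of ?n] row_len_tab_inserts_ge[of T ?n D] row_len_tab_insert[of d ?X ?n] by auto
  ultimately have n: "?n = ?n'" by simp
  have "row_len ?X i = row_len ?X' i" for i
    using f[of i] n by (simp add: row_len_tab_insert)
  then have "map length ?X = map length ?X'" using map_length_eqI wf_rows_foldl assms(1,2) by blast
  then have X: "?X = ?X' \<and> d = d'" using tab_insert_inj[of ?X ?X' d d'] wf_rows_foldl assms(1,2) snoc.prems(4) E' by auto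
  then have "T = T' \<and> D = D'" using snoc.IH[of D'] snoc.prems E' by (auto simp: sorted_wrt_append)
  then show ?case using X E' by simp
qed simp

lemma wf_rows_column_strict: "column_strict T \<Longrightarrow> wf_rows T"
  by (auto simp: column_strict_def wf_rows_def)

text \<open>
  Reversing a word without repetitions transposes its tableau and turns \<open>R\<close> into a decreasing word.
  Row insertion of the latter can be undone, since each new cell is strictly below the previous one.
\<close>

lemma pieri_unique:
  assumes "R @ row_word U \<approx> R' @ row_word U'" "distinct (R @ row_word U)"
    and "sorted R" "sorted R'" "length R = length R'"
    and "column_strict U" "column_strict U'" "map length U = map length U'"
  shows "R = R' \<and> U = U'"
proof -
  have d': "distinct (R' @ row_word U')" using assms(1,2) knuth_distinct by blast
  obtain V where V: "column_strict V" "rev (row_word U) \<approx> row_word V" "map length V = conj_shape (map length U)"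
    using transpose_ex[OF assms(6)] assms(2) by auto
  obtain V' where V': "column_strict V'" "rev (row_word U') \<approx> row_word V'" "map length V' = conj_shape (map length U')"
    using transpose_ex[OF assms(7)] d' by auto
  have s: "schensted (rev (row_word U)) = V" "schensted (rev (row_word U')) = V'"
    using V V' schensted_unique knuth_sym by metis+
  have "rev (row_word U) @ rev R \<approx> rev (row_word U') @ rev R'"
    using knuth_rev[OF assms(1,2)] by simp
  then have "tab_inserts V (rev R) = tab_inserts V' (rev R')"
    using knuth_imp_schensted_eq schensted_append s by metis
  moreover have "sorted_wrt (>) (rev R)" "sorted_wrt (>) (rev R')"
    using assms(2-4) d' by (simp_all add: sorted_wrt_rev strict_sorted_iff)
  ultimately have "V = V' \<and> rev R = rev R'"
    using V V' assms(5,8) by (intro tab_inserts_inj) (auto simp: wf_rows_column_strict)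
  moreover then have "rev (row_word U) \<approx> rev (row_word U')" using V V' knuth_sym knuth_trans by metis
  then have "row_word U \<approx> row_word U'" using knuth_rev assms(2) by fastforce
  then have "U = U'" using schensted_unique[OF assms(6)] schensted_row_word[OF assms(7)] by metis
  ultimately show ?thesis by simp
qed

section \<open>Words of permutations\<close>

fun word_perm :: "nat list \<Rightarrow> nat \<Rightarrow> nat" where
  "word_perm [] = id"
| "word_perm (r # rs) = transpose r (Suc r) \<circ> word_perm rs"

lemma word_for_iff: "word_for w rs \<longleftrightarrow> 0 \<notin> set rs \<and> w = word_perm rs"
proof -
  have "foldr (\<lambda>r g. transpose r (Suc r) \<circ> g) rs id = word_perm rs"
    by (induction rs) simp_all
  then show ?thesis by (simp only: word_for_def)
qed

lemma word_for_append: "word_for w rs \<Longrightarrow> word_for w' rs' \<Longrightarrow> word_for (w \<circ> w') (rs @ rs')"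
proof -
  have "word_perm (rs @ rs') = word_perm rs \<circ> word_perm rs'"
    by (induction rs) (simp_all add: comp_assoc)
  then show "word_for w rs \<Longrightarrow> word_for w' rs' \<Longrightarrow> word_for (w \<circ> w') (rs @ rs')"
    by (simp add: word_for_iff)
qed

text \<open>Conjugation with an adjacent transposition moves the upper end of a transposition by
  one.\<close>

lemma word_for_transpose: "0 < a \<Longrightarrow> \<exists>rs. word_for (transpose a (a + Suc d)) rs"
proof (induction d)
  case 0
  then show ?case by (intro exI[of _ "[a]"]) (simp add: word_for_iff)
next
  case (Suc d)
  let ?c = "a + Suc d"
  obtain rs where rs: "word_for (transpose a ?c) rs" using Suc by blast
  have c: "word_for (transpose ?c (Suc ?c)) [?c]" by (simp add: word_for_iff)
  have "transpose a (a + Suc (Suc d)) = transpose ?c (Suc ?c) \<circ> (transpose a ?c \<circ> transpose ?c (Suc ?c))"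
    by (auto simp: fun_eq_iff transpose_def)
  then show ?case using word_for_append[OF c word_for_append[OF rs c]] by metis
qed

lemma word_for_ex:
  assumes "w permutes {1..N}"
  shows "\<exists>rs. word_for w rs"
  using assms finite_atLeastAtMost[of 1 N]
proof (induction w rule: permutes_induct)
  case id
  then show ?case by (intro exI[of _ "[]"]) (simp add: word_for_iff id_def)
next
  case (swap a b p)
  note 2 = swap
  have "\<exists>rs. word_for (transpose a b) rs" if "0 < a" "a < b" for a b
    using word_for_transpose[OF that(1), of "b - Suc a"] that by simp
  then have "\<exists>rs. word_for (transpose a b) rs"
    using 2 by (metis atLeastAtMost_iff linorder_neqE_nat transpose_commute not_one_le_zero neq0_conv)
  then show ?case using 2 word_for_append by blast
qed

lemma reduced_word_ex: "w permutes {1..N} \<Longrightarrow> \<exists>rs. reduced_word w rs"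
proof -
  assume "w permutes {1..N}"
  then obtain rs where "word_for w rs" using word_for_ex by blast
  then obtain rs where "word_for w rs" "\<forall>rs'. word_for w rs' \<longrightarrow> length rs \<le> length rs'"
    using ex_has_least_nat[of "word_for w" rs length] by blast
  then show ?thesis unfolding reduced_word_def by blast
qed

lemma foldr_reflect:
  assumes "column_strict T" "0 \<notin> set rs"
  shows "step\<^sup>*\<^sup>* T (foldr reflect rs T) \<and> column_strict (foldr reflect rs T) \<and>
    (\<forall>i. count_list (row_word (foldr reflect rs T)) (word_perm rs i) = count_list (row_word T) i)"
  using assms(2)
proof (induction rs)
  case Nil
  then show ?case using assms by simp
next
  case (Cons r rs)
  let ?T = "foldr reflect rs T"
  have IH: "step\<^sup>*\<^sup>* T ?T" "column_strict ?T" "\<And>i. count_list (row_word ?T) (word_perm rs i) = count_list (row_word T) i"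
    using Cons by auto
  have r: "r > 0" using Cons.prems by auto
  show ?case
    using rtranclp.rtrancl_into_rtrancl[OF IH(1) step.reflect[OF r]] reflect_tableau[OF IH(2) r]
    by (simp add: count_reflect_word IH(3))
qed

lemma elementary_embedding_steps:
  assumes "elementary_embedding \<alpha> \<beta> F" "T \<in> tableaux \<alpha>"
  shows "F T \<in> tableaux \<beta> \<and> step\<^sup>*\<^sup>* T (F T)"
  using assms(1)
proof cases
  case (permute w N)
  have T: "column_strict T" "\<And>i. count_list (row_word T) i = part \<alpha> i" using assms(2) by (auto simp: tableaux_def)
  define rs where "rs = (SOME rs. reduced_word w rs)"
  have "reduced_word w rs" unfolding rs_def using reduced_word_ex[OF permute(2)] by (rule someI_ex)
  then have w: "0 \<notin> set rs" "w = word_perm rs"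
    by (auto simp: reduced_word_def word_for_iff)
  have F: "F T = foldr reflect rs T" using permute by (simp add: perm_act_def rs_def)
  note f = foldr_reflect[OF T(1) w(1), folded w(2)]
  have "count_list (row_word (F T)) j = part \<beta> j" for j
  proof -
    obtain i where "j = w i" using permutes_surj[OF permute(2)] by blast
    then show ?thesis using f T(2) permute(3) F by simp
  qed
  then show ?thesis using f F by (simp add: tableaux_def)
next
  case lowering
  have T: "column_strict T" "\<And>i. count_list (row_word T) i = part \<alpha> i" using assms(2) by (auto simp: tableaux_def)
  have c: "count_list (row_word T) 1 > count_list (row_word T) 2 + 1" using lowering T by simp
  have fl: "flip 1 (row_word T) (row_word (F T))"
    using flip_lower[OF low_pos[OF c]] lower_tableau(3)[OF T(1), of 1] lowering(1) by simp
  have "count_list (row_word (F T)) i = part \<beta> i" for i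
    using flip_count[OF fl] lowering(3) T(2) by (auto simp: numeral_2_eq_2)
  then show ?thesis using lower_tableau(1)[OF T(1), of 1] step.lower[OF c] lowering(1) by (auto simp: tableaux_def)
qed

lemma composite_embedding_steps:
  assumes "composite_embedding \<alpha> \<beta> F" "T \<in> tableaux \<alpha>"
  shows "F T \<in> tableaux \<beta> \<and> step\<^sup>*\<^sup>* T (F T)"
  using assms
proof (induction rule: composite_embedding.induct)
  case (step \<alpha> \<beta> F \<gamma> E)
  then show ?case using elementary_embedding_steps[OF step(2)] by (metis comp_apply rtranclp_trans)
qed simp

lemma composite_embedding_trans:
  assumes "composite_embedding \<beta> \<gamma> E" "composite_embedding \<alpha> \<beta> F"
  shows "\<exists>H. composite_embedding \<alpha> \<gamma> H"
  using assms
  by (induction rule: composite_embedding.induct) (blast intro: composite_embedding.step)+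

section \<open>Existence of embeddings\<close>

definition comp_of :: "(nat \<Rightarrow> nat) \<Rightarrow> nat \<Rightarrow> nat list" where
  "comp_of f N = map f [1..<Suc N]"

lemma part_comp_of: "part (comp_of f N) i = (if 1 \<le> i \<and> i \<le> N then f i else 0)"
  by (auto simp: part_def comp_of_def simp del: upt_Suc)

lemma length_comp_of: "length (comp_of f N) = N"
  by (simp add: comp_of_def del: upt_Suc)

lemma part_0: "i = 0 \<or> length \<alpha> < i \<Longrightarrow> part \<alpha> i = 0"
  by (auto simp: part_def)

lemma sum_parts:
  fixes g :: "nat \<Rightarrow> nat"
  assumes "g 0 = 0" "length \<alpha> \<le> N"
  shows "(\<Sum>i\<in>{1..N}. g (part \<alpha> i)) = sum_list (map g \<alpha>)"
proof -
  have "(\<Sum>i\<in>{1..N}. g (part \<alpha> i)) = (\<Sum>i\<in>{1..length \<alpha>}. g (part \<alpha> i))"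
    using assms by (intro sum.mono_neutral_right) (auto simp: part_def)
  also have "\<dots> = (\<Sum>i\<in>{0..<length \<alpha>}. g (\<alpha> ! i))"
    by (rule sum.reindex_bij_witness[of _ Suc "\<lambda>i. i - 1"]) (auto simp: part_def)
  also have "\<dots> = sum_list (map g \<alpha>)" by (simp add: sum_list_sum_nth)
  finally show ?thesis .
qed

lemma permutes_image_ex:
  assumes "finite S" "A \<subseteq> S" "B \<subseteq> S" "card A = card B"
  shows "\<exists>w. w permutes S \<and> (\<forall>i. w i \<in> B \<longleftrightarrow> i \<in> A)"
proof -
  have fin: "finite A" "finite B" using assms finite_subset by blast+
  have "card (S - A) = card (S - B)" using assms fin by (simp add: card_Diff_subset)
  then obtain g where g: "bij_betw g (S - A) (S - B)"
    using finite_same_card_bij[of "S - A" "S - B"] assms(1) by blast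
  obtain f where f: "bij_betw f A B" using finite_same_card_bij[OF fin assms(4)] by blast
  define w where "w i = (if i \<in> A then f i else if i \<in> S then g i else i)" for i
  have "bij_betw w A B" using f by (rule bij_betw_cong[THEN iffD1, rotated]) (simp add: w_def)
  moreover have "bij_betw w (S - A) (S - B)"
    using g by (rule bij_betw_cong[THEN iffD1, rotated]) (simp add: w_def)
  ultimately have "bij_betw w (A \<union> (S - A)) (B \<union> (S - B))" by (rule bij_betw_combine) auto
  then have "bij_betw w S S" using assms(2,3) by (simp add: Un_absorb1)
  then have "w permutes S" by (rule bij_imp_permutes) (use assms(2) in \<open>auto simp: w_def\<close>)
  moreover have "w i \<in> B \<longleftrightarrow> i \<in> A" for i
    using bij_betwE[OF f] bij_betwE[OF g] assms(3) by (auto simp: w_def)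
  ultimately show ?thesis by blast
qed

lemma sum_parts_permute:
  fixes g :: "nat \<Rightarrow> nat"
  assumes "w permutes {1..N}" "\<And>i. part \<beta> (w i) = part \<alpha> i"
  shows "(\<Sum>i\<in>{1..N}. g (part \<beta> i)) = (\<Sum>i\<in>{1..N}. g (part \<alpha> i))"
  using sum.permute[OF assms(1), of "\<lambda>i. g (part \<beta> i)"] assms(2) by (simp add: comp_def)

text \<open>While some part is at least 2, a unit of it is moved to an empty place, which lowers the
  sum of squares; in the end only a permutation of zeros and ones is left. Targets other than all
  ones serve the smaller tableaux, whose letters do not start at 1.\<close>

lemma composite_embedding_ex:
  assumes "sum_list \<alpha> = sum_list \<beta>" "\<forall>i. part \<beta> i \<le> 1"
  shows "\<exists>F. composite_embedding \<alpha> \<beta> F"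
  using assms(1)
proof (induction "sum_list (map (\<lambda>x. x * x) \<alpha>)" arbitrary: \<alpha> rule: less_induct)
  case less
  show ?case
  proof (cases "\<forall>i. part \<alpha> i \<le> 1")
    case True
    define N where "N = max (length \<alpha>) (length \<beta>)"
    have *: "card {i \<in> {1..N}. part \<gamma> i = 1} = sum_list \<gamma>" if "\<forall>i. part \<gamma> i \<le> 1" "length \<gamma> \<le> N" for \<gamma>
    proof -
      have "sum_list \<gamma> = (\<Sum>i\<in>{1..N}. part \<gamma> i)" using sum_parts[of "\<lambda>x. x" \<gamma> N] that by simp
      also have "\<dots> = (\<Sum>i\<in>{1..N}. if part \<gamma> i = 1 then 1 else 0)"
        using that(1) by (intro sum.cong) (auto simp: le_Suc_eq)
      also have "\<dots> = card {i \<in> {1..N}. part \<gamma> i = 1}" by (simp add: sum.If_cases Int_def)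
      finally show ?thesis ..
    qed
    obtain w where w: "w permutes {1..N}" "\<And>i. w i \<in> {i \<in> {1..N}. part \<beta> i = 1} \<longleftrightarrow> i \<in> {i \<in> {1..N}. part \<alpha> i = 1}"
      using permutes_image_ex[of "{1..N}" "{i \<in> {1..N}. part \<alpha> i = 1}" "{i \<in> {1..N}. part \<beta> i = 1}"]
        *[OF True] *[OF assms(2)] less.prems N_def by fastforce
    have "i \<in> {i \<in> {1..N}. part \<gamma> i = 1} \<longleftrightarrow> part \<gamma> i = 1" if "length \<gamma> \<le> N" for \<gamma> i
      using that by (auto simp: part_def split: if_splits)
    then have "part \<beta> (w i) = 1 \<longleftrightarrow> part \<alpha> i = 1" for i using w(2)[of i] by (auto simp: N_def)
    then have "part \<beta> (w i) = part \<alpha> i" for i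
      using True assms(2) by (metis le_neq_implies_less less_one)
    then show ?thesis using composite_embedding.step[OF composite_embedding.base elementary_embedding.permute[OF w(1)]] by blast
  next
    case False
    then obtain i where i: "part \<alpha> i \<ge> 2" by (auto simp: not_le Suc_le_eq numeral_2_eq_2)
    then have il: "1 \<le> i" "i \<le> length \<alpha>" by (auto simp: part_def split: if_splits)
    \<comment> \<open>This leaves room for the empty place \<open>j\<close> behind the last part and
      for position 2 in every case. The permutation \<open>w\<close> brings the large part
      \<open>i\<close> to position 1 and the empty part \<open>j\<close> to position 2, as the
      lowering rule requires.\<close>
    define N where "N = length \<alpha> + 2"
    define j where "j = length \<alpha> + 1"
    define w where "w = transpose j 2 \<circ> transpose 1 i"
    have w: "w permutes {1..N}" unfolding w_def using il
      by (intro permutes_compose permutes_swap_id) (auto simp: N_def j_def)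
    have wi: "w i = 1" "w j = 2" using il by (auto simp: w_def j_def transpose_def)
    define \<beta>1 where "\<beta>1 = comp_of (\<lambda>k. part \<alpha> (inv w k)) N"
    have p1: "part \<beta>1 (w k) = part \<alpha> k" for k
    proof (cases "k \<in> {1..N}")
      case True
      then have "w k \<in> {1..N}" using permutes_in_image[OF w] by blast
      then show ?thesis using permutes_inverses(2)[OF w] by (auto simp: \<beta>1_def part_comp_of)
    next
      case False
      then have "w k = k" using w by (simp add: permutes_not_in)
      then show ?thesis using False part_0[of k \<alpha>] by (auto simp: \<beta>1_def part_comp_of N_def)
    qed
    have b1: "part \<beta>1 1 \<ge> 2" "part \<beta>1 2 = 0" using p1[of i] p1[of j] wi i by (auto simp: part_0 j_def)
    define \<beta>2 where "\<beta>2 = comp_of (\<lambda>k. if k = 1 then part \<beta>1 1 - 1 else if k = 2 then part \<beta>1 2 + 1 else part \<beta>1 k) N"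
    have len: "length \<beta>1 = N" "length \<beta>2 = N" by (auto simp: \<beta>1_def \<beta>2_def comp_of_def)
    have p2: "part \<beta>2 k = (if k = 1 then part \<beta>1 1 - 1 else if k = 2 then part \<beta>1 2 + 1 else part \<beta>1 k)" for k
      using part_0[of k \<beta>1] len by (auto simp: \<beta>2_def part_comp_of N_def)
    have "composite_embedding \<alpha> \<beta>1 (perm_act w \<circ> id)"
      using composite_embedding.step[OF composite_embedding.base elementary_embedding.permute[OF w p1]] .
    moreover have "elementary_embedding \<beta>1 \<beta>2 (lower 1)"
      using elementary_embedding.lowering[of \<beta>1 \<beta>2] b1 p2 by auto
    ultimately have ce: "composite_embedding \<alpha> \<beta>2 (lower 1 \<circ> (perm_act w \<circ> id))"
      by (rule composite_embedding.step)
    have split: "{1..N} = insert 1 (insert 2 {3..N})" by (auto simp: N_def)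
    have sm: "sum_list (map g \<alpha>) = (\<Sum>k\<in>{1..N}. g (part \<beta>1 k))" "sum_list (map g \<beta>2) = (\<Sum>k\<in>{1..N}. g (part \<beta>2 k))"
      if "g 0 = 0" for g :: "nat \<Rightarrow> nat"
      using sum_parts[of g \<alpha> N] sum_parts[of g \<beta>2 N] sum_parts_permute[OF w p1, of g] len that
      by (auto simp: N_def)
    have rest: "(\<Sum>k\<in>{3..N}. g (part \<beta>2 k)) = (\<Sum>k\<in>{3..N}. g (part \<beta>1 k))" for g :: "nat \<Rightarrow> nat"
      by (intro sum.cong) (auto simp: p2)
    obtain a where a: "part \<beta>1 1 = Suc (Suc a)" using b1(1) by (metis add_2_eq_Suc le_Suc_ex)
    have sp: "(\<Sum>k\<in>{1..N}. h k) = h 1 + (h 2 + (\<Sum>k\<in>{3..N}. h k))" for h :: "nat \<Rightarrow> nat"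
      unfolding split by simp
    have v: "part \<beta>2 1 = Suc a" "part \<beta>2 2 = 1" using p2[of 1] p2[of 2] a b1(2) by simp_all
    have "sum_list \<beta>2 = sum_list \<alpha>"
      using sm[of "\<lambda>x. x"] rest[of "\<lambda>x. x"] unfolding sp a b1(2) v by simp
    moreover have "sum_list (map (\<lambda>x. x * x) \<beta>2) < sum_list (map (\<lambda>x. x * x) \<alpha>)"
      using sm[of "\<lambda>x. x * x"] rest[of "\<lambda>x. x * x"] unfolding sp a b1(2) v by simp
    ultimately obtain F where "composite_embedding \<beta>2 \<beta> F" using less.hyps less.prems by metis
    then show ?thesis using composite_embedding_trans ce by blast
  qed
qed

lemma sum_list_part: "length \<alpha> \<le> N \<Longrightarrow> sum_list \<alpha> = (\<Sum>i\<in>{1..N}. part \<alpha> i)"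
  using sum_parts[of "\<lambda>x. x" \<alpha> N] by simp

lemma steps_to_set_ex:
  assumes "column_strict T" "finite B" "0 \<notin> B" "card B = length (row_word T)"
  shows "\<exists>T'. step\<^sup>*\<^sup>* T T' \<and> (\<forall>i. count_list (row_word T') i = (if i \<in> B then 1 else 0))"
proof -
  define N where "N = Max (insert 0 (B \<union> set (row_word T)))"
  have le: "x \<le> N" if "x \<in> B \<union> set (row_word T)" for x using that assms(2) by (auto simp: N_def)
  define \<alpha> where "\<alpha> = comp_of (count_list (row_word T)) N"
  define \<beta> where "\<beta> = comp_of (\<lambda>i. if i \<in> B then 1 else 0) N"
  have a: "part \<alpha> i = count_list (row_word T) i" for i
    using le[of i] column_strict_pos[OF assms(1)] by (cases "i = 0") (auto simp: \<alpha>_def part_comp_of count_list_0_iff)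
  have b: "part \<beta> i = (if i \<in> B then 1 else 0)" for i
    using le[of i] assms(3) by (cases "i = 0") (auto simp: \<beta>_def part_comp_of)
  have "sum_list \<alpha> = (\<Sum>i\<in>{1..N}. count_list (row_word T) i)"
    using sum_list_part[of \<alpha> N] a length_comp_of[of "count_list (row_word T)" N] by (simp add: \<alpha>_def)
  also have "\<dots> = (\<Sum>i\<in>set (row_word T). count_list (row_word T) i)"
  proof (rule sum.mono_neutral_right)
    show "set (row_word T) \<subseteq> {1..N}" using le column_strict_pos[OF assms(1)]
      by (auto simp: Suc_le_eq intro: gr0I)
  qed (auto simp: count_list_0_iff)
  also have "\<dots> = length (row_word T)" by (simp add: sum_count_set)
  finally have sa: "sum_list \<alpha> = length (row_word T)" .
  have "sum_list \<beta> = (\<Sum>i\<in>{1..N}. if i \<in> B then 1 else 0)"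
    using sum_list_part[of \<beta> N] b length_comp_of[of "\<lambda>i. if i \<in> B then 1 else 0" N] by (simp add: \<beta>_def)
  also have "\<dots> = card ({1..N} \<inter> B)" by (simp add: sum.If_cases)
  also have "{1..N} \<inter> B = B" using le assms(3) by (auto simp: Suc_le_eq intro: gr0I)
  finally have "sum_list \<beta> = card B" .
  moreover have "\<forall>i. part \<beta> i \<le> 1" using b by simp
  ultimately obtain F where "composite_embedding \<alpha> \<beta> F"
    using composite_embedding_ex[of \<alpha> \<beta>] sa assms(4) by auto
  moreover have "T \<in> tableaux \<alpha>" using a assms(1) by (simp add: tableaux_def)
  ultimately have "F T \<in> tableaux \<beta> \<and> step\<^sup>*\<^sup>* T (F T)" by (rule composite_embedding_steps)
  then show ?thesis using b by (intro exI[of _ "F T"]) (simp add: tableaux_def)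
qed

lemma standardization_embedding_composite:
  "composite_embedding \<mu> (replicate (sum_list \<mu>) 1) (standardization_embedding \<mu>)"
proof -
  have "\<exists>F. composite_embedding \<mu> (replicate (sum_list \<mu>) 1) F"
    by (rule composite_embedding_ex) (auto simp: part_def sum_list_replicate)
  then show ?thesis unfolding standardization_embedding_def canonical_embedding_def by (rule someI_ex)
qed

section \<open>Transport of a factorization\<close>

lemma similar_Cons:
  assumes "similar (R # L) L'"
  shows "\<exists>R' L''. L' = R' # L'' \<and> length R' = length R \<and> sorted R' \<and> similar L L''"
proof -
  obtain R' L'' where L': "L' = R' # L''" using similar_length[OF assms] by (cases L') auto
  have "below k (L ! i) (L ! Suc i) \<longleftrightarrow> below k (L'' ! i) (L'' ! Suc i)" if "Suc i < length L" for i k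
    using assms that L' unfolding similar_def by (metis Suc_less_eq length_Cons nth_Cons_Suc)
  then show ?thesis using assms L' by (auto simp: similar_def)
qed

text \<open>A product of a row and a tableau. \<open>R\<close> need not fit above \<open>U\<close>;
  only the word with the row in front is prescribed, up to Knuth equivalence.\<close>

definition factors :: "nat list \<Rightarrow> tableau \<Rightarrow> nat list \<Rightarrow> bool" where
  "factors R U w \<longleftrightarrow> sorted R \<and> 0 \<notin> set R \<and> column_strict U \<and> R @ row_word U \<approx> w"

lemma factors_array:
  assumes "sorted R" "column_strict U" "similar (R # rev U) L" "0 \<notin> set (concat L)"
  shows "\<exists>R' U'. L = R' # rev U' \<and> length R' = length R \<and> map length U' = map length U \<and> factors R' U' (concat L)"
proof -
  obtain R' L' where L: "L = R' # L'" "length R' = length R" "sorted R'" "similar (rev U) L'"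
    using similar_Cons[OF assms(3)] by blast
  have "0 \<notin> set R'" "0 \<notin> set (concat L')" using assms(4) L(1) by auto
  then show ?thesis
    using L column_strict_similar[OF assms(2) L(4)]
    by (intro exI[of _ R'] exI[of _ "rev L'"]) (auto simp: factors_def row_word_rev)
qed

lemma concat_eq_array:
  fixes L L' :: "nat list list"
  shows "map length L = map length L' \<Longrightarrow> concat L = concat L' \<Longrightarrow> L = L'"
  by (metis cut_concat)

text \<open>The last conjunct is an equality of words, not just an equivalence, because
  \<open>pull_step\<close> rotates the very word that is filled here.\<close>

lemma factors_fill:
  assumes "factors R U w" "t \<le> low r w + high r w" "r > 0"
  shows "\<exists>R' U'. length R' = length R \<and> map length U' = map length U \<and> factors R' U' (fill r t w) \<and>
    fill r t (R @ row_word U) = R' @ row_word U'"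
proof -
  have f: "sorted R" "0 \<notin> set R" "column_strict U" "R @ row_word U \<approx> w" using assms(1) by (auto simp: factors_def)
  have N: "t \<le> low r (R @ row_word U) + high r (R @ row_word U)" using knuth_stats[OF f(4), of r] assms(2) by presburger
  have c: "concat (R # rev U) = R @ row_word U" by (simp add: row_word_def)
  obtain L where L: "fill r t (R @ row_word U) = concat L" "similar (R # rev U) L"
    using similar_fill[of "R # rev U" t r] N f(1) column_strict_sorted[OF f(3)] unfolding c by auto
  have "0 \<notin> set (concat L)"
    using set_fill[of r t "R @ row_word U"] f(2) column_strict_pos[OF f(3)] assms(3) L(1) by auto
  then obtain R' U' where R': "L = R' # rev U'" "length R' = length R" "map length U' = map length U" "factors R' U' (concat L)"
    using factors_array[OF f(1,3) L(2)] by blast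
  have "concat L = R' @ row_word U'" using R'(1) by (simp add: row_word_def)
  moreover have "fill r t (R @ row_word U) \<approx> fill r t w" using fill_knuth[OF f(4) N] .
  ultimately show ?thesis using R' L(1) by (metis factors_def knuth_trans)
qed

lemma push_step:
  assumes "step X X'" "column_strict X" "factors R U (row_word X)"
  shows "\<exists>R' U'. length R' = length R \<and> map length U' = map length U \<and> factors R' U' (row_word X')"
  using assms(1)
proof cases
  case (reflect r)
  then show ?thesis using factors_fill[OF assms(3), of "high r (row_word X)" r] reflect_tableau(3)[OF assms(2), of r]
    by (auto simp: reflect_word_eq)
next
  case lower
  have t: "low 1 (row_word X) - 1 \<le> low 1 (row_word X) + high 1 (row_word X)" by simp
  have "row_word X' = fill 1 (low 1 (row_word X) - 1) (row_word X)"
    using lower(1) lower_tableau(3)[OF assms(2), of 1] by (simp add: lower_word_eq)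
  then show ?thesis using factors_fill[OF assms(3) t] by (metis zero_less_one)
qed

lemma push_steps:
  assumes "step\<^sup>*\<^sup>* X X'" "column_strict X" "factors R U (row_word X)"
  shows "\<exists>R' U'. length R' = length R \<and> map length U' = map length U \<and> factors R' U' (row_word X')"
  using assms(1)
proof induction
  case base
  then show ?case using assms by blast
next
  case (step Y Z)
  then obtain R' U' where "length R' = length R" "map length U' = map length U" "factors R' U' (row_word Y)" by blast
  moreover have "column_strict Y" using steps_cat_sim[OF step(1) assms(2)] by simp
  ultimately show ?case using push_step[OF step(2)] by metis
qed

lemma below_first_row:
  assumes "similar (rev U @ [R]) (rev U' @ [R'])" "map length U' = map length U"
  shows "below k (first_row U) R \<longleftrightarrow> below k (first_row U') R'"
proof (cases U)
  case Nil
  then show ?thesis using assms(2) by (simp add: first_row_def below_def)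
next
  case (Cons H T)
  then obtain H' T' where U': "U' = H' # T'" "length T' = length T" using assms(2)
    by (cases U') (auto dest: map_eq_imp_length_eq)
  have "below k ((rev U @ [R]) ! length T) ((rev U @ [R]) ! Suc (length T)) \<longleftrightarrow>
    below k ((rev U' @ [R']) ! length T) ((rev U' @ [R']) ! Suc (length T))"
    using assms(1) Cons unfolding similar_def by (metis length_Cons length_append_singleton length_rev lessI)
  then show ?thesis using Cons U' by (simp add: first_row_def nth_append)
qed

text \<open>
  Rotating the array carries the offset inequality through reflections. The inverse of \<open>f\<^sub>1\<close> can
  only break it at the letters 1 of the first row of \<open>U\<close>, and there are at most \<open>k\<close> of these.
\<close>

lemma pull_step:
  assumes "step X X'" "column_strict X" "factors R' U' (row_word X')" "below k (first_row U') R'"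
    and "\<forall>i. count_list (row_word X) i \<le> k"
  shows "\<exists>R U. length R = length R' \<and> map length U = map length U' \<and> factors R U (row_word X) \<and> below k (first_row U) R"
  using assms(1)
proof cases
  case (reflect r)
  let ?w = "row_word X'"
  have w: "reflect_word r ?w = row_word X" using reflect reflect_tableau(3)[OF assms(2), of r] by simp
  obtain R U where RU: "length R = length R'" "map length U = map length U'" "factors R U (fill r (high r ?w) ?w)"
      "fill r (high r ?w) (R' @ row_word U') = R @ row_word U"
    using factors_fill[OF assms(3), of "high r ?w" r] reflect(2) by auto
  have f: "sorted R'" "column_strict U'" "R' @ row_word U' \<approx> ?w" using assms(3) by (auto simp: factors_def)
  have "high r (R' @ row_word U') = high r ?w" using knuth_stats[OF f(3)] by blast
  then have "reflect_word r (R' @ row_word U') = R @ row_word U" using RU(4) by (simp only: reflect_word_eq)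
  then have sw: "reflect_word r (row_word U' @ R') = row_word U @ R" using reflect_word_swap RU(1) by blast
  have c: "concat (rev V @ [Q]) = row_word V @ Q" for V Q by (simp add: row_word_def)
  obtain L where L: "reflect_word r (row_word U' @ R') = concat L" "similar (rev U' @ [R']) L"
    using similar_fill[of "rev U' @ [R']" "high r (row_word U' @ R')" r] f(1) column_strict_sorted[OF f(2)]
    unfolding c reflect_word_eq by auto
  have "L = rev U @ [R]"
  proof (rule concat_eq_array)
    show "map length L = map length (rev U @ [R])" using L(2) RU by (simp add: similar_def rev_map[symmetric])
    show "concat L = concat (rev U @ [R])" using L(1) sw c by simp
  qed
  then have "below k (first_row U) R" using below_first_row[of U' R' U R k] L(2) RU(2) assms(4) by simp
  then show ?thesis using RU w by (auto simp: reflect_word_eq)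
next
  case lower
  have f: "sorted R'" "0 \<notin> set R'" "column_strict U'" "R' @ row_word U' \<approx> row_word X'" using assms(3) by (auto simp: factors_def)
  have "flip 1 (row_word X) (row_word X')"
    using flip_lower[OF low_pos[OF lower(2)]] lower_tableau(3)[OF assms(2), of 1] lower(1) by simp
  then obtain v where v: "flip 1 v (R' @ row_word U')" "row_word X \<approx> v"
    using flip_knuth'[OF knuth_sym[OF f(4)]] by blast
  have c: "concat (R' # rev U') = R' @ row_word U'" by (simp add: row_word_def)
  obtain L where L: "v = concat L" "similar (R' # rev U') L"
     and rel: "list_all2 (\<lambda>R R'. R = R' \<or> (\<exists>R1 R2. R = R1 @ 1 # R2 \<and> R' = R1 @ Suc 1 # R2)) L (R' # rev U')"
    using similar_flip_ex'[of "R' # rev U'" 1 v] v(1) f(1) column_strict_sorted[OF f(3)] unfolding c by auto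
  have v0: "0 \<notin> set (concat L)" using knuth_set[OF v(2)] column_strict_pos[OF assms(2)] L(1) by simp
  then obtain R U where RU: "L = R # rev U" "length R = length R'" "map length U = map length U'" "factors R U (concat L)"
    using factors_array[OF f(1,3) L(2)] by blast
  have "R @ row_word U \<approx> row_word X" using RU(4) L(1) knuth_trans[OF _ knuth_sym[OF v(2)]] unfolding factors_def by blast
  then have "factors R U (row_word X)" using RU(4) unfolding factors_def by blast
  have rel: "R = R' \<or> (\<exists>R1 R2. R = R1 @ 1 # R2 \<and> R' = R1 @ Suc 1 # R2)"
    "list_all2 (\<lambda>R R'. R = R' \<or> (\<exists>R1 R2. R = R1 @ 1 # R2 \<and> R' = R1 @ Suc 1 # R2)) (rev U) (rev U')"
    using rel unfolding RU(1) list_all2_Cons by blast+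
  have "below k (first_row U) R"
    unfolding below_def
  proof
    fix x
    have R: "num_less x R' \<le> num_less x R"
      using rel(1) by (elim disjE exE conjE) simp_all
    have old: "num_le x (first_row U') \<le> k + num_less x R'"
      using assms(4) by (simp add: below_def)
    show "num_le x (first_row U) \<le> k + num_less x R"
    proof (cases "x \<le> 1")
      case True
      have z: "0 \<notin> set (first_row U)" using v0 RU(1) by (cases U) (auto simp: first_row_def)
      have "num_le x W \<le> count_list W 1" if "0 \<notin> set W" for W
        using that True by (induction W) auto
      then have "num_le x (first_row U) \<le> count_list (first_row U) 1" using z by blast
      also have "\<dots> \<le> count_list (concat L) 1"
        using RU(1) by (cases U) (auto simp: first_row_def)
      also have "\<dots> \<le> k" using knuth_count[OF v(2), of 1] L(1) assms(5) by metis
      finally show ?thesis by simp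
    next
      case False
      have "list_all2 (\<lambda>R R'. R = R' \<or> (\<exists>R1 R2. R = R1 @ 1 # R2 \<and> R' = R1 @ Suc 1 # R2)) U U'"
        using rel(2) by (simp only: list_all2_rev)
      then have "first_row U = first_row U' \<or> (\<exists>R1 R2. first_row U = R1 @ 1 # R2 \<and> first_row U' = R1 @ Suc 1 # R2)"
        by (cases U; cases U') (simp_all add: first_row_def)
      then have "num_le x (first_row U) = num_le x (first_row U')"
        using False by (elim disjE exE conjE) simp_all
      then show ?thesis using R old by simp
    qed
  qed
  then show ?thesis using RU \<open>factors R U (row_word X)\<close> by blast
qed

text \<open>Reflections permute the multiplicities. Lowering raises only that of 2, and by its guard
  the new value stays below the old multiplicity of 1. So the bound \<open>k\<close> is available at
  every intermediate content.\<close>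

lemma step_count_le:
  assumes "step X X'" "column_strict X" "\<forall>i. count_list (row_word X) i \<le> k"
  shows "\<forall>i. count_list (row_word X') i \<le> k"
  using assms(1)
proof cases
  case (reflect r)
  then have "row_word X' = reflect_word r (row_word X)" using reflect_tableau(3)[OF assms(2), of r] by simp
  then show ?thesis using count_reflect_word[of r "row_word X"] assms(3) by (metis transpose_involutory)
next
  case lower
  have fl: "flip 1 (row_word X) (row_word X')"
    using flip_lower[OF low_pos[OF lower(2)]] lower_tableau(3)[OF assms(2), of 1] lower(1) by simp
  show ?thesis
  proof
    fix i show "count_list (row_word X') i \<le> k"
      using flip_count[OF fl] assms(3)[rule_format, of i] assms(3)[rule_format, of 1] lower(2)
      by (cases "i = 1 \<or> i = 2") (auto simp: numeral_2_eq_2)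
  qed
qed

lemma pull_steps:
  assumes "step\<^sup>*\<^sup>* X X'" "column_strict X" "factors R' U' (row_word X')" "below k (first_row U') R'"
    and "\<forall>i. count_list (row_word X) i \<le> k"
  shows "\<exists>R U. length R = length R' \<and> map length U = map length U' \<and> factors R U (row_word X) \<and> below k (first_row U) R"
  using assms(1,3,4)
proof (induction arbitrary: R' U')
  case base
  then show ?case by blast
next
  case (step Y Z)
  have Y: "column_strict Y" using steps_cat_sim[OF step(1) assms(2)] by simp
  have "\<forall>i. count_list (row_word Y) i \<le> k" using step(1)
  proof induction
    case base show ?case by (fact assms(5))
  next
    case (step Y Z)
    then show ?case using step_count_le steps_cat_sim[OF step(1) assms(2)] by blast
  qed
  then obtain R U where "length R = length R'" "map length U = map length U'" "factors R U (row_word Y)" "below k (first_row U) R"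
    using pull_step[OF step(2) Y step.prems] by blast
  then show ?case using step.IH by metis
qed

section \<open>Standard tableaux on an interval of letters\<close>

text \<open>
  Working with the letters \<open>m + 1, \<dots>, n\<close> avoids relabelling after the smallest letters are removed.
\<close>

definition std_on :: "nat \<Rightarrow> nat \<Rightarrow> tableau \<Rightarrow> bool" where
  "std_on m n S \<longleftrightarrow> column_strict S \<and> (\<forall>i. count_list (row_word S) i = (if m < i \<and> i \<le> n then 1 else 0))"

lemma std_on_set: "std_on m n S \<Longrightarrow> set (row_word S) = {m<..n}"
proof -
  assume s: "std_on m n S"
  have "x \<in> set (row_word S) \<longleftrightarrow> m < x \<and> x \<le> n" for x
    using s count_list_0_iff[of "row_word S" x] by (simp add: std_on_def split: if_splits)
  then show "set (row_word S) = {m<..n}" by (intro set_eqI) simp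
qed

lemma std_on_distinct: "std_on m n S \<Longrightarrow> distinct (row_word S)"
proof -
  assume s: "std_on m n S"
  have "\<forall>i. count_list w i \<le> 1 \<Longrightarrow> distinct w" for w :: "nat list"
  proof (induction w)
    case (Cons x w)
    have "count_list w x = 0" using Cons.prems[rule_format, of x] by simp
    moreover have "count_list w i \<le> 1" for i using Cons.prems[rule_format, of i] by (simp split: if_splits)
    ultimately show ?case using Cons.IH by (simp add: count_list_0_iff)
  qed simp
  then show "distinct (row_word S)" using s by (simp add: std_on_def)
qed

lemma std_on_length: "std_on m n S \<Longrightarrow> length (row_word S) = n - m"
  using std_on_set[of m n S] std_on_distinct[of m n S] distinct_card by fastforce

lemma std_onI: "column_strict S \<Longrightarrow> set (row_word S) = {m<..n} \<Longrightarrow> distinct (row_word S) \<Longrightarrow> std_on m n S"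
proof -
  assume a: "column_strict S" "set (row_word S) = {m<..n}" "distinct (row_word S)"
  have "distinct w \<Longrightarrow> count_list w i = (if i \<in> set w then 1 else 0)" for w :: "nat list" and i
    by (induction w) auto
  then show "std_on m n S" using a by (simp add: std_on_def)
qed

lemma std_on_Cat: "std_on m n S \<Longrightarrow> std_on m n (Cat S)"
  by (simp add: std_on_def column_strict_Cat count_Cat)

lemma std_on_Cat_funpow: "std_on m n S \<Longrightarrow> std_on m n ((Cat ^^ i) S)"
  by (induction i) (auto simp: std_on_Cat)

lemma sorted_split: "sorted (F::nat list) \<Longrightarrow> F = filter (\<lambda>x. x \<le> t) F @ filter (\<lambda>x. \<not> x \<le> t) F"
proof (induction F)
  case (Cons a F)
  show ?case
  proof (cases "a \<le> t")
    case False
    then have "filter (\<lambda>x. x \<le> t) F = []" "filter (\<lambda>x. \<not> x \<le> t) F = F"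
      using Cons.prems by (auto simp: filter_empty_conv intro!: filter_True)
    then show ?thesis using False by simp
  qed (use Cons in simp)
qed simp

lemma std_on_min:
  assumes "std_on m n S" "m < n"
  shows "Suc m \<in> set (first_row S)"
proof -
  have s: "Suc m \<in> set (row_word S)" using std_on_set[OF assms(1)] assms(2) by auto
  then obtain R U where S: "S = R # U" by (cases S) auto
  have R: "R \<noteq> []" "column_strict S" using assms(1) S by (auto simp: std_on_def column_strict_Cons)
  have "hd R > m" using std_on_set[OF assms(1)] R S by (auto simp: row_word_Cons)
  then have "Suc m \<notin> set (row_word U)" using tl_gt_hd[of R U "Suc m"] R S by auto
  then show ?thesis using s S by (auto simp: row_word_Cons first_row_def)
qed

lemma small_upt: "0 < k \<Longrightarrow> \<forall>x\<in>set w. m + k < x \<Longrightarrow> prependable [Suc m..<Suc (m + k)] w"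
  by (auto simp: prependable_def simp del: upt_Suc)

text \<open>Catabolism leaves an initial run of the first row in place; what it rearranges is the
  rest, which is standard on the remaining interval of letters.\<close>

lemma std_on_decomp:
  assumes "std_on m n S" "0 < k" "{m<..m + k} \<subseteq> set (first_row S)"
  obtains R U X where "S = ([Suc m..<Suc (m + k)] @ R) # U" "X = schensted (R @ row_word U)"
    "std_on (m + k) n X" "Cat S = prepend [Suc m..<Suc (m + k)] X" "factors R U (row_word X)"
proof -
  let ?a = "[Suc m..<Suc (m + k)]"
  have cs: "column_strict S" using assms by (simp add: std_on_def)
  obtain F U where S: "S = F # U" using assms(2,3) by (cases S) (auto simp: first_row_def)
  have F: "sorted F" "distinct F" "set F \<subseteq> {m<..n}" "{m<..m + k} \<subseteq> set F"
    using cs S std_on_distinct[OF assms(1)] std_on_set[OF assms(1)] assms(3)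
    by (auto simp: column_strict_Cons row_word_Cons first_row_def)
  define R where "R = filter (\<lambda>x. \<not> x \<le> m + k) F"
  have "filter (\<lambda>x. x \<le> m + k) F = ?a"
  proof (rule sorted_distinct_set_unique)
    show "set (filter (\<lambda>x. x \<le> m + k) F) = set ?a" using F by (auto simp del: upt_Suc)
  qed (use F in \<open>auto simp: sorted_wrt_filter simp del: upt_Suc\<close>)
  then have FR: "F = ?a @ R" using sorted_split[OF F(1), of "m + k"] by (simp add: R_def)
  have d: "distinct (R @ row_word U)" "set (R @ row_word U) = {m + k<..n}"
  proof -
    have "distinct (row_word U @ ?a @ R)" "set (row_word U @ ?a @ R) = {m<..n}"
      using std_on_distinct[OF assms(1)] std_on_set[OF assms(1)] S FR by (auto simp: row_word_Cons simp del: upt_Suc)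
    note w = this
    have "set ?a = {m<..m + k}" by (auto simp del: upt_Suc)
    moreover have "set (R @ row_word U) = {m<..n} - set ?a"
      using w unfolding distinct_append set_append by blast
    ultimately show "set (R @ row_word U) = {m + k<..n}" by auto
    show "distinct (R @ row_word U)" using w(1) unfolding distinct_append set_append by blast
  qed
  define X where "X = schensted (R @ row_word U)"
  have X: "row_word X \<approx> R @ row_word U" by (simp add: X_def knuth_schensted)
  have cX: "column_strict X" unfolding X_def using d by (intro column_strict_schensted) auto
  have "std_on (m + k) n X"
    using cX d knuth_set[OF X] knuth_distinct[OF X] by (intro std_onI) auto
  moreover have "Cat S = prepend ?a X"
    using Cat_Cons[of ?a R U] cs S FR small_upt[OF assms(2), of "R @ row_word U" m] d(2) X_def by simp
  moreover have "factors R U (row_word X)"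
    using F FR cs S X by (auto simp: factors_def column_strict_Cons sorted_append knuth_sym simp del: upt_Suc)
  ultimately show ?thesis using that S FR X_def by blast
qed

lemma first_row_prepend: "first_row (prepend a X) = a @ first_row X"
  by (simp add: prepend_def first_row_def)

text \<open>Each catabolism lengthens the run by at least one: the next letter is the smallest of
  the tableau behind the run, hence in its first row.\<close>

lemma std_on_run: "std_on m n S \<Longrightarrow> j < n - m \<Longrightarrow> {m<..m + Suc j} \<subseteq> set (first_row ((Cat ^^ j) S))"
proof (induction j)
  case 0
  moreover have "{m<..m + Suc 0} = {Suc m}" by auto
  ultimately show ?case using std_on_min by simp
next
  case (Suc j)
  let ?Z = "(Cat ^^ j) S"
  have Z: "std_on m n ?Z" using Suc std_on_Cat_funpow by blast
  have "0 < Suc j" "{m<..m + Suc j} \<subseteq> set (first_row ?Z)" using Suc by auto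
  then obtain X where X: "std_on (m + Suc j) n X" "Cat ?Z = prepend [Suc m..<Suc (m + Suc j)] X"
    using std_on_decomp[OF Z] by blast
  have "Suc (m + Suc j) \<in> set (first_row X)" using std_on_min[OF X(1)] Suc.prems(2) by simp
  then have "{m<..m + Suc (Suc j)} \<subseteq> set (first_row (Cat ?Z))"
    unfolding X(2) first_row_prepend by (auto simp: le_Suc_eq simp del: upt_Suc)
  then show ?case by simp
qed

lemma std_on_one_row:
  assumes "std_on m n S" "{m<..n} \<subseteq> set (first_row S)"
  shows "S = (if m < n then [[Suc m..<Suc n]] else [])"
proof (cases "m < n")
  case False
  then show ?thesis using std_on_set[OF assms(1)] row_word_eq_Nil[of S] assms(1) by (auto simp: std_on_def)
next
  case True
  then obtain R U where S: "S = R # U" using assms(2) by (cases S) (auto simp: first_row_def)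
  have d: "distinct (row_word U @ R)" "set (row_word U @ R) = {m<..n}" "column_strict S"
    using assms S std_on_distinct[OF assms(1)] std_on_set[OF assms(1)] by (auto simp: row_word_Cons std_on_def)
  then have "row_word U = []" using assms(2) S by (auto simp: first_row_def) (metis IntI UnCI empty_iff list.set_intros(1) neq_Nil_conv subsetD)
  then have U: "U = []" using row_word_eq_Nil[of U] d S by (simp add: column_strict_Cons)
  have "R = [Suc m..<Suc n]"
  proof (rule sorted_distinct_set_unique)
    show "set R = set [Suc m..<Suc n]" using d(2) U by (simp add: atLeastSucLessThan_greaterThanLessThan atLeastLessThanSuc_atLeastAtMost atLeastSucAtMost_greaterThanAtMost del: upt_Suc)
    show "sorted R" using d(3) S by (simp add: column_strict_Cons)
    show "distinct R" using d(1) by simp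
  qed (simp_all del: upt_Suc)
  then show ?thesis using S U True by simp
qed

lemma Cat_inj:
  assumes "std_on m n S" "std_on m n S'" "map length S = map length S'" "Cat S = Cat S'"
  shows "S = S'"
proof -
  have cs: "column_strict S" "column_strict S'" using assms by (auto simp: std_on_def)
  have "first_row S @ row_word (tl S) \<approx> first_row S' @ row_word (tl S')"
    using row_word_Cat[OF cs(1)] row_word_Cat[OF cs(2)] assms(4) knuth_sym knuth_trans by metis
  moreover have "distinct (first_row S @ row_word (tl S))"
    using std_on_distinct[OF assms(1)] row_word_first_row[of S] by auto
  moreover have "length (first_row S) = length (first_row S')" "map length (tl S) = map length (tl S')"
    using assms(3) by (simp_all add: length_first_row map_tl)
  ultimately have "first_row S = first_row S' \<and> tl S = tl S'"
    using cs by (intro pieri_unique) (auto simp: sorted_first_row column_strict_tl)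
  then show ?thesis using assms(3) by (cases S; cases S') (auto simp: first_row_def)
qed

lemma std_on_cat_sim_eq:
  assumes "std_on m n S" "std_on m n S'" "cat_sim S S'"
  shows "S = S'"
proof -
  \<comment> \<open>After so many catabolisms both tableaux are the same single row. From there the
    shapes allow one catabolism at a time to be undone.\<close>
  define N where "N = n - m - 1"
  have "{m<..n} \<subseteq> set (first_row ((Cat ^^ N) V))" if "std_on m n V" for V
  proof (cases "m < n")
    case True
    then show ?thesis using std_on_run[OF that, of N] by (simp add: N_def)
  qed simp
  then have "{m<..n} \<subseteq> set (first_row ((Cat ^^ N) S))" "{m<..n} \<subseteq> set (first_row ((Cat ^^ N) S'))"
    using assms(1,2) by blast+
  then have "(Cat ^^ N) S = (Cat ^^ N) S'"
    using std_on_one_row std_on_Cat_funpow assms(1,2) by metis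
  then have "(Cat ^^ (N - i)) S = (Cat ^^ (N - i)) S'" for i
  proof (induction i)
    case (Suc i)
    show ?case
    proof (cases "N - i")
      case 0
      then show ?thesis using Suc by simp
    next
      case (Suc j)
      then have j: "N - Suc i = j" by simp
      have "Cat ((Cat ^^ j) S) = Cat ((Cat ^^ j) S')" using Suc.IH Suc.prems Suc by simp
      then show ?thesis using Cat_inj[OF std_on_Cat_funpow[OF assms(1), of j] std_on_Cat_funpow[OF assms(2), of j]] assms(3)
        unfolding j by (simp add: cat_sim_def)
    qed
  qed simp
  from this[of N] show ?thesis by simp
qed

section \<open>The two inclusions\<close>

lemma row_word_prepend:
  assumes "prependable a (row_word X)" "column_strict X"
  shows "row_word (prepend a X) \<approx> a @ row_word X"
  using knuth_schensted[of "a @ row_word X"] schensted_prepend[of a "row_word X"] schensted_row_word[OF assms(2)] assms(1)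
  by (simp add: prependable_def)

lemma set_interval: "set [Suc m..<Suc (m + k)] = {m<..m + k}"
  by (auto simp del: upt_Suc)

lemma std_on_small: "std_on (m + k) n X \<Longrightarrow> 0 < k \<Longrightarrow> prependable [Suc m..<Suc (m + k)] (row_word X)"
  using std_on_set[of "m + k" n X] by (intro small_upt) auto

lemma std_on_prepend:
  assumes "std_on (m + k) n X" "0 < k" "m + k \<le> n"
  shows "std_on m n (prepend [Suc m..<Suc (m + k)] X)"
proof -
  let ?a = "[Suc m..<Suc (m + k)]"
  have X: "column_strict X" using assms by (simp add: std_on_def)
  note sm = std_on_small[OF assms(1,2)]
  note rw = row_word_prepend[OF sm X]
  show ?thesis
  proof (rule std_onI)
    show "column_strict (prepend ?a X)" by (rule column_strict_prepend[OF sm X])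
    show "set (row_word (prepend ?a X)) = {m<..n}"
      using knuth_set[OF rw] std_on_set[OF assms(1)] assms(3) unfolding set_append set_interval by auto
    have "distinct (?a @ row_word X)"
      using std_on_distinct[OF assms(1)] std_on_set[OF assms(1)] unfolding distinct_append set_interval by auto
    then show "distinct (row_word (prepend ?a X))" using knuth_distinct[OF rw] by blast
  qed
qed

text \<open>The dominance condition on the catabolism type in terms of first rows. Unlike
  \<open>cattype\<close> it is compatible with removing the first part of the partition, at the
  price of the shift \<open>m\<close>.\<close>

definition runs :: "nat \<Rightarrow> nat list \<Rightarrow> tableau \<Rightarrow> bool" where
  "runs m \<mu> S \<longleftrightarrow> (\<forall>i. {m<..m + sum_list (take (Suc i) \<mu>)} \<subseteq> set (first_row ((Cat ^^ i) S)))"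

lemma runs_Cons:
  assumes "Cat S = prepend [Suc m..<Suc (m + k)] X" "std_on (m + k) n X" "0 < k"
  shows "runs m (k # \<mu>) S \<longleftrightarrow> {m<..m + k} \<subseteq> set (first_row S) \<and> runs (m + k) \<mu> X"
proof -
  have X: "column_strict X" using assms by (simp add: std_on_def)
  let ?P = "\<lambda>i. {m<..m + sum_list (take (Suc i) (k # \<mu>))} \<subseteq> set (first_row ((Cat ^^ i) S))"
  have 0: "?P 0 \<longleftrightarrow> {m<..m + k} \<subseteq> set (first_row S)" by simp
  have S: "?P (Suc i) \<longleftrightarrow> {m + k<..m + k + sum_list (take (Suc i) \<mu>)} \<subseteq> set (first_row ((Cat ^^ i) X))" for i
  proof -
    have "(Cat ^^ Suc i) S = prepend [Suc m..<Suc (m + k)] ((Cat ^^ i) X)"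
      using Cat_funpow_prepend[OF std_on_small[OF assms(2,3)] X] assms(1) by (simp only: funpow_Suc_right comp_apply)
    then have f: "set (first_row ((Cat ^^ Suc i) S)) = {m<..m + k} \<union> set (first_row ((Cat ^^ i) X))"
      by (simp only: first_row_prepend set_append set_interval)
    have "{m<..m + (k + s)} \<subseteq> {m<..m + k} \<union> B \<longleftrightarrow> {m + k<..m + k + s} \<subseteq> B" for s B
    proof -
      have "{m<..m + (k + s)} = {m<..m + k} \<union> {m + k<..m + k + s}" "{m<..m + k} \<inter> {m + k<..m + k + s} = {}" by auto
      then show ?thesis by blast
    qed
    then show ?thesis unfolding f by simp
  qed
  have "(\<forall>i. ?P i) \<longleftrightarrow> ?P 0 \<and> (\<forall>i. ?P (Suc i))" by (metis nat.exhaust)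
  then show ?thesis unfolding runs_def 0 S .
qed

text \<open>Content shifted to the letters from \<open>l + 1\<close> on. For \<open>i\<close> up to
  \<open>l\<close> the truncated subtraction gives \<open>part \<mu> 0 = 0\<close>, so smaller
  letters do not occur.\<close>

definition content :: "nat \<Rightarrow> nat list \<Rightarrow> tableau \<Rightarrow> bool" where
  "content l \<mu> T \<longleftrightarrow> column_strict T \<and> (\<forall>i. count_list (row_word T) i = part \<mu> (i - l))"

lemma part_Cons: "part (k # \<mu>) i = (if i = 1 then k else part \<mu> (i - 1))"
  by (cases i; cases "i - 1") (auto simp: part_def)

lemma content_decomp:
  assumes "content l (k # \<mu>) T" "0 < k"
  obtains R U X where "T = (replicate k (Suc l) @ R) # U" "content (Suc l) \<mu> X"
    "Cat T = prepend (replicate k (Suc l)) X" "factors R U (row_word X)"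
proof -
  let ?a = "replicate k (Suc l)"
  have cs: "column_strict T" and c: "\<And>i. count_list (row_word T) i = part (k # \<mu>) (i - l)"
    using assms by (auto simp: content_def)
  have ge: "Suc l \<le> x" if "x \<in> set (row_word T)" for x
  proof (rule ccontr)
    assume "\<not> ?thesis"
    then have "count_list (row_word T) x = 0" using c[of x] by (simp add: part_def)
    then show False using that by (simp add: count_list_0_iff)
  qed
  have ck: "count_list (row_word T) (Suc l) = k" using c[of "Suc l"] by (simp add: part_Cons)
  then obtain F U where T: "T = F # U" using assms(2) by (cases T) auto
  have F: "sorted F" "0 \<notin> set F" "F \<noteq> []" "column_strict U" using cs T by (auto simp: column_strict_Cons)
  have "Suc l \<le> hd F" using ge[of "hd F"] F T by (simp add: row_word_Cons)
  then have U: "Suc l < x" if "x \<in> set (row_word U)" for x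
    using tl_gt_hd[of F U x] cs T that by simp
  define R where "R = filter (\<lambda>x. \<not> x \<le> Suc l) F"
  have "filter (\<lambda>x. x \<le> Suc l) F = filter ((=) (Suc l)) F"
    using ge T by (intro filter_cong) (auto simp: row_word_Cons le_antisym)
  also have "\<dots> = replicate (count_list F (Suc l)) (Suc l)"
    by (simp add: count_list_eq_length_filter replicate_length_filter)
  also have "count_list F (Suc l) = k"
  proof -
    have "Suc l \<notin> set (row_word U)" using U by blast
    then show ?thesis using ck T by (simp add: row_word_Cons)
  qed
  finally have FR: "F = ?a @ R" using sorted_split[OF F(1), of "Suc l"] by (simp add: R_def)
  define X where "X = schensted (R @ row_word U)"
  have gt: "Suc l < x" if "x \<in> set (R @ row_word U)" for x using that U by (auto simp: R_def)
  have X: "row_word X \<approx> R @ row_word U" by (simp add: X_def knuth_schensted)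
  have cX: "column_strict X" unfolding X_def using gt by (intro column_strict_schensted) auto
  have "count_list (row_word X) i = part \<mu> (i - Suc l)" for i
  proof (cases "Suc l < i")
    case True
    then have "count_list ?a i = 0" by (simp add: count_list_0_iff)
    then have "count_list (row_word X) i = count_list (row_word T) i"
      using knuth_count[OF X, of i] T FR by (simp add: row_word_Cons)
    moreover have "i - l \<noteq> 1" "i - l - 1 = i - Suc l" using True by auto
    ultimately show ?thesis using c[of i] by (simp add: part_Cons)
  next
    case False
    then have "count_list (row_word X) i = 0" using gt[of i] knuth_set[OF X] by (auto simp: count_list_0_iff)
    then show ?thesis using False by (simp add: part_def)
  qed
  then have "content (Suc l) \<mu> X" using cX by (simp add: content_def)
  moreover have "prependable ?a (R @ row_word U)" using gt assms(2) by (fastforce simp: prependable_def)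
  then have "Cat T = prepend ?a X" using Cat_Cons[of ?a R U] cs T FR X_def by simp
  moreover have "factors R U (row_word X)"
    using F FR X by (auto simp: factors_def sorted_append knuth_sym)
  ultimately show ?thesis using that T FR by blast
qed

lemma content_small:
  assumes "content (Suc l) \<mu> X" "0 < k"
  shows "prependable (replicate k (Suc l)) (row_word X)"
proof -
  have "Suc l < x" if "x \<in> set (row_word X)" for x
  proof (rule ccontr)
    assume "\<not> ?thesis"
    then have "count_list (row_word X) x = 0" using assms(1) by (simp add: content_def part_def)
    then show False using that by (simp add: count_list_0_iff)
  qed
  then show ?thesis using assms(2) by (fastforce simp: prependable_def)
qed

lemma steps_to_std_on:
  assumes "column_strict X" "length (row_word X) = n - m"
  shows "\<exists>Y. step\<^sup>*\<^sup>* X Y \<and> std_on m n Y \<and> cat_sim X Y"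
proof -
  obtain Y where Y: "step\<^sup>*\<^sup>* X Y" "\<forall>i. count_list (row_word Y) i = (if i \<in> {m<..n} then 1 else 0)"
    using steps_to_set_ex[OF assms(1), of "{m<..n}"] assms(2) by auto
  then show ?thesis using steps_cat_sim[OF Y(1) assms(1)] by (intro exI[of _ Y]) (simp add: std_on_def)
qed

lemma cat_sim_shape: "cat_sim T S \<Longrightarrow> map length T = map length S"
  using cat_sim_Cat_iff by blast

lemma cat_sim_length: "cat_sim T S \<Longrightarrow> length (row_word T) = length (row_word S)"
  using cat_sim_shape[of T S] by (simp only: length_row_word)

text \<open>Removing the first part shifts the letters of \<open>T\<close> by one but those of
  \<open>S\<close> by \<open>k\<close>. The two tableaux are therefore tied together by their shape
  sequences alone, with independent offsets \<open>l\<close> and \<open>m\<close>.\<close>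

lemma content_runs:
  assumes "content l \<mu> T" "std_on m (m + sum_list \<mu>) S" "cat_sim T S" "0 \<notin> set \<mu>"
  shows "runs m \<mu> S"
  using assms
proof (induction \<mu> arbitrary: l m T S)
  case Nil
  then show ?case by (simp add: runs_def)
next
  case (Cons k \<mu>)
  let ?n = "m + k + sum_list \<mu>"
  let ?a = "replicate k (Suc l)" and ?b = "[Suc m..<Suc (m + k)]"
  have k: "0 < k" using Cons.prems by auto
  have S: "std_on m ?n S" using Cons.prems(2) by (simp add: add.assoc)
  have cS: "column_strict S" using S by (simp add: std_on_def)
  obtain R U X where T: "T = (?a @ R) # U" "content (Suc l) \<mu> X" "Cat T = prepend ?a X" "factors R U (row_word X)"
    by (rule content_decomp[OF Cons.prems(1) k])
  have cX: "column_strict X" using T(2) by (simp add: content_def)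
  have "length (row_word T) = k + length (row_word X)"
    using T(1,4) knuth_length[of "R @ row_word U" "row_word X"] by (auto simp: row_word_Cons factors_def)
  then have "length (row_word X) = ?n - (m + k)"
    using cat_sim_length[OF Cons.prems(3)] std_on_length[OF S] by simp
  then obtain Y where Y: "step\<^sup>*\<^sup>* X Y" "std_on (m + k) ?n Y" "cat_sim X Y" using steps_to_std_on[OF cX] by blast
  have cY: "column_strict Y" using Y by (simp add: std_on_def)
  obtain R' U' where RU: "length R' = length R" "map length U' = map length U" "factors R' U' (row_word Y)"
    using push_steps[OF Y(1) cX T(4)] by blast
  have smY: "prependable ?b (row_word Y)" using std_on_small[OF Y(2) k] .
  have "cat_sim (Cat T) (prepend ?b Y)"
    unfolding T(3) by (rule cat_sim_prepend[OF Y(3) content_small[OF T(2) k] smY _ cX cY]) (simp del: upt_Suc)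
  moreover have "cat_sim (Cat T) (Cat S)" using Cons.prems(3) cat_sim_Cat_iff by blast
  ultimately have "cat_sim (Cat S) (prepend ?b Y)" using cat_sim_sym cat_sim_trans by blast
  then have CS: "Cat S = prepend ?b Y"
    using std_on_cat_sim_eq[OF std_on_Cat[OF S] std_on_prepend[OF Y(2) k]] by simp
  have f: "sorted R'" "column_strict U'" "R' @ row_word U' \<approx> row_word Y" using RU(3) by (auto simp: factors_def)
  have "first_row S @ row_word (tl S) \<approx> row_word (prepend ?b Y)"
    using row_word_Cat[OF cS] CS knuth_sym by simp
  also have "\<dots> \<approx> ?b @ row_word Y" by (rule row_word_prepend[OF smY cY])
  also have "\<dots> \<approx> ?b @ R' @ row_word U'" using knuth_append[OF knuth_refl knuth_sym[OF f(3)]] .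
  also have "\<dots> = (?b @ R') @ row_word U'" by simp
  finally have e: "first_row S @ row_word (tl S) \<approx> (?b @ R') @ row_word U'" .
  \<comment> \<open>The pushed factorization, with the run in front, has the same product as the one
    that comes from \<open>S\<close> and the same row lengths; uniqueness in the Pieri rule
    identifies the two and puts the run into the first row of \<open>S\<close>.\<close>
  have "first_row S = ?b @ R' \<and> tl S = U'"
  proof (rule pieri_unique[OF e])
    show "distinct (first_row S @ row_word (tl S))"
      using std_on_distinct[OF S] row_word_first_row[of S] by auto
    have "set R' \<subseteq> {m + k<..?n}" using knuth_set[OF f(3)] std_on_set[OF Y(2)] by auto
    then show "sorted (?b @ R')" using f(1) by (auto simp: sorted_append simp del: upt_Suc)
    show "length (first_row S) = length (?b @ R')" "map length (tl S) = map length U'"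
      using cat_sim_shape[OF Cons.prems(3)] T(1) RU(1,2) by (cases S; simp add: first_row_def del: upt_Suc)+
  qed (use cS f in \<open>simp_all add: sorted_first_row column_strict_tl\<close>)
  then have "{m<..m + k} \<subseteq> set (first_row S)" unfolding set_interval[symmetric] by simp
  moreover have "runs (m + k) \<mu> Y" using Cons.IH[OF T(2) Y(2,3)] Cons.prems(4) by simp
  ultimately show ?case using runs_Cons[OF CS Y(2) k] by blast
qed

lemma runs_content_ex:
  assumes "std_on m (m + sum_list \<mu>) S" "runs m \<mu> S" "0 \<notin> set \<mu>" "sorted_wrt (\<ge>) \<mu>"
  shows "\<exists>T. content l \<mu> T \<and> cat_sim T S"
  using assms
proof (induction \<mu> arbitrary: l m S)
  case Nil
  then have "row_word S = []" using std_on_length[of m m S] by simp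
  then have "S = []" using row_word_eq_Nil[of S] Nil.prems(1) by (simp add: std_on_def)
  moreover have "part [] j = 0" for j by (simp add: part_def)
  ultimately show ?case by (intro exI[of _ "[]"]) (simp add: content_def cat_sim_def)
next
  case (Cons k \<mu>)
  let ?n = "m + k + sum_list \<mu>"
  let ?a = "replicate k (Suc l)" and ?b = "[Suc m..<Suc (m + k)]"
  have k: "0 < k" using Cons.prems by auto
  have S: "std_on m ?n S" using Cons.prems(1) by (simp add: add.assoc)
  have cS: "column_strict S" using S by (simp add: std_on_def)
  have "{m<..m + k} \<subseteq> set (first_row S)" using Cons.prems(2)[unfolded runs_def, rule_format, of 0] by simp
  then obtain R' U' Y where Y: "S = (?b @ R') # U'" "std_on (m + k) ?n Y" "Cat S = prepend ?b Y" "factors R' U' (row_word Y)"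
    using std_on_decomp[OF S k] by blast
  have cY: "column_strict Y" using Y by (simp add: std_on_def)
  have "runs (m + k) \<mu> Y" using runs_Cons[OF Y(3,2) k] Cons.prems(2) by blast
  then obtain X where X: "content (Suc l) \<mu> X" "cat_sim X Y"
    using Cons.IH[OF Y(2)] Cons.prems(3,4) by auto
  have cX: "column_strict X" using X(1) by (simp add: content_def)
  have "length (row_word X) = ?n - (m + k)" using cat_sim_length[OF X(2)] std_on_length[OF Y(2)] by simp
  then obtain Y' where Y': "step\<^sup>*\<^sup>* X Y'" "std_on (m + k) ?n Y'" "cat_sim X Y'" using steps_to_std_on[OF cX] by blast
  \<comment> \<open>\<open>X\<close> has the shape sequence of \<open>Y\<close> and of its own
    standardization \<open>Y'\<close>, so the two standard tableaux coincide and the steps lead to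
    \<open>Y\<close> itself.\<close>
  have "Y' = Y" using std_on_cat_sim_eq[OF Y'(2) Y(2)] X(2) Y'(3) cat_sim_sym cat_sim_trans by blast
  then have st: "step\<^sup>*\<^sup>* X Y" using Y'(1) by simp
  \<comment> \<open>Removing the run from the first row of \<open>S\<close> costs at most
    \<open>k\<close> at each threshold.\<close>
  have "below k (first_row U') R'"
    unfolding below_def
  proof
    fix x
    show "num_le x (first_row U') \<le> k + num_less x R'"
    proof (cases U')
      case (Cons H V)
      then have "below 0 H (?b @ R')" using cS Y(1) by (simp add: column_strict_Cons del: upt_Suc)
      then have "num_le x H \<le> num_less x ?b + num_less x R'"
        unfolding below_def by (simp del: upt_Suc)
      moreover have "num_less x ?b \<le> k"
        using length_filter_le[of "\<lambda>y. y < x" ?b] by (simp del: upt_Suc)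
      ultimately show ?thesis using Cons by (simp add: first_row_def)
    qed (simp add: first_row_def)
  qed
  moreover have "\<forall>i. count_list (row_word X) i \<le> k"
  proof
    fix i
    have "part \<mu> j \<le> k" for j using Cons.prems(4) by (auto simp: part_def)
    then show "count_list (row_word X) i \<le> k" using X(1) by (simp add: content_def)
  qed
  ultimately obtain R U where RU: "length R = length R'" "map length U = map length U'"
      "factors R U (row_word X)" "below k (first_row U) R"
    using pull_steps[OF st cX Y(4)] by blast
  define T where "T = (?a @ R) # U"
  have f: "sorted R" "column_strict U" "0 \<notin> set R" "R @ row_word U \<approx> row_word X" using RU(3) by (auto simp: factors_def)
  have gt: "Suc l < x" if "x \<in> set (R @ row_word U)" for x
  proof (rule ccontr)
    assume "\<not> ?thesis"
    then have "count_list (R @ row_word U) x = 0" using knuth_count[OF f(4)] X(1) by (simp add: content_def part_def)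
    then show False using that by (simp add: count_list_0_iff)
  qed
  have cT: "column_strict T"
    unfolding T_def column_strict_Cons
  proof (intro conjI impI)
    show "sorted (?a @ R)" using f(1) gt by (auto simp: sorted_append less_imp_le)
    assume "U \<noteq> []"
    then have hd: "first_row U = hd U" "set (hd U) \<subseteq> set (row_word U)" by (cases U; auto simp: first_row_def row_word_Cons)+
    show "below 0 (hd U) (?a @ R)"
      unfolding below_def
    proof
      fix x
      \<comment> \<open>Above the letter \<open>l + 1\<close> its \<open>k\<close> copies count in
        full and make up for the offset; at smaller thresholds no letter of \<open>U\<close>
        counts.\<close>
      show "num_le x (hd U) \<le> 0 + num_less x (?a @ R)"
      proof (cases "Suc l < x")
        case True
        then show ?thesis using RU(4)[unfolded below_def, rule_format, of x] hd(1) by simp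
      next
        case False
        then have "\<forall>y\<in>set (hd U). \<not> y \<le> x" using gt hd(2) by fastforce
        then show ?thesis by simp
      qed
    qed
  qed (use k f in auto)
  have "prependable ?a (R @ row_word U)"
    using content_small[OF X(1) k] unfolding prependable_def knuth_set[OF f(4)] .
  then have "Cat T = prepend ?a (schensted (R @ row_word U))" using Cat_Cons cT unfolding T_def by blast
  also have "schensted (R @ row_word U) = X" using schensted_unique[OF cX knuth_sym[OF f(4)]] by simp
  finally have CT: "Cat T = prepend ?a X" .
  have "cat_sim (prepend ?a X) (prepend ?b Y)"
    by (rule cat_sim_prepend[OF X(2) content_small[OF X(1) k] std_on_small[OF Y(2) k] _ cX cY]) (simp del: upt_Suc)
  moreover have "map length T = map length S" using RU(1,2) Y(1) by (simp add: T_def del: upt_Suc)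
  ultimately have "cat_sim T S" using cat_sim_Cat_iff CT Y(3) by metis
  moreover have "content l (k # \<mu>) T"
  proof -
    have "count_list (row_word T) i = part (k # \<mu>) (i - l)" for i
    proof -
      have "count_list (row_word T) i = count_list ?a i + count_list (row_word X) i"
        using knuth_count[OF f(4), of i] by (simp add: T_def row_word_Cons)
      moreover have "count_list ?a i = (if i = Suc l then k else 0)" by (induction k) auto
      ultimately show ?thesis using X(1) by (auto simp: content_def part_Cons part_def)
    qed
    then show ?thesis using cT by (simp add: content_def)
  qed
  ultimately show ?case by blast
qed

section \<open>Catabolism type\<close>

lemma le_d1_iff: "j \<le> d1 S \<longleftrightarrow> {0<..j} \<subseteq> set (first_row S)"
proof -
  let ?F = "set (first_row S)"
  let ?A = "{i. {1..i} \<subseteq> ?F}"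
  \<comment> \<open>This bounds the lengths of runs, so that \<open>Max\<close> in the definition of
    \<open>d1\<close> is taken over a finite set.\<close>
  have "i \<le> card ?F" if "{1..i} \<subseteq> ?F" for i
    using card_mono[OF _ that] by simp
  then have "finite ?A" by (auto intro: finite_subset[of _ "{..card ?F}"])
  moreover have "0 \<in> ?A" by simp
  ultimately have m: "d1 S \<in> ?A" "\<And>i. i \<in> ?A \<Longrightarrow> i \<le> d1 S"
    unfolding d1_def using Max_in[of ?A] Max_ge[of ?A] by blast+
  have i: "{0<..j} = {1..j}" by auto
  show ?thesis
  proof
    assume "j \<le> d1 S"
    then have "{1..j} \<subseteq> {1..d1 S}" by auto
    then show "{0<..j} \<subseteq> ?F" using m(1) i by auto
  next
    assume "{0<..j} \<subseteq> ?F"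
    then show "j \<le> d1 S" using m(2) i by simp
  qed
qed

lemma low_0: "r \<notin> set u \<Longrightarrow> low r u = 0"
  by (induction u) auto

lemma high_pos: "Suc r \<in> set u \<Longrightarrow> r \<notin> set u \<Longrightarrow> 0 < high r u"
  by (induction u) (auto simp: low_0)

lemma high_0: "Suc r \<notin> set u \<Longrightarrow> high r u = 0"
  by (induction u) auto

lemma length_filter_distinct: "distinct w \<Longrightarrow> length (filter P w) = card {x \<in> set w. P x}"
  by (metis distinct_card distinct_filter set_filter)

text \<open>
  In a word without repetitions \<open>x\<close> precedes \<open>x + 1\<close> iff \<open>x\<close> is unpaired, so this order is
  invariant under Knuth equivalence.
\<close>

lemma run_Cat_bound:
  assumes "std_on m n Y" "{m<..m + e} \<subseteq> set (first_row Y)" "Suc (m + e) \<notin> set (first_row Y)"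
  shows "\<not> {m<..m + 2 * e + 1} \<subseteq> set (first_row (Cat Y))"
proof
  assume sub: "{m<..m + 2 * e + 1} \<subseteq> set (first_row (Cat Y))"
  have cY: "column_strict Y" using assms by (simp add: std_on_def)
  note V = std_on_Cat[OF assms(1)]
  have cV: "column_strict (Cat Y)" using V by (simp add: std_on_def)
  let ?w = "first_row Y @ row_word (tl Y)"
  have dw: "distinct ?w" using std_on_distinct[OF assms(1)] row_word_first_row[of Y] by auto
  have sw: "set ?w = {m<..n}" using std_on_set[OF assms(1)] row_word_first_row[of Y] by auto
  have inw: "{m<..m + 2 * e + 1} \<subseteq> set ?w"
    using sub std_on_set[OF V] row_word_first_row[of "Cat Y"] sw by (metis Un_iff set_append subset_iff)
  \<comment> \<open>Neighbouring letters in one increasing row leave \<open>x\<close> unpaired.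
    Carried over to \<open>?w\<close>, this says that \<open>x\<close> precedes \<open>x + 1\<close>
    there.\<close>
  have p: "0 < low x ?w" if "m < x" "x < m + 2 * e + 1" for x
  proof -
    have xs: "x \<in> set (first_row (Cat Y))" "Suc x \<in> set (first_row (Cat Y))" using sub that by auto
    have "distinct (row_word (tl (Cat Y)) @ first_row (Cat Y))"
      using std_on_distinct[OF V] row_word_first_row[of "Cat Y"] by simp
    then have "Suc x \<notin> set (row_word (tl (Cat Y)))" using xs by auto
    then have "high x (row_word (tl (Cat Y))) = 0" by (rule high_0)
    moreover have "0 < low x (first_row (Cat Y))"
      using low_sorted[OF sorted_first_row[OF cV], of x] xs by (metis count_list_0_iff neq0_conv)
    ultimately have "0 < low x (row_word (Cat Y))" using row_word_first_row[of "Cat Y"] by simp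
    then show ?thesis using knuth_stats[OF row_word_Cat[OF cY], of x] by presburger
  qed
  have "Suc (m + e) \<in> {m<..m + 2 * e + 1}" by simp
  then have "Suc (m + e) \<in> set ?w" using inw by blast
  then have t: "Suc (m + e) \<in> set (row_word (tl Y))" using assms(3) by auto
  then obtain F H U where Y: "Y = F # H # U" by (cases Y; cases "tl Y") auto
  have F: "first_row Y = F" "tl Y = H # U" "sorted F" "sorted H" "H \<noteq> []" "below 0 H F" "column_strict (H # U)"
    using cY Y by (auto simp: first_row_def column_strict_Cons)
  have dw': "distinct (F @ row_word U @ H)" using dw F by (simp add: row_word_Cons)
  \<comment> \<open>The smallest letter missing from the first row has to head the second one, since
    everything below the second row exceeds its head.\<close>
  have hdH: "hd H = Suc (m + e)"
  proof (rule antisym)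
    show "hd H \<le> Suc (m + e)"
    proof (cases "Suc (m + e) \<in> set H")
      case True then show ?thesis using F(4) by (cases H) auto
    next
      case False
      then have "Suc (m + e) \<in> set (row_word U)" using t F(2) by (simp add: row_word_Cons)
      then show ?thesis using tl_gt_hd[OF F(7)] by (simp add: less_imp_le)
    qed
    have "hd H \<in> set H" using F(5) by simp
    then have "m < hd H" "hd H \<notin> set F" using sw dw' F by (auto simp: row_word_Cons)
    then have "hd H \<notin> {m<..m + e}" using assms(2) F(1) by blast
    then show "Suc (m + e) \<le> hd H" using \<open>m < hd H\<close> by auto
  qed
  \<comment> \<open>The row \<open>H\<close> comes last in \<open>?w\<close>. Once \<open>x\<close>
    lies in it, \<open>x + 1\<close> can follow \<open>x\<close> only within
    \<open>H\<close>.\<close>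
  have inH: "Suc (m + e + i) \<in> set H" if "i \<le> e" for i
    using that
  proof (induction i)
    case 0
    then show ?case using hdH F(5) by (metis add_0_right hd_in_set)
  next
    case (Suc i)
    let ?x = "Suc (m + e + i)"
    have x: "?x \<in> set H" using Suc by simp
    show ?case
    proof (rule ccontr)
      assume n: "Suc (m + e + Suc i) \<notin> set H"
      have "Suc ?x \<in> {m<..m + 2 * e + 1}" using Suc.prems by auto
      then have "Suc ?x \<in> set ?w" using inw by blast
      then have "Suc ?x \<in> set (F @ row_word U)" using n F by (auto simp: row_word_Cons)
      moreover have nx: "?x \<notin> set (F @ row_word U)" using x dw' by auto
      ultimately have "0 < high ?x (F @ row_word U)" by (rule high_pos)
      moreover have "low ?x H \<le> 1"
      proof -
        have "distinct H" using dw' by simp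
        then have "count_list H ?x \<le> 1" by (induction H) auto
        then show ?thesis using low_sorted[OF F(4)] by simp
      qed
      moreover have "low ?x ((F @ row_word U) @ H) = low ?x H - high ?x (F @ row_word U)"
        using low_append[of ?x "F @ row_word U" H] unfolding low_0[OF nx] by (rule trans) (rule add_0)
      ultimately have "low ?x ((F @ row_word U) @ H) = 0" by linarith
      moreover have "0 < low ?x ?w" using p[of ?x] Suc.prems by simp
      ultimately show False using F by (simp add: row_word_Cons del: low_append)
    qed
  qed
  let ?t = "m + 2 * e + 1"
  have subH: "{m + e<..?t} \<subseteq> set H"
  proof
    fix x assume "x \<in> {m + e<..?t}"
    then have "x = Suc (m + e + (x - Suc (m + e)))" "x - Suc (m + e) \<le> e" by auto
    then show "x \<in> set H" using inH by metis
  qed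
  have dF: "distinct F" "distinct H" "set F \<inter> set H = {}" using dw' by auto
  \<comment> \<open>The count that gives the contradiction: \<open>e + 1\<close> letters of
    \<open>H\<close> need as many smaller letters in the row above, but below \<open>?t\<close> that
    row has only the \<open>e\<close> letters of the run.\<close>
  have "Suc e = card {m + e<..?t}" by simp
  also have "\<dots> \<le> card {x \<in> set H. x \<le> ?t}" using subH by (intro card_mono) auto
  also have "\<dots> = num_le ?t H" using length_filter_distinct[OF dF(2)] by simp
  also have "\<dots> \<le> num_less ?t F" using F(6) by (simp add: below_def)
  also have "\<dots> = card {x \<in> set F. x < ?t}" using length_filter_distinct[OF dF(1)] by simp
  also have "\<dots> \<le> card {m<..m + e}"
  proof (rule card_mono)
    show "{x \<in> set F. x < ?t} \<subseteq> {m<..m + e}"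
    proof
      fix x assume "x \<in> {x \<in> set F. x < ?t}"
      then have x: "x \<in> set F" "x < ?t" "x \<notin> set H" using dF(3) by auto
      then have "x \<notin> {m + e<..?t}" using subH by blast
      moreover have "m < x" using x(1) sw F(1) by auto
      ultimately show "x \<in> {m<..m + e}" using x(2) by auto
    qed
  qed simp
  also have "\<dots> = e" by simp
  finally show False by simp
qed

text \<open>Applied to the tableau behind the run of an earlier stage, \<open>run_Cat_bound\<close>
  says that no increment of \<open>D\<close> exceeds the preceding one. From index
  \<open>n - 1\<close> on \<open>D\<close> is constantly \<open>n\<close>, so partial sums beyond
  the end of the list agree too.\<close>

lemma cattype_partition:
  assumes "std_on 0 n S" "0 < n"
  defines "D \<equiv> \<lambda>i. d1 ((Cat ^^ i) S)"
  shows "sorted_wrt (\<ge>) (cattype S)" "\<And>i. sum_list (take (Suc i) (cattype S)) = D i" "sum_list (cattype S) = n"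
proof -
  have len: "length (row_word S) = n" using std_on_length[OF assms(1)] by simp
  have std_on: "std_on 0 n ((Cat ^^ i) S)" for i using std_on_Cat_funpow[OF assms(1)] .
  have le: "j \<le> D i \<longleftrightarrow> {0<..j} \<subseteq> set (first_row ((Cat ^^ i) S))" for i j
    by (simp add: D_def le_d1_iff)
  have lower: "Suc i \<le> D i" if "i < n" for i
    using std_on_run[OF assms(1), of i] that le by simp
  have upper: "D i \<le> n" for i
  proof -
    have "{0<..D i} \<subseteq> set (row_word ((Cat ^^ i) S))" using le[of "D i" i] row_word_first_row[of "(Cat ^^ i) S"] by auto
    then have "{0<..D i} \<subseteq> {0<..n}" using std_on_set[OF std_on] by simp
    then show ?thesis by (cases "D i") auto
  qed
  have D0: "0 < D i" for i
  proof -
    have "Suc 0 \<in> set (first_row ((Cat ^^ i) S))" using std_on_min[OF std_on assms(2)] .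
    then have "{0<..1} \<subseteq> set (first_row ((Cat ^^ i) S))" by (auto simp: le_Suc_eq)
    then show ?thesis using le[of 1 i] by simp
  qed
  have next_ex: "\<exists>Y. std_on (D i) n Y \<and> Cat ((Cat ^^ i) S) = prepend [1..<Suc (D i)] Y" for i
  proof -
    have "{0<..0 + D i} \<subseteq> set (first_row ((Cat ^^ i) S))" using le[of "D i" i] by simp
    then obtain Y where "std_on (0 + D i) n Y" "Cat ((Cat ^^ i) S) = prepend [Suc 0..<Suc (0 + D i)] Y"
      using std_on_decomp[OF std_on D0] by blast
    then show ?thesis by auto
  qed
  have step: "D i \<le> D (Suc i)" "D (Suc (Suc i)) \<le> D (Suc i) + (D (Suc i) - D i)" for i
  proof -
    obtain Y where Y: "std_on (D i) n Y" "Cat ((Cat ^^ i) S) = prepend [1..<Suc (D i)] Y" using next_ex by blast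
    have cY: "column_strict Y" using Y by (simp add: std_on_def)
    have sm: "prependable [1..<Suc (D i)] (row_word Y)" using std_on_small[of 0 "D i" n Y] Y(1) D0 by simp
    have Z1: "(Cat ^^ Suc i) S = prepend [1..<Suc (D i)] Y" using Y(2) by simp
    then have "(Cat ^^ Suc (Suc i)) S = Cat (prepend [1..<Suc (D i)] Y)" by simp
    then have Z2: "(Cat ^^ Suc (Suc i)) S = prepend [1..<Suc (D i)] (Cat Y)" using Cat_prepend[OF sm cY] by simp
    have s: "set [1..<Suc (D i)] = {0<..D i}" by (auto simp del: upt_Suc)
    have f1: "set (first_row ((Cat ^^ Suc i) S)) = {0<..D i} \<union> set (first_row Y)"
      unfolding Z1 first_row_prepend set_append s ..
    have f2: "set (first_row ((Cat ^^ Suc (Suc i)) S)) = {0<..D i} \<union> set (first_row (Cat Y))"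
      unfolding Z2 first_row_prepend set_append s ..
    show m: "D i \<le> D (Suc i)" unfolding le f1 by simp
    \<comment> \<open>This is the exact length of the initial run of \<open>Y\<close>: the first
      \<open>D i\<close> letters are prepended, and a longer run in \<open>Y\<close> would lengthen
      that of stage \<open>i + 1\<close>.\<close>
    define e where "e = D (Suc i) - D i"
    have e: "D (Suc i) = D i + e" using m by (simp add: e_def)
    have disj: "{D i<..b} \<subseteq> B" if "{0<..b} \<subseteq> {0<..D i} \<union> B" for b B
    proof
      fix x assume "x \<in> {D i<..b}"
      then have "x \<in> {0<..b}" "x \<notin> {0<..D i}" by auto
      then show "x \<in> B" using that by blast
    qed
    have "{D i<..D i + e} \<subseteq> set (first_row Y)"
      using le[of "D i + e" "Suc i"] e f1 disj by simp
    moreover have "Suc (D i + e) \<notin> set (first_row Y)"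
    proof
      assume "Suc (D i + e) \<in> set (first_row Y)"
      then have "Suc (D i + e) \<in> set (first_row ((Cat ^^ Suc i) S))" unfolding f1 by (rule UnI2)
      moreover have "{0<..D i + e} \<subseteq> set (first_row ((Cat ^^ Suc i) S))" using le[of "D i + e" "Suc i"] e by simp
      moreover have "{0<..Suc (D i + e)} = insert (Suc (D i + e)) {0<..D i + e}" by auto
      ultimately have "{0<..Suc (D i + e)} \<subseteq> set (first_row ((Cat ^^ Suc i) S))"
        by (simp only: insert_subset)
      then show False using le[of "Suc (D i + e)" "Suc i"] e by simp
    qed
    ultimately have nsub: "\<not> {D i<..D i + 2 * e + 1} \<subseteq> set (first_row (Cat Y))"
      by (rule run_Cat_bound[OF Y(1)])
    have "\<not> D i + 2 * e + 1 \<le> D (Suc (Suc i))"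
      unfolding le f2 using nsub disj by blast
    then show "D (Suc (Suc i)) \<le> D (Suc i) + (D (Suc i) - D i)" using e by simp
  qed
  \<comment> \<open>The first two parts are compared by the same bound, now for \<open>S\<close>
    itself with nothing removed.\<close>
  have D1: "D 1 \<le> 2 * D 0"
  proof -
    have "{0<..0 + D 0} \<subseteq> set (first_row S)" using le[of "D 0" 0] by simp
    moreover have "Suc (0 + D 0) \<notin> set (first_row S)"
    proof
      assume "Suc (0 + D 0) \<in> set (first_row S)"
      moreover have "{0<..Suc (D 0)} = insert (Suc (D 0)) {0<..D 0}" by auto
      ultimately have "{0<..Suc (D 0)} \<subseteq> set (first_row S)"
        using \<open>{0<..0 + D 0} \<subseteq> set (first_row S)\<close> by (simp only: insert_subset add_0 simp_thms)
      then show False using le[of "Suc (D 0)" 0] by simp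
    qed
    ultimately have "\<not> {0<..0 + 2 * D 0 + 1} \<subseteq> set (first_row (Cat S))"
      by (rule run_Cat_bound[OF assms(1)])
    then have "\<not> 2 * D 0 + 1 \<le> D 1" using le[of "2 * D 0 + 1" 1] by simp
    then show ?thesis by simp
  qed
  let ?c = "cattype S"
  have lc: "length ?c = n" by (simp add: cattype_def len)
  have c: "?c ! i = (if i = 0 then D 0 else D i - D (i - 1))" if "i < n" for i
    using that by (simp add: cattype_def len D_def)
  have take_lt: "sum_list (take (Suc i) ?c) = D i" if "i < n" for i
    using that
  proof (induction i)
    case 0
    then show ?case using c[of 0] lc by (cases ?c) auto
  next
    case (Suc i)
    then show ?case using c[of "Suc i"] lc step(1)[of i] by (simp add: take_Suc_conv_app_nth)
  qed
  have last: "D i = n" if "n \<le> Suc i" for i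
  proof -
    have "D (n - 1) \<le> D i" using lift_Suc_mono_le[of D "n - 1" i] step(1) that by simp
    then show ?thesis using lower[of "n - 1"] upper[of i] assms(2) by simp
  qed
  show sum: "sum_list ?c = n" using take_lt[of "n - 1"] last[of "n - 1"] assms(2) lc by simp
  show "sum_list (take (Suc i) ?c) = D i" for i
  proof (cases "i < n")
    case False
    then show ?thesis using last[of i] sum lc by simp
  qed (rule take_lt)
  show "sorted_wrt (\<ge>) ?c"
  proof (subst sorted_wrt_iff_nth_Suc_transp)
    show "transp ((\<ge>) :: nat \<Rightarrow> nat \<Rightarrow> bool)" by (auto intro: transpI)
    show "\<forall>i. Suc i < length ?c \<longrightarrow> ?c ! i \<ge> ?c ! Suc i"
    proof (intro allI impI)
      fix i assume i: "Suc i < length ?c"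
      show "?c ! i \<ge> ?c ! Suc i"
      proof (cases i)
        case 0
        then show ?thesis using c[of 0] c[of 1] i lc D1 by simp
      next
        case (Suc j)
        then show ?thesis using c[of i] c[of "Suc i"] i lc step(2)[of j] by simp
      qed
    qed
  qed
qed

lemma sort_parts_id: "sorted_wrt (\<ge>) \<alpha> \<Longrightarrow> sort_parts \<alpha> = \<alpha>"
proof -
  assume "sorted_wrt (\<ge>) \<alpha>"
  then have "sorted (rev \<alpha>)" by (simp add: sorted_wrt_rev)
  then have "sort (rev \<alpha>) = rev \<alpha>" by (rule sorted_sort_id)
  moreover have "sort (rev \<alpha>) = sort \<alpha>" by (rule properties_for_sort) auto
  ultimately show "sort_parts \<alpha> = \<alpha>" by (simp add: sort_parts_def)
qed

lemma cattype_dominates_iff: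
  assumes "std_on 0 n S" "partition_of \<mu> n"
  shows "cattype S \<unrhd> \<mu> \<longleftrightarrow> runs 0 \<mu> S"
proof (cases "n = 0")
  case True
  then have mu: "\<mu> = []" using assms(2) by (cases \<mu>) (auto simp: partition_of_def)
  have "length (row_word S) = 0" using std_on_length[OF assms(1)] True by simp
  then have "cattype S = []" by (simp add: cattype_def)
  then show ?thesis using mu by (simp add: dominates_def runs_def)
next
  case False
  let ?c = "cattype S"
  have n: "0 < n" using False by simp
  note C = cattype_partition[OF assms(1) n]
  have mu: "sum_list \<mu> = n" "sort_parts \<mu> = \<mu>" using assms(2) sort_parts_id by (auto simp: partition_of_def)
  have "?c \<unrhd> \<mu> \<longleftrightarrow> (\<forall>i. sum_list (take i \<mu>) \<le> sum_list (take i ?c))"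
    using C(3) mu sort_parts_id[OF C(1)] by (simp add: dominates_def)
  also have "\<dots> \<longleftrightarrow> (\<forall>i. sum_list (take (Suc i) \<mu>) \<le> sum_list (take (Suc i) ?c))"
    by (metis le0 not0_implies_Suc sum_list.Nil take0)
  also have "\<dots> \<longleftrightarrow> runs 0 \<mu> S" unfolding C(2) le_d1_iff runs_def by simp
  finally show ?thesis .
qed

lemma content_iff: "content 0 \<mu> T \<longleftrightarrow> T \<in> tableaux \<mu>"
  by (simp add: content_def tableaux_def)

lemma std_on_iff: "std_on 0 n S \<longleftrightarrow> S \<in> standard_tableaux n"
proof -
  have "part (replicate n 1) i = (if 0 < i \<and> i \<le> n then 1 else 0)" for i by (auto simp: part_def)
  then show ?thesis unfolding std_on_def tableaux_def mem_Collect_eq by presburger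
qed

theorem theorem45:
  fixes \<mu> :: "nat list" and n :: nat
  assumes "partition_of \<mu> n"
  shows "standardization_embedding \<mu> ` tableaux \<mu> =
    {S \<in> standard_tableaux n. cattype S \<unrhd> \<mu>}"
proof -
  let ?F = "standardization_embedding \<mu>"
  have mu: "sum_list \<mu> = n" "0 \<notin> set \<mu>" "sorted_wrt (\<ge>) \<mu>" using assms by (auto simp: partition_of_def)
  have F: "std_on 0 n (?F T) \<and> cat_sim T (?F T)" if "T \<in> tableaux \<mu>" for T
  proof -
    have "?F T \<in> standard_tableaux n \<and> step\<^sup>*\<^sup>* T (?F T)"
      using composite_embedding_steps[OF standardization_embedding_composite that] mu(1) by simp
    moreover have "column_strict T" using that by (simp add: tableaux_def)
    ultimately show ?thesis using steps_cat_sim std_on_iff by blast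
  qed
  show ?thesis
  proof (intro equalityI subsetI)
    fix S assume "S \<in> ?F ` tableaux \<mu>"
    then obtain T where T: "T \<in> tableaux \<mu>" "S = ?F T" by blast
    then have S: "std_on 0 n S" "cat_sim T S" using F by auto
    then have "runs 0 \<mu> S" using content_runs[of 0 \<mu> T 0 S] content_iff T(1) mu by simp
    then show "S \<in> {S \<in> standard_tableaux n. cattype S \<unrhd> \<mu>}"
      using cattype_dominates_iff[OF S(1) assms] S(1) std_on_iff by blast
  next
    fix S assume "S \<in> {S \<in> standard_tableaux n. cattype S \<unrhd> \<mu>}"
    then have S: "std_on 0 n S" "runs 0 \<mu> S" using cattype_dominates_iff[OF _ assms] std_on_iff by auto
    then obtain T where T: "T \<in> tableaux \<mu>" "cat_sim T S"
      using runs_content_ex[of 0 \<mu> S 0] mu content_iff by auto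
    \<comment> \<open>Both tableaux are standard and have the shape sequence of \<open>T\<close>,
      which determines a standard tableau.\<close>
    then have "S = ?F T" using std_on_cat_sim_eq[OF S(1)] F[OF T(1)] cat_sim_sym cat_sim_trans by blast
    then show "S \<in> ?F ` tableaux \<mu>" using T(1) by blast
  qed
qed

end
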